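(* Let $c>0$ and $s\ge 3$, and let $\varphi_c$ be the periodic peakon profile $\varphi_c(x)=\sqrt{c}\,\dfrac{\cosh(\frac12-x+[x])}{\cosh(\frac12)}$ on $\mathbb{S}=\mathbb{R}/\mathbb{Z}$. For every $\epsilon>0$ there exists $\delta>0$ such that the following holds. If $u_0\in H^s(\mathbb{S})$ satisfies $y_0=u_0-\partial_x^2u_0\ge 0$ and $$\|u_0-\varphi_c\|_{H^1(\mathbb{S})}<\delta,$$ then the corresponding global strong solution $u(t)$ of the Cauchy problem for the Novikov equation on $\mathbb{S}$ with initial data $u(0)=u_0$ satisfies $$\sup_{t\ge 0}\|u(t,\cdot)-\varphi_c(\cdot-\xi(t))\|_{H^1(\mathbb{S})}<\epsilon,$$ where, for each $t\geq 0$, $\xi(t)\in\mathbb{R}$ is any point at which the function $u(t,\cdot)$ attains its maximum.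
   Context: $\mathbb{S}=\mathbb{R}/\mathbb{Z}$ is the unit circle; functions on $\mathbb{S}$ are regarded as functions on $\mathbb{R}$ of period one. $[x]$ denotes the largest integer not exceeding $x$. The norm is $\|f\|_{H^1(\mathbb{S})}^2=\int_{\mathbb{S}}(f^2+f_x^2)\,dx$. The Cauchy problem for the Novikov equation on $\mathbb{S}$ is $$y_t+u^2y_x+3uu_xy=0,\quad y=u-u_{xx},\quad t>0,\ x\in\mathbb{S};\qquad u(0,x)=u_0(x),\ x\in\mathbb{S}.$$ A strong solution on $[0,T)$ is a function $u\in C([0,T);H^s(\mathbb{S}))\cap C^1([0,T);H^{s-1}(\mathbb{S}))$ satisfying this problem; it is global if this holds for every $T>0$. It is known that for $u_0\in H^s(\mathbb{S})$, $s\ge 3$, with $u_0-\partial_x^2u_0\ge0$, there is a unique global strong solution $u\in C([0,\infty);H^s(\mathbb{S}))\cap C^1([0,\infty);H^{s-1}(\mathbb{S}))$; this is the "corresponding solution". *)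

theory Defs
  imports "HOL-Analysis.Analysis"
begin

text \<open>
  Functions on the circle \<open>\<real>/\<int>\<close> are functions on \<open>\<real>\<close> of period one.  All notions below except
  the continuity clause in \<open>strong_solution\<close> are insensitive to changes on a (periodic) null set.
\<close>

definition periodic1 :: "(real \<Rightarrow> 'a) \<Rightarrow> bool" where
  "periodic1 f \<longleftrightarrow> (\<forall>x. f (x + 1) = f x)"

definition L2_circle :: "(real \<Rightarrow> real) \<Rightarrow> bool" where
  "L2_circle f \<longleftrightarrow> periodic1 f \<and> f \<in> borel_measurable lebesgue \<and>
     (\<lambda>x. (f x)\<^sup>2) absolutely_integrable_on {0..1}"

definition fourier_coeff :: "(real \<Rightarrow> real) \<Rightarrow> int \<Rightarrow> complex" where
  "fourier_coeff f k =
     (LINT x:{0..1}|lebesgue. complex_of_real (f x) * cis (- (2 * pi * of_int k * x)))"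

text \<open>
  \<open>H\<^sup>s\<close> of the circle for real \<open>s \<ge> 0\<close>; the weight is the Fourier symbol of \<open>(1 - \<partial>\<^sub>x\<^sup>2)\<^sup>s\<close>.
  The sum in \<open>sobolev_norm\<close> is meaningful only for members of \<open>H\<^sup>s\<close>.
\<close>

definition sobolev_weight :: "real \<Rightarrow> int \<Rightarrow> real" where
  "sobolev_weight s k = (1 + (2 * pi * of_int k)\<^sup>2) powr s"

definition sobolev :: "real \<Rightarrow> (real \<Rightarrow> real) \<Rightarrow> bool" where
  "sobolev s f \<longleftrightarrow> L2_circle f \<and>
     (\<lambda>k. sobolev_weight s k * (cmod (fourier_coeff f k))\<^sup>2) summable_on UNIV"

definition sobolev_norm :: "real \<Rightarrow> (real \<Rightarrow> real) \<Rightarrow> real" where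
  "sobolev_norm s f =
     sqrt (\<Sum>\<^sub>\<infinity>k\<in>UNIV. sobolev_weight s k * (cmod (fourier_coeff f k))\<^sup>2)"

definition test_function :: "(real \<Rightarrow> real) \<Rightarrow> bool" where
  "test_function \<phi> \<longleftrightarrow> periodic1 \<phi> \<and> (\<forall>n x. (deriv ^^ n) \<phi> differentiable (at x))"

definition has_weak_deriv :: "(real \<Rightarrow> real) \<Rightarrow> (real \<Rightarrow> real) \<Rightarrow> bool" where
  "has_weak_deriv f g \<longleftrightarrow>
     periodic1 f \<and> f absolutely_integrable_on {0..1} \<and>
     periodic1 g \<and> g absolutely_integrable_on {0..1} \<and>
     (\<forall>\<phi>. test_function \<phi> \<longrightarrow>
        (LINT x:{0..1}|lebesgue. f x * deriv \<phi> x) = - (LINT x:{0..1}|lebesgue. g x * \<phi> x))"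

text \<open>
  The weak derivative is unique only up to null sets, so \<open>weak_deriv f\<close> is some representative.
  It is used only under integrals, almost everywhere, or through \<open>sobolev\<close> and \<open>sobolev_norm\<close>.
\<close>

definition weak_deriv :: "(real \<Rightarrow> real) \<Rightarrow> real \<Rightarrow> real" where
  "weak_deriv f = (SOME g. has_weak_deriv f g)"

definition H1_norm :: "(real \<Rightarrow> real) \<Rightarrow> real" where
  "H1_norm f = sqrt (LINT x:{0..1}|lebesgue. (f x)\<^sup>2 + (weak_deriv f x)\<^sup>2)"

definition sobolev_continuous_on :: "real \<Rightarrow> real set \<Rightarrow> (real \<Rightarrow> real \<Rightarrow> real) \<Rightarrow> bool" where
  "sobolev_continuous_on s I u \<longleftrightarrow>
     (\<forall>t\<in>I. sobolev s (u t)) \<and>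
     (\<forall>t\<in>I. ((\<lambda>r. sobolev_norm s (\<lambda>x. u r x - u t x)) \<longlongrightarrow> 0) (at t within I))"

definition has_sobolev_deriv ::
    "real \<Rightarrow> (real \<Rightarrow> real \<Rightarrow> real) \<Rightarrow> (real \<Rightarrow> real) \<Rightarrow> real \<Rightarrow> real set \<Rightarrow> bool" where
  "has_sobolev_deriv s u v t I \<longleftrightarrow>
     (\<forall>r\<in>I. sobolev s (u r)) \<and> sobolev s v \<and>
     ((\<lambda>r. sobolev_norm s (\<lambda>x. (u r x - u t x) / (r - t) - v x)) \<longlongrightarrow> 0) (at t within I)"

definition sobolev_C1_on :: "real \<Rightarrow> real set \<Rightarrow> (real \<Rightarrow> real \<Rightarrow> real) \<Rightarrow> bool" where
  "sobolev_C1_on s I u \<longleftrightarrow>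
     (\<exists>v. (\<forall>t\<in>I. has_sobolev_deriv s u (v t) t I) \<and> sobolev_continuous_on s I v)"

definition momentum :: "(real \<Rightarrow> real) \<Rightarrow> real \<Rightarrow> real" where
  "momentum f x = f x - weak_deriv (weak_deriv f) x"

text \<open>
  For \<open>s \<ge> 3\<close> the derivative \<open>y\<^sub>t\<close> is that of the \<open>H\<^bsup>s-3\<^esup>\<close>-valued map \<open>t \<mapsto> y(t)\<close>, and all terms of
  the equation are square integrable functions of \<open>x\<close>.  The continuity clause selects the continuous
  representative of \<open>u(t)\<close>, which is needed to speak of points where \<open>u(t)\<close> attains its maximum.
\<close>

definition novikov_at :: "real \<Rightarrow> real \<Rightarrow> (real \<Rightarrow> real \<Rightarrow> real) \<Rightarrow> real \<Rightarrow> bool" where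
  "novikov_at s T u t \<longleftrightarrow>
     (\<exists>y\<^sub>t. has_sobolev_deriv (s - 3) (\<lambda>r. momentum (u r)) y\<^sub>t t {0..<T} \<and>
        (AE x in lebesgue.
           y\<^sub>t x + (u t x)\<^sup>2 * weak_deriv (momentum (u t)) x
             + 3 * u t x * weak_deriv (u t) x * momentum (u t) x = 0))"

definition strong_solution ::
    "real \<Rightarrow> real \<Rightarrow> (real \<Rightarrow> real) \<Rightarrow> (real \<Rightarrow> real \<Rightarrow> real) \<Rightarrow> bool" where
  "strong_solution s T u\<^sub>0 u \<longleftrightarrow>
     (\<forall>t\<in>{0..<T}. continuous_on UNIV (u t)) \<and>
     sobolev_continuous_on s {0..<T} u \<and>
     sobolev_C1_on (s - 1) {0..<T} u \<and>
     (AE x in lebesgue. u 0 x = u\<^sub>0 x) \<and>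
     (\<forall>t\<in>{0<..<T}. novikov_at s T u t)"

definition global_strong_solution ::
    "real \<Rightarrow> (real \<Rightarrow> real) \<Rightarrow> (real \<Rightarrow> real \<Rightarrow> real) \<Rightarrow> bool" where
  "global_strong_solution s u\<^sub>0 u \<longleftrightarrow> (\<forall>T>0. strong_solution s T u\<^sub>0 u)"

definition peakon :: "real \<Rightarrow> real \<Rightarrow> real" where
  "peakon c x = sqrt c * (cosh (1 / 2 - x + of_int \<lfloor>x\<rfloor>) / cosh (1 / 2))"

end

theory Submission imports Defs begin

text \<open>
  Both \<open>E = \<integral> u\<^sup>2 + u\<^sub>x\<^sup>2\<close> and \<open>F = \<integral> u\<^sup>4 + 2 u\<^sup>2 u\<^sub>x\<^sup>2 - u\<^sub>x\<^sup>4 / 3\<close> are conserved, and since \<open>\<phi>\<^sub>c - \<partial>\<^sub>x\<^sup>2 \<phi>\<^sub>c\<close> is a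
  multiple of the Dirac measure, the squared \<open>H\<^sup>1\<close> distance of \<open>u\<close> to \<open>\<phi>\<^sub>c (x - \<xi>)\<close> is an affine function of \<open>E\<close>
  and \<open>u \<xi>\<close>.  It remains to bound the maximum \<open>M\<close> of \<open>u\<close> from below.  If \<open>m > 0\<close> is the minimum, put
  \<open>g = u\<^sub>x \<plusminus> sqrt (u\<^sup>2 - m\<^sup>2)\<close> with a change of sign at the extrema.  Then \<open>\<integral> g\<^sup>2\<close> is \<open>E\<close> minus a function of \<open>M\<close>
  and \<open>m\<close>, and for \<open>h = u\<^sup>2 + m\<^sup>2 \<plusminus> 2/3 u\<^sub>x sqrt (u\<^sup>2 - m\<^sup>2) - u\<^sub>x\<^sup>2 / 3\<close> also \<open>\<integral> h g\<^sup>2\<close> is \<open>F\<close> minus such a function;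
  the bound \<open>h \<le> 4/3 M\<^sup>2 + 2/3 m\<^sup>2\<close> gives an inequality between \<open>E\<close>, \<open>F\<close>, \<open>M\<close> and \<open>m\<close> which, for \<open>E\<close> and \<open>F\<close> near
  their peakon values, forces \<open>M\<close> to be near the height of the peakon.  The sign of the momentum gives
  \<open>\<bar>u\<^sub>x\<bar> \<le> u\<close> at time \<open>0\<close>, so that \<open>F\<close> is close to its peakon value, and \<open>u > 0\<close> propagates by continuity in
  time, because closeness to the peakon bounds \<open>u\<close> from below.
\<close>

subsection \<open>Absolutely continuous periodic functions\<close>

text \<open>The hypotheses speak of Fourier coefficients and of weak derivatives chosen by
  \<open>SOME\<close>, while the estimates integrate by parts with third order quantities that are
  only integrable. \<open>ac_deriv\<close> is the common ground, and uniqueness of Fourier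
  coefficients carries everything there. The minimum m is not controlled in advance, so the two
  numbers E and F have to determine both M and m. Scaling resolves this: F / E^2 does not change
  when u is multiplied by a constant, and the calibration inequality shows that for positive
  functions it never exceeds its peakon value. Being near that maximum fixes the shape of u, and E
  then fixes its size. Closeness in \<open>H^1\<close> says nothing about the integral of u_x^4,
  which is why a pointwise bound on u_x has to be found for the initial datum; conservation of F
  makes one such bound, at time 0, enough. At later times only positivity is required, and the
  calibration returns it in a stronger, quantitative form.\<close>

lemma periodic1_of_int:
  assumes "periodic1 f" shows "f (x + of_int n) = f x"
proof (induction n rule: int_induct[where k=0])
  case base then show ?case by simp
next
  case (step1 i)
  have "f (x + of_int (i+1)) = f ((x + of_int i) + 1)" by (simp add: add.assoc)
  then show ?case using assms step1 unfolding periodic1_def by simp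
next
  case (step2 i)
  have "f (x + of_int i) = f ((x + of_int (i-1)) + 1)" by (simp add: add.assoc)
  then show ?case using assms step2 unfolding periodic1_def by (metis (no_types))
qed

lemma periodic1_frac:
  assumes "periodic1 f" shows "f (frac x) = f x"
  using periodic1_of_int[OF assms, of "frac x" "\<lfloor>x\<rfloor>"] by (simp add: frac_def)

lemma absolutely_integrable_shift_real:
  fixes g :: "real \<Rightarrow> real"
  assumes "g absolutely_integrable_on {a..b}"
  shows "(\<lambda>x. g (x + c)) absolutely_integrable_on {a-c..b-c}"
  using assms integrable_shift_real_ivl[of g a b c] integrable_shift_real_ivl[of "\<lambda>x. norm (g x)" a b c]
  unfolding absolutely_integrable_on_def by auto

lemma absolutely_integrable_combine_real:
  fixes g :: "real \<Rightarrow> real"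
  assumes "g absolutely_integrable_on {a..b}" "g absolutely_integrable_on {b..c}"
  shows "g absolutely_integrable_on {a..c}"
proof -
  have "g absolutely_integrable_on ({a..b} \<union> {b..c})"
    using assms by (intro absolutely_integrable_Un) auto
  then show ?thesis by (rule absolutely_integrable_on_subinterval) auto
qed

lemma periodic1_absolutely_integrable:
  fixes g :: "real \<Rightarrow> real"
  assumes per: "periodic1 g" and g: "g absolutely_integrable_on {0..1}"
  shows "g absolutely_integrable_on {a..b}"
proof -
  have 1: "g absolutely_integrable_on {of_int n..of_int n + 1}" for n :: int
    using absolutely_integrable_shift_real[OF g, of "- of_int n"] periodic1_of_int[OF per, of _ "-n"]
    by (simp add: algebra_simps)
  have 2: "g absolutely_integrable_on {- real n..real n}" for n :: nat
  proof (induction n)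
    case 0 show ?case by (rule absolutely_integrable_on_subinterval[OF g]) auto
  next
    case (Suc n)
    have "g absolutely_integrable_on {real n..real (Suc n)}"
         "g absolutely_integrable_on {-real (Suc n)..- real n}"
      using 1[of "int n"] 1[of "- int (Suc n)"] by (simp_all add: algebra_simps)
    then show ?case using Suc by (blast intro: absolutely_integrable_combine_real)
  qed
  obtain n where "real n \<ge> max \<bar>a\<bar> \<bar>b\<bar>" using real_arch_simple by blast
  then show ?thesis by (intro absolutely_integrable_on_subinterval[OF 2[of n]]) auto
qed

lemma periodic1_integral:
  fixes g :: "real \<Rightarrow> real"
  assumes per: "periodic1 g" and g: "g absolutely_integrable_on {0..1}"
  shows "integral {a..a+1} g = integral {0..1} g"
proof -
  have int: "g integrable_on {p..q}" for p q
    using periodic1_absolutely_integrable[OF assms] set_lebesgue_integral_eq_integral(1) by blast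
  have shift: "integral {p + of_int n..q + of_int n} g = integral {p..q} g" for p q n
    using integral_shift_real_ivl[of "p + of_int n" "of_int n" "q + of_int n" g]
      periodic1_of_int[OF per] by simp
  define r where "r = frac a"
  have r: "0 \<le> r" "r \<le> 1" by (auto simp: r_def frac_lt_1 less_imp_le)
  have "integral {a..a+1} g = integral {r..r+1} g"
    using shift[of r "\<lfloor>a\<rfloor>" "r+1"] by (simp add: r_def frac_def algebra_simps)
  also have "\<dots> = integral {r..1} g + integral {1..r+1} g"
    using r by (intro Henstock_Kurzweil_Integration.integral_combine[symmetric] int) auto
  also have "integral {1..r+1} g = integral {0..r} g" using shift[of 0 1 r] by simp
  also have "integral {r..1} g + integral {0..r} g = integral {0..1} g"
    using r by (subst add.commute, intro Henstock_Kurzweil_Integration.integral_combine int) auto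
  finally show ?thesis .
qed

text \<open>Absolute continuity expressed through the integral instead of pointwise
  differentiability: at s = 3 the functions u_xxx and u_txx are only square integrable, yet
  products, linear combinations and changes of the derivative on null sets remain available in this
  form.\<close>

definition ac_deriv :: "(real \<Rightarrow> real) \<Rightarrow> (real \<Rightarrow> real) \<Rightarrow> bool" where
  "ac_deriv f g \<longleftrightarrow> periodic1 f \<and> periodic1 g \<and>
     (\<forall>a b. a \<le> b \<longrightarrow> g absolutely_integrable_on {a..b} \<and> f b - f a = integral {a..b} g)"

lemma ac_derivD:
  assumes "ac_deriv f g"
  shows "periodic1 f" "periodic1 g" "g absolutely_integrable_on {a..b}" "g integrable_on {a..b}"
    "a \<le> b \<Longrightarrow> integral {a..b} g = f b - f a"
proof -
  show "g absolutely_integrable_on {a..b}"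
    using assms unfolding ac_deriv_def by (cases "a \<le> b") auto
  then show "g integrable_on {a..b}" using set_lebesgue_integral_eq_integral(1) by blast
qed (use assms in \<open>auto simp: ac_deriv_def\<close>)

lemma ac_deriv_integral_eq_0:
  assumes "ac_deriv f g" shows "integral {0..1} g = 0"
proof -
  have "f (0 + 1) = f 0" using ac_derivD(1)[OF assms] unfolding periodic1_def by blast
  then show ?thesis using ac_derivD(5)[OF assms, of 0 1] by simp
qed

lemma ac_deriv_continuous:
  assumes "ac_deriv f g" shows "continuous_on S f"
proof -
  have "isCont f x" for x
  proof -
    have "continuous_on {x-1..x+1} (\<lambda>y. integral {x-1..y} g + f (x-1))"
      by (intro continuous_intros indefinite_integral_continuous_1 ac_derivD(4)[OF assms])
    also have "?this \<longleftrightarrow> continuous_on {x-1..x+1} f"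
      using ac_derivD(5)[OF assms, of "x-1"] by (intro continuous_on_cong) auto
    finally show ?thesis
      by (rule continuous_on_interior) (simp add: interior_atLeastAtMost_real)
  qed
  then show ?thesis by (simp add: continuous_at_imp_continuous_on)
qed

lemma continuous_mult_absolutely_integrable:
  fixes f g :: "real \<Rightarrow> real"
  assumes f: "continuous_on {a..b} f" and g: "g absolutely_integrable_on {a..b}"
  shows "(\<lambda>x. f x * g x) absolutely_integrable_on {a..b}"
    "(\<lambda>x. g x * f x) absolutely_integrable_on {a..b}"
proof -
  show "(\<lambda>x. f x * g x) absolutely_integrable_on {a..b}"
    by (intro absolutely_integrable_bounded_measurable_product_real g
        continuous_imp_measurable_on_sets_lebesgue f compact_imp_bounded
        compact_continuous_image) auto
  then show "(\<lambda>x. g x * f x) absolutely_integrable_on {a..b}" by (simp add: mult.commute)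
qed

text \<open>Along a uniform partition both sides telescope, so the increment of D is at most
  \<epsilon> times that of \<Gamma>, for every \<epsilon>. This stands in for Lebesgue's
  differentiation theorem: with \<Gamma> the primitive of an integrable function it yields the
  product rule for absolutely continuous functions.\<close>

lemma eq_if_small_increments:
  fixes D \<Gamma> :: "real \<Rightarrow> real"
  assumes ab: "a \<le> b"
    and small: "\<And>\<epsilon>. \<epsilon> > 0 \<Longrightarrow> \<exists>\<delta>>0. \<forall>x y. a \<le> x \<longrightarrow> x \<le> y \<longrightarrow> y \<le> b \<longrightarrow> y - x \<le> \<delta> \<longrightarrow>
      \<bar>D y - D x\<bar> \<le> \<epsilon> * (\<Gamma> y - \<Gamma> x)"
  shows "D b = D a"
proof -
  have bound: "\<bar>D b - D a\<bar> \<le> \<epsilon> * (\<Gamma> b - \<Gamma> a)" if \<epsilon>: "\<epsilon> > 0" for \<epsilon>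
  proof -
    obtain \<delta> where \<delta>: "\<delta> > 0" and D: "\<And>x y. a \<le> x \<Longrightarrow> x \<le> y \<Longrightarrow> y \<le> b \<Longrightarrow> y - x \<le> \<delta> \<Longrightarrow>
      \<bar>D y - D x\<bar> \<le> \<epsilon> * (\<Gamma> y - \<Gamma> x)"
      using small[OF \<epsilon>] by blast
    obtain N :: nat where N: "(b - a) / \<delta> < real N" using reals_Archimedean2 by blast
    have N0: "N > 0"
    proof (rule ccontr)
      assume "\<not> N > 0"
      moreover have "(b - a) / \<delta> \<ge> 0" using ab \<delta> by simp
      ultimately show False using N by simp
    qed
    define p where "p i = a + (b - a) * (real i / real N)" for i
    have step: "\<bar>D (p (Suc i)) - D (p i)\<bar> \<le> \<epsilon> * (\<Gamma> (p (Suc i)) - \<Gamma> (p i))" if i: "i < N" for i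
    proof (rule D)
      show "a \<le> p i" using ab by (simp add: p_def)
      show "p i \<le> p (Suc i)" using ab N0
        by (auto simp: p_def intro!: mult_left_mono divide_right_mono)
      have "real (Suc i) / real N \<le> 1" using i by simp
      then have "(b - a) * (real (Suc i) / real N) \<le> (b - a) * 1" using ab by (intro mult_left_mono) auto
      then show "p (Suc i) \<le> b" by (simp add: p_def)
      have "p (Suc i) - p i = (b - a) / real N"
        by (simp add: p_def algebra_simps add_divide_distrib)
      also have "\<dots> \<le> \<delta>" using N N0 \<delta> by (simp add: field_simps)
      finally show "p (Suc i) - p i \<le> \<delta>" .
    qed
    have ends: "p 0 = a" "p N = b" using N0 by (auto simp: p_def)
    have "D b - D a = (\<Sum>i<N. D (p (Suc i)) - D (p i))"
      using sum_lessThan_telescope[of "\<lambda>i. D (p i)" N] ends by simp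
    also have "\<bar>\<dots>\<bar> \<le> (\<Sum>i<N. \<epsilon> * (\<Gamma> (p (Suc i)) - \<Gamma> (p i)))"
      by (rule order_trans[OF sum_abs sum_mono]) (use step in auto)
    also have "\<dots> = \<epsilon> * (\<Gamma> b - \<Gamma> a)"
      using sum_lessThan_telescope[of "\<lambda>i. \<Gamma> (p i)" N] ends by (simp add: sum_distrib_left[symmetric])
    finally show ?thesis .
  qed
  have "\<bar>D b - D a\<bar> \<le> 0"
  proof (rule field_le_epsilon)
    fix e :: real assume e: "e > 0"
    \<comment> \<open>The summand 1 keeps the divisor positive when the increment of \<Gamma> is
      zero.\<close>
    define c where "c = \<bar>\<Gamma> b - \<Gamma> a\<bar> + 1"
    have c: "c > 0" "\<Gamma> b - \<Gamma> a \<le> c" by (auto simp: c_def)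
    have "\<bar>D b - D a\<bar> \<le> (e / c) * (\<Gamma> b - \<Gamma> a)" using bound[of "e / c"] c e by simp
    also have "\<dots> \<le> (e / c) * c" using c e by (intro mult_left_mono) auto
    finally show "\<bar>D b - D a\<bar> \<le> 0 + e" using c by simp
  qed
  then show ?thesis by simp
qed

lemma ac_deriv_mult:
  assumes f: "ac_deriv f f'" and g: "ac_deriv g g'"
  shows "ac_deriv (\<lambda>x. f x * g x) (\<lambda>x. f' x * g x + f x * g' x)"
  unfolding ac_deriv_def
proof (intro conjI allI impI)
  show "periodic1 (\<lambda>x. f x * g x)" "periodic1 (\<lambda>x. f' x * g x + f x * g' x)"
    using ac_derivD(1,2)[OF f] ac_derivD(1,2)[OF g] by (auto simp: periodic1_def)
  fix a b :: real assume ab: "a \<le> b"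
  let ?h = "\<lambda>x. f' x * g x + f x * g' x"
  note cont = ac_deriv_continuous[OF f] ac_deriv_continuous[OF g]
  have hai: "?h absolutely_integrable_on {x..y}" for x y
    by (intro set_integral_add(1) continuous_mult_absolutely_integrable cont ac_derivD(3)[OF f] ac_derivD(3)[OF g])
  then show "?h absolutely_integrable_on {a..b}" .
  have hi: "?h integrable_on {x..y}" for x y
    using hai set_lebesgue_integral_eq_integral(1) by blast
  define \<Gamma> where "\<Gamma> x = integral {a..x} (\<lambda>s. \<bar>f' s\<bar> + \<bar>g' s\<bar>)" for x
  have gi: "(\<lambda>s. \<bar>f' s\<bar> + \<bar>g' s\<bar>) integrable_on {x..y}" for x y
    using ac_derivD(3)[OF f, of x y] ac_derivD(3)[OF g, of x y] unfolding absolutely_integrable_on_def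
    by (intro integrable_add) simp_all
  define D where "D x = f x * g x - integral {a..x} ?h" for x
  have "D b = D a"
  proof (rule eq_if_small_increments[OF ab, where \<Gamma> = \<Gamma>])
    fix \<epsilon> :: real assume \<epsilon>: "\<epsilon> > 0"
    have uc: "uniformly_continuous_on {a..b} f" "uniformly_continuous_on {a..b} g"
      by (auto intro!: compact_uniformly_continuous cont)
    obtain d1 where d1: "d1 > 0" "\<And>x y. x \<in> {a..b} \<Longrightarrow> y \<in> {a..b} \<Longrightarrow> dist y x < d1 \<Longrightarrow> dist (f y) (f x) < \<epsilon>"
      using uc(1)[unfolded uniformly_continuous_on_def, rule_format, OF \<epsilon>] by blast
    obtain d2 where d2: "d2 > 0" "\<And>x y. x \<in> {a..b} \<Longrightarrow> y \<in> {a..b} \<Longrightarrow> dist y x < d2 \<Longrightarrow> dist (g y) (g x) < \<epsilon>"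
      using uc(2)[unfolded uniformly_continuous_on_def, rule_format, OF \<epsilon>] by blast
    show "\<exists>\<delta>>0. \<forall>x y. a \<le> x \<longrightarrow> x \<le> y \<longrightarrow> y \<le> b \<longrightarrow> y - x \<le> \<delta> \<longrightarrow> \<bar>D y - D x\<bar> \<le> \<epsilon> * (\<Gamma> y - \<Gamma> x)"
    proof (intro exI[of _ "min d1 d2 / 2"] conjI allI impI)
      show "min d1 d2 / 2 > 0" using d1 d2 by simp
      fix x y assume xy: "a \<le> x" "x \<le> y" "y \<le> b" "y - x \<le> min d1 d2 / 2"
      have fs: "\<bar>f y - f s\<bar> \<le> \<epsilon>" "\<bar>g x - g s\<bar> \<le> \<epsilon>" if "s \<in> {x..y}" for s
        using d1(2)[of s y] d2(2)[of s x] that xy d1(1) d2(1) by (simp_all add: dist_real_def)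
      have i1: "(\<lambda>s. f y * g' s + g x * f' s) integrable_on {x..y}"
        by (intro integrable_add integrable_on_mult_right ac_derivD(4)[OF f] ac_derivD(4)[OF g])
      have hxy: "integral {a..y} ?h = integral {a..x} ?h + integral {x..y} ?h"
        using xy by (intro Henstock_Kurzweil_Integration.integral_combine[symmetric] hi) auto
      have \<Gamma>xy: "\<Gamma> y = \<Gamma> x + integral {x..y} (\<lambda>s. \<bar>f' s\<bar> + \<bar>g' s\<bar>)"
        unfolding \<Gamma>_def using xy by (intro Henstock_Kurzweil_Integration.integral_combine[symmetric] gi) auto
      \<comment> \<open>Freezing f at y and g at x splits the increment exactly. Compared with the
        integrand \<open>?h\<close>, only f y - f s and g x - g s appear, and both are uniformly
        small.\<close>
      have "f y * g y - f x * g x = f y * (g y - g x) + g x * (f y - f x)" by (simp add: algebra_simps)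
      also have "\<dots> = integral {x..y} (\<lambda>s. f y * g' s + g x * f' s)"
        using ac_derivD(5)[OF f xy(2)] ac_derivD(5)[OF g xy(2)]
        by (subst integral_add) (auto intro!: integrable_on_mult_right ac_derivD(4)[OF f] ac_derivD(4)[OF g])
      finally have "D y - D x = integral {x..y} (\<lambda>s. f y * g' s + g x * f' s) - integral {x..y} ?h"
        unfolding D_def hxy by simp
      also have "\<dots> = integral {x..y} (\<lambda>s. (f y * g' s + g x * f' s) - ?h s)"
        by (rule integral_diff[symmetric]) (intro i1 hi)+
      finally have Dxy: "D y - D x = integral {x..y} (\<lambda>s. (f y * g' s + g x * f' s) - ?h s)" .
      have "norm (D y - D x) \<le> integral {x..y} (\<lambda>s. \<epsilon> * (\<bar>f' s\<bar> + \<bar>g' s\<bar>))"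
        unfolding Dxy
      proof (rule integral_norm_bound_integral)
        show "(\<lambda>s. (f y * g' s + g x * f' s) - ?h s) integrable_on {x..y}"
          by (intro integrable_diff i1 hi)
        show "(\<lambda>s. \<epsilon> * (\<bar>f' s\<bar> + \<bar>g' s\<bar>)) integrable_on {x..y}"
          by (intro integrable_on_mult_right gi)
        fix s assume s: "s \<in> {x..y}"
        have "(f y * g' s + g x * f' s) - ?h s = (f y - f s) * g' s + (g x - g s) * f' s"
          by (simp add: algebra_simps)
        also have "norm \<dots> \<le> \<bar>f y - f s\<bar> * \<bar>g' s\<bar> + \<bar>g x - g s\<bar> * \<bar>f' s\<bar>"
          unfolding real_norm_def by (rule order_trans[OF abs_triangle_ineq]) (simp add: abs_mult)
        also have "\<dots> \<le> \<epsilon> * \<bar>g' s\<bar> + \<epsilon> * \<bar>f' s\<bar>"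
          using fs[OF s] by (intro add_mono mult_right_mono) auto
        finally show "norm ((f y * g' s + g x * f' s) - ?h s) \<le> \<epsilon> * (\<bar>f' s\<bar> + \<bar>g' s\<bar>)"
          by (simp add: algebra_simps)
      qed
      then show "\<bar>D y - D x\<bar> \<le> \<epsilon> * (\<Gamma> y - \<Gamma> x)" unfolding \<Gamma>xy by simp
    qed
  qed
  then show "f b * g b - f a * g a = integral {a..b} ?h" by (simp add: D_def)
qed

lemma ac_deriv_add:
  assumes f: "ac_deriv f f'" and g: "ac_deriv g g'"
  shows "ac_deriv (\<lambda>x. f x + g x) (\<lambda>x. f' x + g' x)"
  unfolding ac_deriv_def
proof (intro conjI allI impI)
  fix a b :: real assume ab: "a \<le> b"
  show "(\<lambda>x. f' x + g' x) absolutely_integrable_on {a..b}"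
    by (intro set_integral_add(1) ac_derivD(3)[OF f] ac_derivD(3)[OF g])
  show "(f b + g b) - (f a + g a) = integral {a..b} (\<lambda>x. f' x + g' x)"
    by (simp add: integral_add ac_derivD(4)[OF f] ac_derivD(4)[OF g] ac_derivD(5)[OF f ab] ac_derivD(5)[OF g ab])
qed (use ac_derivD(1,2)[OF f] ac_derivD(1,2)[OF g] in \<open>auto simp: periodic1_def\<close>)

lemma ac_deriv_const: "ac_deriv (\<lambda>x. c) (\<lambda>x. 0)"
  by (auto simp: ac_deriv_def periodic1_def)

lemma ac_deriv_cmult:
  assumes f: "ac_deriv f f'" shows "ac_deriv (\<lambda>x. c * f x) (\<lambda>x. c * f' x)"
  using ac_deriv_mult[OF ac_deriv_const[of c] f] by simp

lemma ac_deriv_diff: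
  assumes f: "ac_deriv f f'" and g: "ac_deriv g g'"
  shows "ac_deriv (\<lambda>x. f x - g x) (\<lambda>x. f' x - g' x)"
  using ac_deriv_add[OF f ac_deriv_cmult[OF g, of "-1"]] by simp

lemma ac_deriv_shift:
  assumes f: "ac_deriv f f'" shows "ac_deriv (\<lambda>x. f (x + c)) (\<lambda>x. f' (x + c))"
  unfolding ac_deriv_def
proof (intro conjI allI impI)
  show "periodic1 (\<lambda>x. f (x + c))" "periodic1 (\<lambda>x. f' (x + c))"
    using ac_derivD(1,2)[OF f] by (auto simp: periodic1_def add.commute[of _ c] add.assoc[symmetric])
  fix a b :: real assume ab: "a \<le> b"
  show "(\<lambda>x. f' (x + c)) absolutely_integrable_on {a..b}"
    using absolutely_integrable_shift_real[OF ac_derivD(3)[OF f, of "a+c" "b+c"], of c] by simp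
  show "f (b + c) - f (a + c) = integral {a..b} (\<lambda>x. f' (x + c))"
    using ac_derivD(5)[OF f, of "a+c" "b+c"] integral_shift_real_ivl[of "a+c" c "b+c" f'] ab by simp
qed

lemma ac_deriv_C1:
  assumes per: "periodic1 f" and d: "\<And>x. (f has_real_derivative g x) (at x)"
    and g: "continuous_on UNIV g"
  shows "ac_deriv f g"
  unfolding ac_deriv_def
proof (intro conjI allI impI per)
  show "periodic1 g"
    unfolding periodic1_def
  proof
    fix x
    have "((\<lambda>x. f (x + 1)) has_real_derivative g (x + 1)) (at x)"
      using d[of "x + 1"] by (simp add: DERIV_shift)
    moreover have "(\<lambda>x. f (x + 1)) = f" using per by (auto simp: periodic1_def)
    ultimately show "g (x + 1) = g x" using DERIV_unique[OF d[of x]] by simp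
  qed
  fix a b :: real assume ab: "a \<le> b"
  show "g absolutely_integrable_on {a..b}"
    by (intro absolutely_integrable_continuous_real continuous_on_subset[OF g]) auto
  have "(g has_integral f b - f a) {a..b}"
    using has_field_derivative_at_within[OF d]
    by (intro fundamental_theorem_of_calculus ab) (simp add: has_real_derivative_iff_has_vector_derivative)
  then show "f b - f a = integral {a..b} g" by (simp add: integral_unique)
qed

lemma ac_deriv_has_real_derivative:
  assumes f: "ac_deriv f g" and g: "continuous_on UNIV g"
  shows "(f has_real_derivative g x) (at x)"
proof -
  have "((\<lambda>y. integral {x-1..y} g) has_real_derivative g x) (at x within {x-1..x+1})"
    by (intro integral_has_real_derivative continuous_on_subset[OF g]) auto
  then have "((\<lambda>y. integral {x-1..y} g) has_real_derivative g x) (at x)"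
    using at_within_Icc_at[of "x-1" x "x+1"] by simp
  then have "((\<lambda>y. integral {x-1..y} g + f (x-1)) has_real_derivative g x) (at x)"
    using DERIV_add[OF _ DERIV_const] by fastforce
  then show ?thesis
  proof (rule has_field_derivative_transform_within_open)
    show "open {x-1<..}" "x \<in> {x-1<..}" by auto
    show "integral {x-1..y} g + f (x-1) = f y" if "y \<in> {x-1<..}" for y
      using ac_derivD(5)[OF f, of "x-1" y] that by simp
  qed
qed

text \<open>Allows the equation, known only almost everywhere, to be substituted for the second
  space derivative of u_t.\<close>

lemma ac_deriv_spike:
  assumes f: "ac_deriv f g" and ae: "AE x in lebesgue. g x = g' x" and per: "periodic1 g'"
  shows "ac_deriv f g'"
  unfolding ac_deriv_def
proof (intro conjI allI impI per ac_derivD(1)[OF f])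
  from ae obtain N where "N \<in> null_sets lebesgue" "{x. g x \<noteq> g' x} \<subseteq> N"
    unfolding eventually_ae_filter by auto
  then have N: "negligible N" "\<And>x. x \<notin> N \<Longrightarrow> g x = g' x"
    by (auto simp: negligible_iff_null_sets)
  fix a b :: real assume ab: "a \<le> b"
  show "g' absolutely_integrable_on {a..b}"
    by (rule absolutely_integrable_spike[OF ac_derivD(3)[OF f] N(1)]) (use N in auto)
  have "integral {a..b} g = integral {a..b} g'" by (rule integral_spike[OF N(1)]) (use N in auto)
  then show "f b - f a = integral {a..b} g'" using ac_derivD(5)[OF f ab] by simp
qed

subsection \<open>Uniqueness of Fourier coefficients\<close>

abbreviation cos_mode :: "int \<Rightarrow> real \<Rightarrow> real" where "cos_mode k x \<equiv> cos (2 * pi * of_int k * x)"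
abbreviation sin_mode :: "int \<Rightarrow> real \<Rightarrow> real" where "sin_mode k x \<equiv> sin (2 * pi * of_int k * x)"
abbreviation cis_mode :: "int \<Rightarrow> real \<Rightarrow> complex" where "cis_mode k x \<equiv> cis (2 * pi * of_int k * x)"

lemma absolutely_integrable_fourier:
  assumes f: "f absolutely_integrable_on {0..1}"
  shows "(\<lambda>x. f x * cos_mode k x) absolutely_integrable_on {0..1}"
    "(\<lambda>x. f x * sin_mode k x) absolutely_integrable_on {0..1}"
  by (intro continuous_mult_absolutely_integrable(2) f continuous_intros)+

lemma fourier_coeff_eq:
  assumes f: "f absolutely_integrable_on {0..1}"
  shows "fourier_coeff f k = Complex (integral {0..1} (\<lambda>x. f x * cos_mode k x))
      (- integral {0..1} (\<lambda>x. f x * sin_mode k x))"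
proof -
  let ?F = "\<lambda>x. complex_of_real (f x) * cis (- (2 * pi * of_int k * x))"
  have F: "?F = (\<lambda>x. of_real (f x * cos_mode k x) - \<i> * of_real (f x * sin_mode k x))"
    by (auto simp: complex_eq_iff)
  have ai: "(\<lambda>x. complex_of_real (f x * cos_mode k x)) absolutely_integrable_on {0..1}"
    "(\<lambda>x. complex_of_real (f x * sin_mode k x)) absolutely_integrable_on {0..1}"
    using absolutely_integrable_fourier[OF f, of k] by (simp_all add: complex_of_real_integrable_eq[symmetric] set_integrable_def scaleR_conv_of_real)
  have "?F absolutely_integrable_on {0..1}"
    unfolding F by (intro set_integral_diff(1) ai set_integrable_mult_right)
  then have "fourier_coeff f k = (LINT x:{0..1}|lebesgue. ?F x)" by (simp add: fourier_coeff_def)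
  also have "\<dots> = (LINT x:{0..1}|lebesgue. complex_of_real (f x * cos_mode k x)) -
     \<i> * (LINT x:{0..1}|lebesgue. complex_of_real (f x * sin_mode k x))"
    unfolding F by (subst set_integral_diff(2)) (auto intro!: ai set_integrable_mult_right simp del: of_real_mult)
  also have "\<dots> = of_real (LINT x:{0..1}|lebesgue. f x * cos_mode k x) -
     \<i> * of_real (LINT x:{0..1}|lebesgue. f x * sin_mode k x)"
    by (simp only: set_integral_complex_of_real)
  also have "\<dots> = of_real (integral {0..1} (\<lambda>x. f x * cos_mode k x)) -
     \<i> * of_real (integral {0..1} (\<lambda>x. f x * sin_mode k x))"
    using set_lebesgue_integral_eq_integral(2)[OF absolutely_integrable_fourier(1)[OF f, of k]]
      set_lebesgue_integral_eq_integral(2)[OF absolutely_integrable_fourier(2)[OF f, of k]] by simp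
  also have "\<dots> = Complex (integral {0..1} (\<lambda>x. f x * cos_mode k x))
      (- integral {0..1} (\<lambda>x. f x * sin_mode k x))"
    by (simp add: complex_eq_iff)
  finally show ?thesis .
qed

text \<open>This class is closed under sums, reflection and multiplication by the first cosine and
  sine, which reduces uniqueness to even functions and to polynomials in one cosine.\<close>

definition fourier_null :: "(real \<Rightarrow> real) \<Rightarrow> bool" where
  "fourier_null f \<longleftrightarrow> continuous_on UNIV f \<and> periodic1 f \<and>
     (\<forall>k::int. integral {0..1} (\<lambda>x. f x * cos_mode k x) = 0 \<and>
               integral {0..1} (\<lambda>x. f x * sin_mode k x) = 0)"

lemma continuous_UNIV_integrable:
  fixes f :: "real \<Rightarrow> 'a::banach"
  assumes "continuous_on UNIV f" shows "f integrable_on {a..b}"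
  using assms by (intro integrable_continuous_real) (rule continuous_on_subset, auto)

lemma fourier_null_continuous: "fourier_null f \<Longrightarrow> continuous_on S f"
  unfolding fourier_null_def using continuous_on_subset by blast

lemma fourier_null_add:
  assumes "fourier_null f" "fourier_null g" shows "fourier_null (\<lambda>x. f x + g x)"
proof -
  note [continuous_intros] = assms[THEN fourier_null_continuous]
  have "integral {0..1} (\<lambda>x. (f x + g x) * cos_mode k x) = 0"
    "integral {0..1} (\<lambda>x. (f x + g x) * sin_mode k x) = 0" for k :: int
    using assms by (simp_all add: distrib_right fourier_null_def integral_add[OF continuous_UNIV_integrable continuous_UNIV_integrable] continuous_intros)
  then show ?thesis
    using assms unfolding fourier_null_def by (auto simp: periodic1_def intro!: continuous_intros)
qed

lemma fourier_null_cmult: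
  assumes "fourier_null f" shows "fourier_null (\<lambda>x. c * f x)"
  using assms unfolding fourier_null_def
  by (simp add: periodic1_def mult.assoc continuous_on_mult_left)

lemma periodic_cos_sin: 
  "cos (2 * pi * of_int k * (x + 1)) = cos_mode k x"
  "sin (2 * pi * of_int k * (x + 1)) = sin_mode k x"
  using cos.plus_of_int[of "2 * pi * of_int k * x" k] sin.plus_of_int[of "2 * pi * of_int k * x" k]
  by (simp_all add: algebra_simps)

text \<open>By the product-to-sum formulas, a mode times the first cosine or sine is half a signed
  sum of the two neighbouring modes.\<close>

lemma fourier_null_mult_cos_sin:
  assumes "fourier_null f"
  shows "fourier_null (\<lambda>x. f x * cos (2 * pi * x))" "fourier_null (\<lambda>x. f x * sin (2 * pi * x))"
proof -
  note [continuous_intros] = fourier_null_continuous[OF assms]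
  have z: "integral {0..1} (\<lambda>x. f x * cos_mode k x) = 0" "integral {0..1} (\<lambda>x. f x * sin_mode k x) = 0" for k
    using assms unfolding fourier_null_def by auto
  have half: "integral {0..1} (\<lambda>x. f x * p x * g x) = 0"
    if pg: "\<And>x. p x * g x = (a x + \<sigma> * b x) / 2" and 0: "integral {0..1} (\<lambda>x. f x * a x) = 0" "integral {0..1} (\<lambda>x. f x * b x) = 0"
      and c: "continuous_on UNIV a" "continuous_on UNIV b" for p g a b :: "real \<Rightarrow> real" and \<sigma>
  proof -
    have "(\<lambda>x. f x * p x * g x) = (\<lambda>x. (f x * a x + \<sigma> * (f x * b x)) / 2)"
      using pg by (simp add: mult.assoc fun_eq_iff algebra_simps)
    moreover have "integral {0..1} (\<lambda>x. f x * a x + \<sigma> * (f x * b x)) = 0"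
      using 0 by (subst integral_add) (auto intro!: continuous_UNIV_integrable continuous_intros c)
    ultimately show ?thesis by simp
  qed
  have arg: "2 * pi * x + 2 * pi * of_int k * x = 2 * pi * of_int (k + 1) * x"
    "2 * pi * x - 2 * pi * of_int k * x = - (2 * pi * of_int (k - 1) * x)" for x and k :: int
    by (simp_all add: algebra_simps)
  have "integral {0..1} (\<lambda>x. f x * cos (2 * pi * x) * cos_mode k x) = 0" for k
    by (rule half[of _ _ "cos_mode (k - 1)" 1 "cos_mode (k + 1)"])
      (simp_all only: cos_times_cos arg cos_minus z mult_1 continuous_intros)
  moreover have "integral {0..1} (\<lambda>x. f x * cos (2 * pi * x) * sin_mode k x) = 0" for k
    by (rule half[of _ _ "sin_mode (k + 1)" 1 "sin_mode (k - 1)"])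
      (simp_all only: cos_times_sin arg sin_minus z mult_1 diff_minus_eq_add continuous_intros)
  moreover have "integral {0..1} (\<lambda>x. f x * sin (2 * pi * x) * cos_mode k x) = 0" for k
    by (rule half[of _ _ "sin_mode (k + 1)" "-1" "sin_mode (k - 1)"])
      (simp_all only: sin_times_cos arg sin_minus z mult_minus1 continuous_intros)
  moreover have "integral {0..1} (\<lambda>x. f x * sin (2 * pi * x) * sin_mode k x) = 0" for k
    by (rule half[of _ _ "cos_mode (k - 1)" "-1" "cos_mode (k + 1)"])
      (simp_all only: sin_times_sin arg cos_minus z mult_minus1 diff_conv_add_uminus[symmetric] continuous_intros)
  ultimately show "fourier_null (\<lambda>x. f x * cos (2 * pi * x))" "fourier_null (\<lambda>x. f x * sin (2 * pi * x))"
    using assms periodic_cos_sin[of 1] unfolding fourier_null_def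
    by (auto simp: periodic1_def intro!: continuous_intros)
qed

lemma fourier_null_reflect:
  assumes "fourier_null f" shows "fourier_null (\<lambda>x. f (- x))"
  unfolding fourier_null_def
proof (intro conjI allI)
  have per: "periodic1 f" and c: "continuous_on UNIV f" using assms by (auto simp: fourier_null_def)
  show "continuous_on UNIV (\<lambda>x. f (- x))"
    by (rule continuous_on_compose2[OF c]) (auto intro!: continuous_intros)
  show "periodic1 (\<lambda>x. f (- x))"
    using periodic1_of_int[OF per, of _ "-1"] by (simp add: periodic1_def)
  have refl: "integral {0..1} (\<lambda>x. g (- x)) = integral {0..1} g"
    if "periodic1 g" "continuous_on UNIV g" for g :: "real \<Rightarrow> real"
  proof -
    have "integral {0..1} (\<lambda>x. g (- x)) = integral {-1..0} g"
      using Henstock_Kurzweil_Integration.integral_reflect_real[of 0 "-1" g] by simp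
    also have "\<dots> = integral {0..1} g"
      using periodic1_integral[OF that(1), of "-1"] that(2)
      by (simp add: absolutely_integrable_continuous_real continuous_on_subset)
    finally show ?thesis .
  qed
  fix k :: int
  have "integral {0..1} (\<lambda>x. f (- x) * cos (2 * pi * of_int k * (- x))) =
      integral {0..1} (\<lambda>x. f x * cos_mode k x)"
    by (rule refl) (use per in \<open>auto simp: periodic1_def periodic_cos_sin intro!: continuous_intros c\<close>)
  then show "integral {0..1} (\<lambda>x. f (- x) * cos_mode k x) = 0"
    using assms by (simp add: fourier_null_def)
  have "integral {0..1} (\<lambda>x. f (- x) * sin (2 * pi * of_int k * (- x))) =
      integral {0..1} (\<lambda>x. f x * sin_mode k x)"
    by (rule refl) (use per in \<open>auto simp: periodic1_def periodic_cos_sin intro!: continuous_intros c\<close>)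
  then show "integral {0..1} (\<lambda>x. f (- x) * sin_mode k x) = 0"
    using assms by (simp add: fourier_null_def)
qed

lemma fourier_null_mult_poly_cos:
  assumes "fourier_null f" shows "fourier_null (\<lambda>x. f x * (\<Sum>i\<le>n. a i * cos (2 * pi * x) ^ i))"
proof -
  have pow: "fourier_null (\<lambda>x. f x * cos (2 * pi * x) ^ i)" for i
  proof (induction i)
    case (Suc i) then show ?case using fourier_null_mult_cos_sin(1)[OF Suc] by (simp add: mult_ac)
  qed (use assms in simp)
  show ?thesis
  proof (induction n)
    case 0 show ?case using fourier_null_cmult[OF pow[of 0], of "a 0"] by (simp add: mult_ac)
  next
    case (Suc n)
    show ?case using fourier_null_add[OF Suc fourier_null_cmult[OF pow[of "Suc n"], of "a (Suc n)"]]
      by (simp add: algebra_simps)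
  qed
qed

text \<open>
  An even continuous function on the circle is a continuous function of \<open>cos (2\<pi>x)\<close>, hence a uniform
  limit of polynomials in \<open>cos (2\<pi>x)\<close>, all of which are orthogonal to it.
\<close>

lemma fourier_null_even_eq_0:
  assumes f: "fourier_null f" and even: "\<And>x. f (- x) = f x"
  shows "f x = 0"
proof -
  note [continuous_intros] = fourier_null_continuous[OF f]
  have per: "periodic1 f" using f by (simp add: fourier_null_def)
  define \<Phi> where "\<Phi> c = f (arccos c / (2 * pi))" for c
  have \<Phi>: "continuous_on {-1..1} \<Phi>"
    unfolding \<Phi>_def
    by (rule continuous_on_compose2[OF fourier_null_continuous[OF f, of UNIV]])
      (auto intro!: continuous_intros continuous_on_arccos')
  \<comment> \<open>\<open>arccos\<close> inverts the cosine only on the first half period; the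
    second half is reached by the reflection x to 1 - x, under which f is invariant.\<close>
  have rep: "f x = \<Phi> (cos (2 * pi * x))" if x: "x \<in> {0..1}" for x
  proof (cases "x \<le> 1/2")
    case True
    then have "2 * pi * x \<le> pi" using pi_gt_zero by simp
    then show ?thesis using x by (simp add: \<Phi>_def arccos_cos)
  next
    case False
    have "cos (2 * pi * x) = cos (2 * pi * (1 - x))"
      using cos_periodic[of "- (2 * pi * x)"] by (simp add: algebra_simps)
    moreover have "2 * pi * (1 - x) \<le> pi" using False pi_gt_zero by (simp add: algebra_simps)
    ultimately have "\<Phi> (cos (2 * pi * x)) = f (1 - x)" using x by (simp add: \<Phi>_def arccos_cos)
    also have "\<dots> = f x" using per even[of x] unfolding periodic1_def
      by (metis add.commute uminus_add_conv_diff)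
    finally show ?thesis ..
  qed
  have "integral {0..1} (\<lambda>x. f x * f x) \<le> e * integral {0..1} (\<lambda>x. \<bar>f x\<bar>)" if e: "e > 0" for e
  proof -
    obtain g where g: "real_polynomial_function g" "\<And>c. c \<in> {-1..1} \<Longrightarrow> \<bar>\<Phi> c - g c\<bar> < e"
      using Stone_Weierstrass_real_polynomial_function[OF _ \<Phi> e] by auto
    obtain a n where gs: "g = (\<lambda>c. \<Sum>i\<le>n. a i * c ^ i)"
      using real_polynomial_function_imp_sum[OF g(1)] by blast
    let ?p = "\<lambda>x. \<Sum>i\<le>n. a i * cos (2 * pi * x) ^ i"
    have null: "integral {0..1} (\<lambda>x. f x * ?p x) = 0"
      using fourier_null_mult_poly_cos[OF f, of a n] unfolding fourier_null_def
      by (metis (no_types, lifting) cos_zero integral_cong mult.commute mult_1 mult_zero_right mult_zero_left of_int_0)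
    have int: "(\<lambda>x. f x * f x) integrable_on {0..1}" "(\<lambda>x. f x * ?p x) integrable_on {0..1}"
      "(\<lambda>x. e * \<bar>f x\<bar>) integrable_on {0..1}"
      by (intro continuous_UNIV_integrable continuous_intros)+
    \<comment> \<open>Subtracting \<open>f x * ?p x\<close>, whose integral is its own zero mode and
      so vanishes, leaves f times the approximation error, which is below e.\<close>
    have "integral {0..1} (\<lambda>x. f x * f x) = integral {0..1} (\<lambda>x. f x * f x - f x * ?p x)"
      using null by (subst integral_diff) (use int in auto)
    also have "\<dots> \<le> integral {0..1} (\<lambda>x. e * \<bar>f x\<bar>)"
    proof (rule integral_le[OF integrable_diff[OF int(1,2)] int(3)])
      fix x :: real assume x: "x \<in> {0..1}"
      have "f x * f x - f x * ?p x = f x * (\<Phi> (cos (2*pi*x)) - g (cos (2*pi*x)))"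
        using rep[OF x] by (simp add: gs algebra_simps)
      also have "\<dots> \<le> \<bar>f x\<bar> * \<bar>\<Phi> (cos (2*pi*x)) - g (cos (2*pi*x))\<bar>"
        by (metis abs_ge_self abs_mult)
      also have "\<dots> \<le> \<bar>f x\<bar> * e" using g(2)[of "cos (2*pi*x)"] by (intro mult_left_mono) auto
      finally show "f x * f x - f x * ?p x \<le> e * \<bar>f x\<bar>" by (simp add: mult.commute)
    qed
    finally show ?thesis by simp
  qed
  note le = this
  have nn: "integral {0..1} (\<lambda>x. \<bar>f x\<bar>) \<ge> 0" by (rule integral_nonneg) (auto intro!: continuous_UNIV_integrable continuous_intros)
  have "integral {0..1} (\<lambda>x. f x * f x) \<le> 0"
  proof (rule field_le_epsilon)
    fix d :: real assume d: "d > 0"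
    define I where "I = integral {0..1} (\<lambda>x. \<bar>f x\<bar>)"
    have "integral {0..1} (\<lambda>x. f x * f x) \<le> (d / (I + 1)) * I"
      using le[of "d / (I+1)"] d nn by (simp add: I_def)
    also have "\<dots> \<le> d" using d nn by (simp add: I_def field_simps)
    finally show "integral {0..1} (\<lambda>x. f x * f x) \<le> 0 + d" by simp
  qed
  moreover have "integral {0..1} (\<lambda>x. f x * f x) \<ge> 0"
    by (rule integral_nonneg) (auto intro!: continuous_UNIV_integrable continuous_intros)
  ultimately have "integral {0..1} (\<lambda>x. f x * f x) = 0" by simp
  then have "\<forall>x\<in>{0..1}. f x * f x = 0"
    by (subst (asm) integral_eq_0_iff) (auto intro!: continuous_intros)
  moreover have "frac x \<in> {0..1}" by (simp add: less_imp_le frac_lt_1)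
  ultimately have "f (frac x) = 0" by auto
  then show ?thesis using periodic1_frac[OF per] by simp
qed

text \<open>The even part vanishes by the previous lemma, so f is odd. Then f times the first sine
  is even and again orthogonal to all modes, hence zero, and f vanishes wherever that sine does not,
  that is off three points of the period.\<close>

lemma fourier_null_eq_0:
  assumes f: "fourier_null f" shows "f x = 0"
proof -
  note [continuous_intros] = fourier_null_continuous[OF f]
  have per: "periodic1 f" using f by (simp add: fourier_null_def)
  have "f x + f (- x) = 0" for x
    by (rule fourier_null_even_eq_0[OF fourier_null_add[OF f fourier_null_reflect[OF f]]]) simp
  then have odd: "f (- x) = - f x" for x using add_eq_0_iff by blast
  have sin0: "f x * sin (2 * pi * x) = 0" for x
    by (rule fourier_null_even_eq_0[OF fourier_null_mult_cos_sin(2)[OF f]]) (simp add: odd)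
  have 0: "f y = 0" if "y \<in> {0..1} - {0, 1/2, 1}" for y
  proof -
    have "sin (2 * pi * y) \<noteq> 0"
    proof (cases "y < 1/2")
      case True
      then have "sin (2 * pi * y) > 0" using that pi_gt_zero by (intro sin_gt_zero) auto
      then show ?thesis by simp
    next
      case False
      then have "sin (2 * pi * y) < 0" using that pi_gt_zero by (intro sin_lt_zero) auto
      then show ?thesis by simp
    qed
    then show ?thesis using sin0[of y] by simp
  qed
  have "integral {0..1} (\<lambda>x. f x * f x) = integral {0..1} (\<lambda>x::real. 0)"
    by (rule integral_spike[OF negligible_finite[of "{0, 1/2, 1}"]]) (use 0 in auto)
  then have "integral {0..1} (\<lambda>x. f x * f x) = 0" by simp
  then have "\<forall>x\<in>{0..1}. f x * f x = 0"
    by (subst (asm) integral_eq_0_iff) (auto intro!: continuous_intros)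
  moreover have "frac x \<in> {0..1}" by (simp add: less_imp_le frac_lt_1)
  ultimately have "f (frac x) = 0" by auto
  then show ?thesis using periodic1_frac[OF per] by simp
qed

subsection \<open>Weak derivatives and absolute continuity\<close>

text \<open>Intervals generate the Borel sets, and vanishing integrals pass to complements and
  disjoint countable unions, so the integral over every Borel set vanishes. Truncation to
  \<open>{-real n..real n}\<close> provides a globally integrable function.\<close>

lemma AE_eq_0_if_integrals_0:
  fixes f :: "real \<Rightarrow> real"
  assumes f: "\<And>a b. f absolutely_integrable_on {a..b}"
    and 0: "\<And>a b. integral {a..b} f = 0"
  shows "AE x in lebesgue. f x = 0"
proof -
  have AEn: "AE x in lebesgue. indicator {-real n..real n} x * f x = 0" for n :: nat
  proof -
    let ?F = "\<lambda>x. indicator {-real n..real n} x * f x"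
    have F: "integrable lebesgue ?F" using f[of "-real n" "real n"] by (simp add: set_integrable_def)
    \<comment> \<open>The induction over Borel sets and \<open>density_zero\<close> take place on
      \<open>lborel\<close>, so f is replaced by a Borel representative.\<close>
    obtain G where G: "G \<in> borel_measurable lborel" "AE x in lborel. ?F x = G x"
      using completion_ex_borel_measurable_real[OF borel_measurable_integrable[OF F]] by blast
    have AEG: "AE x in lebesgue. ?F x = G x" by (rule AE_completion[OF G(2)])
    have Gl: "integrable lebesgue G"
      using integrable_cong_AE[OF borel_measurable_integrable[OF F] measurable_completion[OF G(1)] AEG] F
      by blast
    then have Gi: "integrable lborel G" using integrable_completion[OF G(1)] by simp
    have sub: "set_integrable lborel A G" if "A \<in> sets borel" for A
      using integrable_mult_indicator[OF _ Gi, of A] that by (simp add: set_integrable_def)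
    have int: "(LINT x:{a..b}|lborel. G x) = 0" for a b
    proof -
      have "(LINT x:{a..b}|lborel. G x) = (LINT x:{a..b}|lebesgue. G x)"
        unfolding set_lebesgue_integral_def
        by (rule integral_completion[symmetric]) (use G(1) in measurable)
      also have "\<dots> = (LINT x:{a..b}|lebesgue. ?F x)"
        unfolding set_lebesgue_integral_def
        by (rule integral_cong_AE)
          (use AEG borel_measurable_scaleR[OF borel_measurable_indicator borel_measurable_integrable[OF F], of "{a..b}"]
             borel_measurable_scaleR[OF borel_measurable_indicator measurable_completion[OF G(1)], of "{a..b}"] in auto)
      also have "\<dots> = (LINT x:({a..b} \<inter> {-real n..real n})|lebesgue. f x)"
        unfolding set_lebesgue_integral_def
        by (rule Bochner_Integration.integral_cong) (auto simp: indicator_def)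
      also have "{a..b} \<inter> {-real n..real n} = {max a (-real n)..min b (real n)}" by auto
      also have "(LINT x:{max a (-real n)..min b (real n)}|lebesgue. f x) = 0"
        using set_lebesgue_integral_eq_integral(2)[OF f] 0 by simp
      finally show ?thesis .
    qed
    have all: "(LINT x:A|lborel. G x) = 0" if "A \<in> sets borel" for A
      using that
    proof (induction A rule: borel_set_induct)
      case empty show ?case by (simp add: set_lebesgue_integral_def)
    next
      case (interval a b) show ?case by (rule int)
    next
      case (compl A)
      have U: "(LINT x:UNIV|lborel. G x) = 0"
      proof -
        have "(LINT x:{-real n..real n}|lborel. G x) = (LINT x:UNIV|lborel. G x)"
          unfolding set_lebesgue_integral_def
        proof (rule integral_cong_AE)
          show "AE x in lborel. indicator {-real n..real n} x *\<^sub>R G x = indicator UNIV x *\<^sub>R G x"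
            using G(2)
          proof eventually_elim
            case (elim x) then show ?case by (cases "x \<in> {-real n..real n}") auto
          qed
        qed (use G(1) in auto)
        then show ?thesis using int by simp
      qed
      have "(LINT x:A \<union> (-A)|lborel. G x) = (LINT x:A|lborel. G x) + (LINT x:(-A)|lborel. G x)"
        using compl sub by (intro set_integral_Un) auto
      then show ?case using U compl by simp
    next
      case (union A)
      have "(LINT x:(\<Union>i. A i)|lborel. G x) = (\<Sum>i. (LINT x:(A i)|lborel. G x))"
        using union by (intro lebesgue_integral_countable_add sub) (auto simp: disjoint_family_on_def)
      then show ?case using union by simp
    qed
    have "AE x in lborel. G x = 0"
      by (rule sigma_finite_measure.density_zero[OF lborel.sigma_finite_measure_axioms Gi]) (use all in auto)
    with G(2) have "AE x in lborel. ?F x = 0" by eventually_elim simp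
    then show ?thesis by (rule AE_completion)
  qed
  have "AE x in lebesgue. \<forall>n. indicator {-real n..real n} x * f x = 0"
    unfolding AE_all_countable using AEn by blast
  then show ?thesis
  proof eventually_elim
    case (elim x)
    obtain n :: nat where "\<bar>x\<bar> \<le> real n" using real_arch_simple by blast
    then show ?case using elim[rule_format, of n] by (auto simp: indicator_def split: if_splits)
  qed
qed

lemma AE_lebesgueE:
  assumes "AE x in lebesgue. P x"
  obtains N where "negligible N" "\<And>x. x \<notin> N \<Longrightarrow> P x"
proof -
  from assms obtain N where "N \<in> null_sets lebesgue" "{x. \<not> P x} \<subseteq> N"
    unfolding eventually_ae_filter by auto
  then show ?thesis using that[of N] by (auto simp: negligible_iff_null_sets)
qed

lemma continuous_AE_eq:
  fixes f g :: "real \<Rightarrow> real"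
  assumes "continuous_on UNIV f" "continuous_on UNIV g" "AE x in lebesgue. f x = g x"
  shows "f = g"
proof -
  obtain N where N: "negligible N" "\<And>x. x \<notin> N \<Longrightarrow> f x = g x" using AE_lebesgueE[OF assms(3)] by blast
  have "open {x. f x \<noteq> g x}" by (intro open_Collect_neq assms)
  moreover have "negligible {x. f x \<noteq> g x}" by (rule negligible_subset[OF N(1)]) (use N(2) in auto)
  ultimately have "{x. f x \<noteq> g x} = {}" using open_not_negligible by blast
  then show ?thesis by auto
qed

lemma ac_deriv_unique:
  assumes "ac_deriv f g1" "ac_deriv f g2"
  shows "AE x in lebesgue. g1 x = g2 x"
proof -
  have "AE x in lebesgue. g1 x - g2 x = 0"
  proof (rule AE_eq_0_if_integrals_0)
    fix a b :: real
    show "(\<lambda>x. g1 x - g2 x) absolutely_integrable_on {a..b}"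
      by (intro set_integral_diff(1) ac_derivD(3)[OF assms(1)] ac_derivD(3)[OF assms(2)])
    show "integral {a..b} (\<lambda>x. g1 x - g2 x) = 0"
    proof (cases "a \<le> b")
      case True
      then show ?thesis
        by (simp add: integral_diff ac_derivD(4)[OF assms(1)] ac_derivD(4)[OF assms(2)]
            ac_derivD(5)[OF assms(1)] ac_derivD(5)[OF assms(2)])
    qed simp
  qed
  then show ?thesis by simp
qed

text \<open>Mean zero is what makes the primitive periodic.\<close>

lemma ac_deriv_exists:
  assumes per: "periodic1 g" and g: "g absolutely_integrable_on {0..1}" and 0: "integral {0..1} g = 0"
  shows "\<exists>G. ac_deriv G g"
proof -
  have ai: "g absolutely_integrable_on {a..b}" for a b by (rule periodic1_absolutely_integrable[OF per g])
  then have int: "g integrable_on {a..b}" for a b using set_lebesgue_integral_eq_integral(1) by blast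
  have comb: "integral {a..b} g + integral {b..c} g = integral {a..c} g" if "a \<le> b" "b \<le> c" for a b c
    by (rule Henstock_Kurzweil_Integration.integral_combine[OF that int])
  define G where "G x = (if x \<ge> 0 then integral {0..x} g else - integral {x..0} g)" for x
  have G: "G b - G a = integral {a..b} g" if "a \<le> b" for a b
    using that comb[of 0 a b] comb[of a 0 b] comb[of a b 0] by (auto simp: G_def)
  have "periodic1 G"
    unfolding periodic1_def
  proof
    fix x show "G (x + 1) = G x" using G[of x "x+1"] periodic1_integral[OF per g, of x] 0 by simp
  qed
  then have "ac_deriv G g" using per ai G by (simp add: ac_deriv_def)
  then show ?thesis by blast
qed

lemma ac_deriv_cos_sin:
  "ac_deriv (\<lambda>x. cos_mode k x) (\<lambda>x. - (2 * pi * of_int k) * sin_mode k x)"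
  "ac_deriv (\<lambda>x. sin_mode k x) (\<lambda>x. (2 * pi * of_int k) * cos_mode k x)"
  by (rule ac_deriv_C1; auto simp: periodic1_def periodic_cos_sin simp del: of_int_minus
      intro!: derivative_eq_intros continuous_intros)+

lemma ac_deriv_by_parts:
  assumes f: "ac_deriv f f'" and g: "ac_deriv g g'"
  shows "integral {0..1} (\<lambda>x. f x * g' x) = - integral {0..1} (\<lambda>x. f' x * g x)"
proof -
  have i: "(\<lambda>x. f' x * g x) integrable_on {0..1}" "(\<lambda>x. f x * g' x) integrable_on {0..1}"
    by (rule set_lebesgue_integral_eq_integral(1),
        rule continuous_mult_absolutely_integrable ac_deriv_continuous[OF g] ac_deriv_continuous[OF f],
        rule ac_deriv_continuous[OF g] ac_deriv_continuous[OF f], rule ac_derivD(3)[OF f] ac_derivD(3)[OF g])+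
  have "integral {0..1} (\<lambda>x. f' x * g x + f x * g' x) = 0"
    by (rule ac_deriv_integral_eq_0[OF ac_deriv_mult[OF f g]])
  then show ?thesis using integral_add[OF i] by simp
qed

lemma fourier_coeff_ac_deriv:
  assumes "ac_deriv f g"
  shows "fourier_coeff g k = 2 * pi * of_int k * \<i> * fourier_coeff f k"
proof -
  have f: "f absolutely_integrable_on {0..1}"
    by (intro absolutely_integrable_continuous_real ac_deriv_continuous[OF assms])
  show ?thesis
    using ac_deriv_by_parts[OF assms ac_deriv_cos_sin(1)[of k]] ac_deriv_by_parts[OF assms ac_deriv_cos_sin(2)[of k]]
    by (simp add: fourier_coeff_eq[OF f] fourier_coeff_eq[OF ac_derivD(3)[OF assms]] complex_eq_iff
        mult.left_commute[of "f _"])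
qed

lemma fourier_coeff_diff:
  assumes "f absolutely_integrable_on {0..1}" "g absolutely_integrable_on {0..1}"
  shows "fourier_coeff (\<lambda>x. f x - g x) k = fourier_coeff f k - fourier_coeff g k"
proof -
  note i = absolutely_integrable_fourier[THEN set_lebesgue_integral_eq_integral(1)]
  show ?thesis
    by (simp add: fourier_coeff_eq assms set_integral_diff(1) left_diff_distrib integral_diff i complex_eq_iff)
qed

lemma fourier_coeff_cmult:
  assumes "f absolutely_integrable_on {0..1}"
  shows "fourier_coeff (\<lambda>x. c * f x) k = of_real c * fourier_coeff f k"
  by (simp add: fourier_coeff_eq assms set_integrable_mult_right mult.assoc complex_eq_iff)

lemma fourier_coeff_const: "fourier_coeff (\<lambda>x. c) k = (if k = 0 then of_real c else 0)"
proof -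
  have "ac_deriv (\<lambda>x. c) (\<lambda>x. 0)" by (rule ac_deriv_const)
  from fourier_coeff_ac_deriv[OF this, of k] have "k \<noteq> 0 \<Longrightarrow> fourier_coeff (\<lambda>x. c) k = 0"
    by (simp add: fourier_coeff_def set_lebesgue_integral_def)
  moreover have "fourier_coeff (\<lambda>x. c) 0 = of_real c"
    by (subst fourier_coeff_eq) (auto intro: absolutely_integrable_continuous_real simp: complex_eq_iff)
  ultimately show ?thesis by simp
qed

lemma continuous_fourier_unique:
  assumes f: "continuous_on UNIV f" "periodic1 f" and 0: "\<And>k. fourier_coeff f k = 0"
  shows "f = (\<lambda>x. 0)"
proof -
  have "f absolutely_integrable_on {0..1}"
    by (intro absolutely_integrable_continuous_real continuous_on_subset[OF f(1)]) auto
  then have "fourier_null f"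
    using 0 f by (auto simp: fourier_null_def fourier_coeff_eq complex_eq_iff)
  then show ?thesis using fourier_null_eq_0 by blast
qed

text \<open>Passing to the primitive reduces the integrable case to the continuous one: the
  coefficients of the primitive away from the zero mode are those of f divided by 2 pi i k, and the
  zero mode is removed by subtracting the mean. A constant primitive has no increments.\<close>

lemma AE_eq_0_if_fourier_coeff_0:
  assumes per: "periodic1 f" and f: "f absolutely_integrable_on {0..1}" and 0: "\<And>k. fourier_coeff f k = 0"
  shows "AE x in lebesgue. f x = 0"
proof -
  have "integral {0..1} f = 0" using 0[of 0] by (simp add: fourier_coeff_eq[OF f] complex_eq_iff)
  then obtain G where G: "ac_deriv G f" using ac_deriv_exists[OF per f] by blast
  define c where "c = Re (fourier_coeff G 0)"
  have Gai: "G absolutely_integrable_on {0..1}"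
    by (intro absolutely_integrable_continuous_real ac_deriv_continuous[OF G])
  have "(\<lambda>x. G x - c) = (\<lambda>x. 0)"
  proof (rule continuous_fourier_unique)
    show "continuous_on UNIV (\<lambda>x. G x - c)" by (intro continuous_intros ac_deriv_continuous[OF G])
    show "periodic1 (\<lambda>x. G x - c)" using ac_derivD(1)[OF G] by (simp add: periodic1_def)
    show "fourier_coeff (\<lambda>x. G x - c) k = 0" for k
      using fourier_coeff_ac_deriv[OF G, of k] 0[of k]
      by (subst fourier_coeff_diff[OF Gai])
        (auto simp: fourier_coeff_const c_def complex_eq_iff fourier_coeff_eq[OF Gai]
          intro: absolutely_integrable_continuous_real)
  qed
  then have Gc: "G x = c" for x using fun_cong[of "\<lambda>x. G x - c" "\<lambda>x. 0" x] by simp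
  have "integral {a..b} f = 0" for a b
    using ac_derivD(5)[OF G, of a b] Gc by (cases "a \<le> b") simp_all
  then show ?thesis by (intro AE_eq_0_if_integrals_0 ac_derivD(3)[OF G])
qed

text \<open>The passage from Fourier multipliers to derivatives: the primitive of g has the
  coefficients of f away from the zero mode, which a constant corrects. Weak derivatives and the
  second space derivative of u_t both become \<open>ac_deriv\<close> statements this way.\<close>

lemma ac_deriv_if_fourier_coeff:
  assumes f: "periodic1 f" "f absolutely_integrable_on {0..1}"
    and g: "periodic1 g" "g absolutely_integrable_on {0..1}"
    and coeff: "\<And>k. fourier_coeff g k = 2 * pi * of_int k * \<i> * fourier_coeff f k"
  shows "\<exists>G. ac_deriv G g \<and> (AE x in lebesgue. f x = G x)"
proof -
  have "integral {0..1} g = 0" using coeff[of 0] by (simp add: fourier_coeff_eq[OF g(2)] complex_eq_iff)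
  then obtain G where G: "ac_deriv G g" using ac_deriv_exists[OF g] by blast
  have Gai: "G absolutely_integrable_on {0..1}"
    by (intro absolutely_integrable_continuous_real ac_deriv_continuous[OF G])
  have real0: "Im (fourier_coeff h 0) = 0" if "h absolutely_integrable_on {0..1}" for h
    by (simp add: fourier_coeff_eq[OF that])
  define c where "c = Re (fourier_coeff f 0 - fourier_coeff G 0)"
  have G': "ac_deriv (\<lambda>x. G x + c) g" using ac_deriv_add[OF G ac_deriv_const[of c]] by simp
  have G'ai: "(\<lambda>x. G x + c) absolutely_integrable_on {0..1}"
    by (intro absolutely_integrable_continuous_real ac_deriv_continuous[OF G'])
  have "AE x in lebesgue. f x - (G x + c) = 0"
  proof (rule AE_eq_0_if_fourier_coeff_0)
    show "periodic1 (\<lambda>x. f x - (G x + c))"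
      using ac_derivD(1)[OF G] f(1) by (simp add: periodic1_def)
    show "(\<lambda>x. f x - (G x + c)) absolutely_integrable_on {0..1}"
      by (intro set_integral_diff(1) f G'ai)
    fix k
    have Gc: "fourier_coeff (\<lambda>x. G x + c) k = fourier_coeff G k + (if k = 0 then of_real c else 0)"
      using fourier_coeff_diff[OF Gai, of "\<lambda>x. - c" k]
      by (simp add: fourier_coeff_const absolutely_integrable_continuous_real)
    have "fourier_coeff f k = fourier_coeff G k" if "k \<noteq> 0"
      using fourier_coeff_ac_deriv[OF G, of k] coeff[of k] that by simp
    then show "fourier_coeff (\<lambda>x. f x - (G x + c)) k = 0"
      unfolding fourier_coeff_diff[OF f(2) G'ai] Gc
      using real0[OF f(2)] real0[OF Gai] by (auto simp: c_def complex_eq_iff)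
  qed
  then have "AE x in lebesgue. f x = G x + c" by simp
  then show ?thesis using G' by blast
qed

lemma ac_deriv_if_fourier_coeff_continuous:
  assumes f: "periodic1 f" "continuous_on UNIV f"
    and g: "periodic1 g" "g absolutely_integrable_on {0..1}"
    and coeff: "\<And>k. fourier_coeff g k = 2 * pi * of_int k * \<i> * fourier_coeff f k"
  shows "ac_deriv f g"
proof -
  have fai: "f absolutely_integrable_on {0..1}"
    by (intro absolutely_integrable_continuous_real continuous_on_subset[OF f(2)]) auto
  obtain G where G: "ac_deriv G g" "AE x in lebesgue. f x = G x"
    using ac_deriv_if_fourier_coeff[OF f(1) fai g coeff] by blast
  have "f = G" by (rule continuous_AE_eq[OF f(2) ac_deriv_continuous[OF G(1)] G(2)])
  then show ?thesis using G(1) by simp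
qed

text \<open>Repeated differentiation stays in the span of one cosine and one sine, so the modes are
  admissible test functions; against them a weak derivative reveals its Fourier
  coefficients.\<close>

lemma test_function_trig:
  "test_function (\<lambda>x. A * cos_mode k x + B * sin_mode k x)"
proof -
  define \<omega> where "\<omega> = 2 * pi * of_int k"
  have d: "((\<lambda>x. A * cos (\<omega> * x) + B * sin (\<omega> * x)) has_real_derivative
      (B * \<omega>) * cos (\<omega> * x) + (- A * \<omega>) * sin (\<omega> * x)) (at x)" for A B x
    by (auto intro!: derivative_eq_intros simp: algebra_simps)
  have iter: "\<exists>A' B'. (deriv ^^ n) (\<lambda>x. A * cos (\<omega> * x) + B * sin (\<omega> * x)) = (\<lambda>x. A' * cos (\<omega> * x) + B' * sin (\<omega> * x))" for n
  proof (induction n)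
    case (Suc n)
    then obtain A' B' where "(deriv ^^ n) (\<lambda>x. A * cos (\<omega> * x) + B * sin (\<omega> * x)) = (\<lambda>x. A' * cos (\<omega> * x) + B' * sin (\<omega> * x))"
      by blast
    then have "(deriv ^^ Suc n) (\<lambda>x. A * cos (\<omega> * x) + B * sin (\<omega> * x)) = deriv (\<lambda>x. A' * cos (\<omega> * x) + B' * sin (\<omega> * x))"
      by simp
    also have "\<dots> = (\<lambda>x. (B' * \<omega>) * cos (\<omega> * x) + (- A' * \<omega>) * sin (\<omega> * x))"
      by (rule ext, rule DERIV_imp_deriv, rule d)
    finally show ?case by blast
  qed auto
  have "(deriv ^^ n) (\<lambda>x. A * cos (\<omega> * x) + B * sin (\<omega> * x)) differentiable at x" for n x
  proof -
    from iter[of n] obtain A' B' where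
      "(deriv ^^ n) (\<lambda>x. A * cos (\<omega> * x) + B * sin (\<omega> * x)) = (\<lambda>x. A' * cos (\<omega> * x) + B' * sin (\<omega> * x))" by blast
    then show ?thesis using d[of A' B' x] real_differentiable_def by fastforce
  qed
  then show ?thesis
    unfolding test_function_def \<omega>_def by (auto simp: periodic1_def periodic_cos_sin)
qed

lemma deriv_trig:
  "deriv (\<lambda>x. cos_mode k x) = (\<lambda>x. - (2 * pi * of_int k) * sin_mode k x)"
  "deriv (\<lambda>x. sin_mode k x) = (\<lambda>x. (2 * pi * of_int k) * cos_mode k x)"
  by (rule ext, rule DERIV_imp_deriv, auto intro!: derivative_eq_intros)+

lemma has_weak_deriv_fourier_coeff:
  assumes "has_weak_deriv f g"
  shows "fourier_coeff g k = 2 * pi * of_int k * \<i> * fourier_coeff f k"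
proof -
  have f: "f absolutely_integrable_on {0..1}" and g: "g absolutely_integrable_on {0..1}"
    using assms by (auto simp: has_weak_deriv_def)
  have test: "(LINT x:{0..1}|lebesgue. f x * deriv \<phi> x) = - (LINT x:{0..1}|lebesgue. g x * \<phi> x)"
    if "test_function \<phi>" for \<phi> using assms that by (auto simp: has_weak_deriv_def)
  have conv: "(LINT x:{0..1}|lebesgue. h x * cos_mode k x) = Re (fourier_coeff h k)"
    "(LINT x:{0..1}|lebesgue. h x * sin_mode k x) = - Im (fourier_coeff h k)"
    if "h absolutely_integrable_on {0..1}" for h
    using set_lebesgue_integral_eq_integral(2)[OF absolutely_integrable_fourier(1)[OF that, of k]]
      set_lebesgue_integral_eq_integral(2)[OF absolutely_integrable_fourier(2)[OF that, of k]]
    by (simp_all add: fourier_coeff_eq[OF that])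
  have "test_function (\<lambda>x. cos_mode k x)" "test_function (\<lambda>x. sin_mode k x)"
    using test_function_trig[of 1 k 0] test_function_trig[of 0 k 1] by simp_all
  note t = test[OF this(1), unfolded deriv_trig] test[OF this(2), unfolded deriv_trig]
  have "(\<lambda>x. f x * (- (2 * pi * of_int k) * sin_mode k x)) =
      (\<lambda>x. - (2 * pi * of_int k) * (f x * sin_mode k x))"
    "(\<lambda>x. f x * (2 * pi * of_int k * cos_mode k x)) =
      (\<lambda>x. (2 * pi * of_int k) * (f x * cos_mode k x))"
    by (simp_all add: fun_eq_iff)
  note t' = t[unfolded this set_integral_mult_right]
  have 1: "2 * pi * of_int k * (LINT x:{0..1}|lebesgue. f x * sin_mode k x) =
      (LINT x:{0..1}|lebesgue. g x * cos_mode k x)"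
    using t'(1) by simp
  have 2: "2 * pi * of_int k * (LINT x:{0..1}|lebesgue. f x * cos_mode k x) =
      - (LINT x:{0..1}|lebesgue. g x * sin_mode k x)"
    using t'(2) by simp
  show ?thesis using 1 2 unfolding conv[OF f] conv[OF g] by (simp add: complex_eq_iff)
qed

lemma ac_deriv_imp_has_weak_deriv:
  assumes "ac_deriv f g" shows "has_weak_deriv f g"
  unfolding has_weak_deriv_def
proof (intro conjI allI impI)
  show "f absolutely_integrable_on {0..1}"
    by (intro absolutely_integrable_continuous_real ac_deriv_continuous[OF assms])
  fix \<phi> assume \<phi>: "test_function \<phi>"
  have diff: "(deriv ^^ n) \<phi> differentiable (at x)" for n x using \<phi> by (auto simp: test_function_def)
  have "ac_deriv \<phi> (deriv \<phi>)"
  proof (rule ac_deriv_C1)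
    show "periodic1 \<phi>" using \<phi> by (simp add: test_function_def)
    show "(\<phi> has_real_derivative deriv \<phi> x) (at x)" for x
      using diff[of 0 x] by (simp add: DERIV_deriv_iff_real_differentiable)
    show "continuous_on UNIV (deriv \<phi>)"
      using diff[of 1] by (auto intro!: continuous_at_imp_continuous_on differentiable_imp_continuous_within)
  qed
  from ac_deriv_by_parts[OF assms this]
  have "integral {0..1} (\<lambda>x. f x * deriv \<phi> x) = - integral {0..1} (\<lambda>x. g x * \<phi> x)" .
  moreover have "(\<lambda>x. f x * deriv \<phi> x) absolutely_integrable_on {0..1}" "(\<lambda>x. g x * \<phi> x) absolutely_integrable_on {0..1}"
    using \<open>ac_deriv \<phi> (deriv \<phi>)\<close> assms
    by (simp_all add: continuous_mult_absolutely_integrable ac_derivD(3)[of \<phi>] ac_derivD(3)[of f] ac_deriv_continuous[of \<phi>] ac_deriv_continuous[of f])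
  ultimately show "(LINT x:{0..1}|lebesgue. f x * deriv \<phi> x) = - (LINT x:{0..1}|lebesgue. g x * \<phi> x)"
    by (simp add: set_lebesgue_integral_eq_integral(2))
qed (use ac_derivD[OF assms] in auto)

lemma has_weak_deriv_imp_ac_deriv:
  assumes "has_weak_deriv f g"
  shows "\<exists>G. ac_deriv G g \<and> (AE x in lebesgue. f x = G x)"
  using assms by (intro ac_deriv_if_fourier_coeff has_weak_deriv_fourier_coeff) (auto simp: has_weak_deriv_def)

text \<open>The conclusion is equality of functions, not merely almost everywhere: both arguments
  have the same set of weak derivatives, so \<open>SOME\<close> picks the same representative from
  it.\<close>

lemma weak_deriv_cong:
  assumes "AE x in lebesgue. f1 x = f2 x" "periodic1 f1" "periodic1 f2"
  shows "weak_deriv f1 = weak_deriv f2"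
proof -
  have *: "has_weak_deriv f g" if h: "has_weak_deriv f' g" and ae: "AE x in lebesgue. f x = f' x" and per: "periodic1 f" for f f' g
  proof -
    obtain N where N: "negligible N" "\<And>x. x \<notin> N \<Longrightarrow> f x = f' x" using AE_lebesgueE[OF ae] by blast
    obtain G where G: "ac_deriv G g" "AE x in lebesgue. f' x = G x" using has_weak_deriv_imp_ac_deriv[OF h] by blast
    have w: "has_weak_deriv G g" by (rule ac_deriv_imp_has_weak_deriv[OF G(1)])
    have aeG: "AE x in lebesgue. f x = G x" using ae G(2) by eventually_elim simp
    then obtain M where M: "negligible M" "\<And>x. x \<notin> M \<Longrightarrow> f x = G x" using AE_lebesgueE by blast
    have fai: "f absolutely_integrable_on {0..1}"
    proof (rule absolutely_integrable_spike[OF _ M(1)])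
      show "G absolutely_integrable_on {0..1}" using w by (simp add: has_weak_deriv_def)
    qed (use M(2) in auto)
    have "(LINT x:{0..1}|lebesgue. f x * deriv \<phi> x) = (LINT x:{0..1}|lebesgue. G x * deriv \<phi> x)"
      if "test_function \<phi>" for \<phi>
    proof -
      have "continuous_on {0..1} (deriv \<phi>)"
      proof (rule continuous_at_imp_continuous_on, rule ballI)
        fix x
        have "(deriv ^^ 1) \<phi> differentiable at x" using that unfolding test_function_def by blast
        then show "isCont (deriv \<phi>) x" by (simp add: differentiable_imp_continuous_within)
      qed
      then have "(\<lambda>x. f x * deriv \<phi> x) absolutely_integrable_on {0..1}" "(\<lambda>x. G x * deriv \<phi> x) absolutely_integrable_on {0..1}"
        using fai w by (auto intro!: continuous_mult_absolutely_integrable simp: has_weak_deriv_def)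
      moreover have "integral {0..1} (\<lambda>x. f x * deriv \<phi> x) = integral {0..1} (\<lambda>x. G x * deriv \<phi> x)"
        by (rule integral_spike[OF M(1)]) (use M in auto)
      ultimately show ?thesis by (simp add: set_lebesgue_integral_eq_integral(2))
    qed
    then show ?thesis using w fai per by (simp add: has_weak_deriv_def)
  qed
  have "has_weak_deriv f1 g \<longleftrightarrow> has_weak_deriv f2 g" for g
    using *[of f1 g f2] *[of f2 g f1] assms by (auto simp: eq_commute)
  then show ?thesis by (simp add: weak_deriv_def)
qed

lemma weak_deriv_ac_deriv:
  assumes "ac_deriv f g"
  shows "AE x in lebesgue. weak_deriv f x = g x" "periodic1 (weak_deriv f)" "ac_deriv f (weak_deriv f)"
proof -
  have h: "has_weak_deriv f (weak_deriv f)"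
    unfolding weak_deriv_def by (rule someI[of "has_weak_deriv f", OF ac_deriv_imp_has_weak_deriv[OF assms]])
  then show "periodic1 (weak_deriv f)" by (simp add: has_weak_deriv_def)
  obtain G where G: "ac_deriv G (weak_deriv f)" "AE x in lebesgue. f x = G x"
    using has_weak_deriv_imp_ac_deriv[OF h] by blast
  have "f = G" by (rule continuous_AE_eq[OF ac_deriv_continuous[OF assms] ac_deriv_continuous[OF G(1)] G(2)])
  then show "ac_deriv f (weak_deriv f)" using G(1) by simp
  then show "AE x in lebesgue. weak_deriv f x = g x" by (rule ac_deriv_unique[OF _ assms])
qed

subsection \<open>Fourier series\<close>

definition trig_sum :: "(int \<Rightarrow> complex) \<Rightarrow> int set \<Rightarrow> real \<Rightarrow> complex" where
  "trig_sum c X x = (\<Sum>k\<in>X. c k * cis_mode k x)"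

text \<open>The real part makes the value real for arbitrary coefficients; for those with
  \<open>c (- k) = cnj (c k)\<close>, such as the coefficients of a real function, nothing is
  lost.\<close>

definition fourier_series :: "(int \<Rightarrow> complex) \<Rightarrow> real \<Rightarrow> real" where
  "fourier_series c x = Re (\<Sum>\<^sub>\<infinity>k. c k * cis_mode k x)"

text \<open>The Fourier symbol of the derivative.\<close>

abbreviation ik_mult :: "(int \<Rightarrow> complex) \<Rightarrow> int \<Rightarrow> complex" where
  "ik_mult c \<equiv> \<lambda>k. 2 * pi * of_int k * \<i> * c k"

lemma continuous_on_trig_sum [continuous_intros]: "continuous_on S (trig_sum c X)"
  unfolding trig_sum_def by (intro continuous_intros)

lemma continuous_on_Re_trig_sum [continuous_intros]: "continuous_on S (\<lambda>x. Re (trig_sum c X x))"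
  by (intro continuous_intros)

lemma trig_sum_periodic: "trig_sum c X (x + 1) = trig_sum c X x"
proof -
  have "cis (2 * pi * of_int k * (x + 1)) = cis_mode k x" for k
    by (simp only: complex_eq_iff cis.sel periodic_cos_sin)
  then show ?thesis by (simp add: trig_sum_def)
qed

lemma uniform_limit_trig_sum:
  assumes "(\<lambda>k. cmod (c k)) summable_on UNIV"
  shows "uniform_limit UNIV (\<lambda>X. trig_sum c X) (\<lambda>x. \<Sum>\<^sub>\<infinity>k. c k * cis_mode k x) (finite_subsets_at_top UNIV)"
  unfolding trig_sum_def[abs_def]
  by (rule Weierstrass_m_test_general[OF _ assms]) (simp add: norm_mult)

lemma uniform_limit_fourier_series:
  assumes "(\<lambda>k. cmod (c k)) summable_on UNIV"
  shows "uniform_limit UNIV (\<lambda>X x. Re (trig_sum c X x)) (fourier_series c) (finite_subsets_at_top UNIV)"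
  using bounded_linear.uniform_limit[OF bounded_linear_Re uniform_limit_trig_sum[OF assms]]
  by (simp add: fourier_series_def[abs_def])

lemma fourier_series_continuous:
  assumes "(\<lambda>k. cmod (c k)) summable_on UNIV"
  shows "continuous_on UNIV (fourier_series c)"
  by (rule uniform_limit_theorem[OF _ uniform_limit_fourier_series[OF assms]])
    (auto intro!: always_eventually continuous_intros)

lemma fourier_series_periodic1: "periodic1 (fourier_series c)"
proof -
  have "cis (2 * pi * of_int k * (x + 1)) = cis_mode k x" for k x
    by (simp only: complex_eq_iff cis.sel periodic_cos_sin)
  then show ?thesis by (simp add: periodic1_def fourier_series_def)
qed

lemma abs_fourier_series_le:
  assumes "(\<lambda>k. cmod (c k)) summable_on UNIV"
  shows "\<bar>fourier_series c x\<bar> \<le> (\<Sum>\<^sub>\<infinity>k. cmod (c k))"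
proof -
  have "\<bar>fourier_series c x\<bar> \<le> norm (\<Sum>\<^sub>\<infinity>k. c k * cis_mode k x)"
    unfolding fourier_series_def by (rule abs_Re_le_cmod)
  also have "\<dots> \<le> (\<Sum>\<^sub>\<infinity>k. norm (c k * cis_mode k x))"
    by (rule norm_infsum_bound) (use assms in \<open>simp add: norm_mult\<close>)
  finally show ?thesis by (simp add: norm_mult)
qed

lemma Re_trig_sum_ac_deriv:
  assumes "finite X"
  shows "ac_deriv (\<lambda>x. Re (trig_sum c X x)) (\<lambda>x. Re (trig_sum (ik_mult c) X x))"
proof (rule ac_deriv_C1)
  show "periodic1 (\<lambda>x. Re (trig_sum c X x))" by (simp add: periodic1_def trig_sum_periodic)
  show "continuous_on UNIV (\<lambda>x. Re (trig_sum (ik_mult c) X x))" by (intro continuous_intros)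
  fix x
  have "((\<lambda>x. \<Sum>k\<in>X. Re (c k * cis_mode k x)) has_real_derivative
      (\<Sum>k\<in>X. Re (ik_mult c k * cis_mode k x))) (at x)"
  proof (rule DERIV_sum)
    fix k
    show "((\<lambda>x. Re (c k * cis_mode k x)) has_real_derivative
      Re (ik_mult c k * cis_mode k x)) (at x)"
      by (auto intro!: derivative_eq_intros simp: algebra_simps)
  qed
  then show "((\<lambda>x. Re (trig_sum c X x)) has_real_derivative Re (trig_sum (ik_mult c) X x)) (at x)"
    by (simp only: trig_sum_def Re_sum)
qed

lemma tendsto_integral_uniform_limit:
  fixes f :: "'b \<Rightarrow> real \<Rightarrow> 'a::banach"
  assumes u: "uniform_limit {a..b} f g F" and c: "\<And>n. continuous_on {a..b} (f n)" and F: "F \<noteq> bot"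
  shows "((\<lambda>n. integral {a..b} (f n)) \<longlongrightarrow> integral {a..b} g) F"
proof -
  obtain I J where I: "\<And>n. (f n has_integral I n) {a..b}" and J: "(g has_integral J) {a..b}" and "(I \<longlongrightarrow> J) F"
    using uniform_limit_integral[OF u c F] by blast
  have "I = (\<lambda>n. integral {a..b} (f n))" "J = integral {a..b} g"
    using integral_unique[OF I] integral_unique[OF J] by simp_all
  then show ?thesis using \<open>(I \<longlongrightarrow> J) F\<close> by simp
qed

text \<open>Differentiation term by term in integrated form: the partial sums satisfy the identity,
  and both sides converge.\<close>

lemma fourier_series_ac_deriv:
  assumes c: "(\<lambda>k. cmod (c k)) summable_on UNIV" and c': "(\<lambda>k. cmod (ik_mult c k)) summable_on UNIV"
  shows "ac_deriv (fourier_series c) (fourier_series (ik_mult c))"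
  unfolding ac_deriv_def
proof (intro conjI allI impI fourier_series_periodic1)
  fix a b :: real assume ab: "a \<le> b"
  show "fourier_series (ik_mult c) absolutely_integrable_on {a..b}"
    by (intro absolutely_integrable_continuous_real continuous_on_subset[OF fourier_series_continuous[OF c']]) auto
  let ?F = "finite_subsets_at_top (UNIV :: int set)"
  have "((\<lambda>X. integral {a..b} (\<lambda>x. Re (trig_sum (ik_mult c) X x))) \<longlongrightarrow> integral {a..b} (fourier_series (ik_mult c))) ?F"
    by (rule tendsto_integral_uniform_limit[OF uniform_limit_on_subset[OF uniform_limit_fourier_series[OF c']]])
      (auto intro!: continuous_intros)
  moreover have "\<forall>\<^sub>F X in ?F. integral {a..b} (\<lambda>x. Re (trig_sum (ik_mult c) X x)) = Re (trig_sum c X b) - Re (trig_sum c X a)"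
    using ac_derivD(5)[OF Re_trig_sum_ac_deriv ab] by (auto intro!: eventually_finite_subsets_at_top_weakI)
  ultimately have "((\<lambda>X. Re (trig_sum c X b) - Re (trig_sum c X a)) \<longlongrightarrow> integral {a..b} (fourier_series (ik_mult c))) ?F"
    by (rule Lim_transform_eventually)
  moreover have "((\<lambda>X. Re (trig_sum c X b) - Re (trig_sum c X a)) \<longlongrightarrow> fourier_series c b - fourier_series c a) ?F"
    by (intro tendsto_diff tendsto_uniform_limitI[OF uniform_limit_fourier_series[OF c]]) auto
  ultimately show "fourier_series c b - fourier_series c a = integral {a..b} (fourier_series (ik_mult c))"
    by (rule tendsto_unique[rotated, symmetric]) simp
qed

lemma integral_cis: "integral {0..1} (\<lambda>x. cis_mode m x) = (if m = 0 then 1 else 0)"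
proof (cases "m = 0")
  case False
  define \<omega> where "\<omega> = 2 * pi * real_of_int m"
  have \<omega>: "\<omega> \<noteq> 0" using False by (simp add: \<omega>_def)
  define F where "F x = Complex (sin (\<omega> * x) / \<omega>) (- cos (\<omega> * x) / \<omega>)" for x
  have "((\<lambda>x. cis (\<omega> * x)) has_integral F 1 - F 0) {0..1}"
  proof (rule fundamental_theorem_of_calculus)
    fix x :: real assume "x \<in> {0..1}"
    show "(F has_vector_derivative cis (\<omega> * x)) (at x within {0..1})"
      unfolding has_vector_derivative_complex_iff F_def using \<omega>
      by (auto intro!: derivative_eq_intros)
  qed simp
  moreover have "F 1 = F 0"
    using periodic_cos_sin[of m 0] by (simp add: F_def \<omega>_def)
  ultimately have "((\<lambda>x. cis (\<omega> * x)) has_integral 0) {0..1}" by simp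
  then show ?thesis using False by (simp add: \<omega>_def integral_unique)
qed simp

lemma integral_trig_sum_cis:
  assumes "finite X"
  shows "integral {0..1} (\<lambda>x. trig_sum c X x * cis (- (2 * pi * of_int k * x))) = (if k \<in> X then c k else 0)"
proof -
  have "(\<lambda>x. trig_sum c X x * cis (- (2 * pi * of_int k * x))) = (\<lambda>x. \<Sum>j\<in>X. c j * cis_mode (j - k) x)"
    by (auto simp: trig_sum_def sum_distrib_right mult.assoc cis_mult left_diff_distrib right_diff_distrib fun_eq_iff intro!: sum.cong)
  then have "integral {0..1} (\<lambda>x. trig_sum c X x * cis (- (2 * pi * of_int k * x))) =
      (\<Sum>j\<in>X. integral {0..1} (\<lambda>x. c j * cis_mode (j - k) x))"
    by (simp only:) (intro Henstock_Kurzweil_Integration.integral_sum assms continuous_UNIV_integrable continuous_intros)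
  also have "\<dots> = (\<Sum>j\<in>X. if j = k then c j else 0)"
    by (rule sum.cong) (auto simp: integral_cis simp del: of_int_diff)
  finally show ?thesis using assms by simp
qed

text \<open>Orthogonality gives equality for the modulus of the complex sum; passing to the real
  part costs the inequality.\<close>

lemma integral_Re_trig_sum_sq_le:
  assumes X: "finite X"
  shows "integral {0..1} (\<lambda>x. (Re (trig_sum c X x))\<^sup>2) \<le> (\<Sum>k\<in>X. (cmod (c k))\<^sup>2)"
proof -
  have cnj: "cnj (trig_sum c X x) = (\<Sum>k\<in>X. cnj (c k) * cis (- (2 * pi * of_int k * x)))" for x
    by (simp add: trig_sum_def cis_cnj)
  have sq: "complex_of_real ((cmod (trig_sum c X x))\<^sup>2) = (\<Sum>k\<in>X. cnj (c k) * (trig_sum c X x * cis (- (2 * pi * of_int k * x))))" for x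
    unfolding complex_norm_square cnj by (simp add: sum_distrib_left mult_ac)
  have "complex_of_real (integral {0..1} (\<lambda>x. (cmod (trig_sum c X x))\<^sup>2)) =
      integral {0..1} (\<lambda>x. complex_of_real ((cmod (trig_sum c X x))\<^sup>2))"
    by (rule integral_linear[OF _ bounded_linear_of_real, unfolded o_def, symmetric])
      (intro continuous_UNIV_integrable continuous_intros)
  also have "\<dots> = (\<Sum>k\<in>X. integral {0..1} (\<lambda>x. cnj (c k) * (trig_sum c X x * cis (- (2 * pi * of_int k * x)))))"
    unfolding sq by (intro Henstock_Kurzweil_Integration.integral_sum X continuous_UNIV_integrable continuous_intros)
  also have "\<dots> = (\<Sum>k\<in>X. cnj (c k) * c k)"
    by (rule sum.cong) (simp_all add: integral_trig_sum_cis[OF X])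
  also have "\<dots> = of_real (\<Sum>k\<in>X. (cmod (c k))\<^sup>2)"
    by (simp add: complex_norm_square mult.commute del: of_real_power)
  finally have *: "integral {0..1} (\<lambda>x. (cmod (trig_sum c X x))\<^sup>2) = (\<Sum>k\<in>X. (cmod (c k))\<^sup>2)"
    using of_real_eq_iff by blast
  have "integral {0..1} (\<lambda>x. (Re (trig_sum c X x))\<^sup>2) \<le> integral {0..1} (\<lambda>x. (cmod (trig_sum c X x))\<^sup>2)"
    by (rule integral_le) (auto intro!: continuous_UNIV_integrable continuous_intros abs_le_square_iff[THEN iffD1] abs_Re_le_cmod simp: abs_Re_le_cmod)
  then show ?thesis using * by simp
qed

lemma fourier_coeff_continuous:
  assumes "continuous_on UNIV f"
  shows "fourier_coeff f k = integral {0..1} (\<lambda>x. complex_of_real (f x) * cis (- (2 * pi * of_int k * x)))"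
  unfolding fourier_coeff_def
  by (intro set_lebesgue_integral_eq_integral(2) absolutely_integrable_continuous_real continuous_intros
      continuous_on_subset[OF assms]) auto

lemma infsum_int_uminus: "(\<Sum>\<^sub>\<infinity>k::int. f (- k)) = (\<Sum>\<^sub>\<infinity>k. f k)"
  by (rule infsum_reindex_bij_betw) (rule bij_uminus)

lemma fourier_series_complex:
  assumes c: "(\<lambda>k. cmod (c k)) summable_on UNIV" and sym: "\<And>k. c (- k) = cnj (c k)"
  shows "complex_of_real (fourier_series c x) = (\<Sum>\<^sub>\<infinity>k. c k * cis_mode k x)"
proof -
  let ?S = "\<Sum>\<^sub>\<infinity>k. c k * cis_mode k x"
  have "cnj ?S = (\<Sum>\<^sub>\<infinity>k. cnj (c k * cis_mode k x))" by (rule infsum_cnj[symmetric])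
  also have "\<dots> = (\<Sum>\<^sub>\<infinity>k. c (- k) * cis_mode (- k) x)"
    by (simp add: sym cis_cnj)
  also have "\<dots> = ?S" by (rule infsum_int_uminus)
  finally have "Im ?S = 0" by (simp add: complex_eq_iff)
  then show ?thesis by (simp add: fourier_series_def complex_eq_iff)
qed

lemma fourier_coeff_fourier_series:
  assumes c: "(\<lambda>k. cmod (c k)) summable_on UNIV" and sym: "\<And>k. c (- k) = cnj (c k)"
  shows "fourier_coeff (fourier_series c) k = c k"
proof -
  let ?F = "finite_subsets_at_top (UNIV :: int set)"
  let ?e = "\<lambda>x. cis (- (2 * pi * of_int k * x))"
  have "uniform_limit UNIV (\<lambda>X. trig_sum c X) (\<lambda>x. complex_of_real (fourier_series c x)) ?F"
    unfolding fourier_series_complex[OF assms] by (rule uniform_limit_trig_sum[OF c])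
  then have "uniform_limit {0..1} (\<lambda>X. trig_sum c X) (\<lambda>x. complex_of_real (fourier_series c x)) ?F"
    by (rule uniform_limit_on_subset) simp
  moreover have "uniform_limit {0..1} (\<lambda>X. ?e) ?e ?F" by (rule uniform_limit_const)
  ultimately have "uniform_limit {0..1} (\<lambda>X x. trig_sum c X x * ?e x) (\<lambda>x. complex_of_real (fourier_series c x) * ?e x) ?F"
    by (rule uniform_lim_mult)
      (auto intro!: compact_imp_bounded compact_continuous_image continuous_intros
        continuous_on_subset[OF fourier_series_continuous[OF c]])
  then have "((\<lambda>X. integral {0..1} (\<lambda>x. trig_sum c X x * ?e x)) \<longlongrightarrow> integral {0..1} (\<lambda>x. complex_of_real (fourier_series c x) * ?e x)) ?F"
    by (rule tendsto_integral_uniform_limit) (auto intro!: continuous_intros)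
  moreover have "\<forall>\<^sub>F X in ?F. integral {0..1} (\<lambda>x. trig_sum c X x * ?e x) = c k"
    unfolding eventually_finite_subsets_at_top
    by (rule exI[of _ "{k}"]) (auto simp: integral_trig_sum_cis)
  ultimately have "((\<lambda>X. c k) \<longlongrightarrow> integral {0..1} (\<lambda>x. complex_of_real (fourier_series c x) * ?e x)) ?F"
    by (rule Lim_transform_eventually)
  then have "integral {0..1} (\<lambda>x. complex_of_real (fourier_series c x) * ?e x) = c k"
    by (rule tendsto_unique[rotated]) auto
  then show ?thesis using fourier_coeff_continuous[OF fourier_series_continuous[OF c]] by simp
qed

lemma fourier_coeff_uminus:
  assumes "f absolutely_integrable_on {0..1}"
  shows "fourier_coeff f (- k) = cnj (fourier_coeff f k)"
  by (simp add: fourier_coeff_eq[OF assms] complex_eq_iff)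

lemma eq_fourier_series:
  assumes f: "continuous_on UNIV f" "periodic1 f" and c: "(\<lambda>k. cmod (fourier_coeff f k)) summable_on UNIV"
  shows "f = fourier_series (fourier_coeff f)"
proof -
  have fai: "f absolutely_integrable_on {0..1}"
    by (intro absolutely_integrable_continuous_real continuous_on_subset[OF f(1)]) auto
  note sc = fourier_series_continuous[OF c]
  have gai: "fourier_series (fourier_coeff f) absolutely_integrable_on {0..1}"
    by (intro absolutely_integrable_continuous_real continuous_on_subset[OF sc]) auto
  have "(\<lambda>x. f x - fourier_series (fourier_coeff f) x) = (\<lambda>x. 0)"
  proof (rule continuous_fourier_unique)
    show "continuous_on UNIV (\<lambda>x. f x - fourier_series (fourier_coeff f) x)" by (intro continuous_intros f sc)
    show "periodic1 (\<lambda>x. f x - fourier_series (fourier_coeff f) x)"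
      using f(2) fourier_series_periodic1[of "fourier_coeff f"] by (simp add: periodic1_def)
    show "fourier_coeff (\<lambda>x. f x - fourier_series (fourier_coeff f) x) k = 0" for k
      by (simp add: fourier_coeff_diff[OF fai gai] fourier_coeff_fourier_series[OF c fourier_coeff_uminus[OF fai]])
  qed
  then show ?thesis by (metis (no_types, lifting) eq_iff_diff_eq_0 ext)
qed

text \<open>For derivatives that are handled on one period only: the limit in the Riesz--Fischer
  argument, and the peakon with its kinks at the integers.\<close>

lemma ac_deriv_if_unit_interval:
  assumes f: "periodic1 f" and g: "periodic1 g" "g absolutely_integrable_on {0..1}"
    and fg: "\<And>x. 0 \<le> x \<Longrightarrow> x \<le> 1 \<Longrightarrow> f x - f 0 = integral {0..x} g"
  shows "ac_deriv f g"
proof -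
  have "f 1 = f 0" using f unfolding periodic1_def by (metis add_0)
  then have "integral {0..1} g = 0" using fg[of 1] by simp
  then obtain G where G: "ac_deriv G g" using ac_deriv_exists[OF g] by blast
  have "f x = G x + (f 0 - G 0)" for x
  proof -
    have "f (frac x) - f 0 = G (frac x) - G 0"
      using fg[of "frac x"] ac_derivD(5)[OF G, of 0 "frac x"] by (simp add: less_imp_le frac_lt_1)
    then show ?thesis using periodic1_frac[OF f] periodic1_frac[OF ac_derivD(1)[OF G]] by simp
  qed
  then have "f = (\<lambda>x. G x + (f 0 - G 0))" by blast
  moreover have "ac_deriv (\<lambda>x. G x + (f 0 - G 0)) (\<lambda>x. g x + 0)" by (rule ac_deriv_add[OF G ac_deriv_const])
  ultimately show ?thesis by simp
qed

text \<open>
  A Riesz--Fischer argument: along a fast subsequence the derivatives of the partial sums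
  converge absolutely in mean, hence almost everywhere.
\<close>

lemma fourier_series_ac_deriv_exists:
  assumes a: "(\<lambda>k. cmod (a k)) summable_on UNIV"
    and c: "(\<lambda>k. (cmod (ik_mult a k))\<^sup>2) summable_on UNIV"
  shows "\<exists>g. ac_deriv (fourier_series a) g"
proof -
  define c where "c = ik_mult a"
  define X where "X n = {- int n..int n}" for n
  define S where "S = (\<Sum>\<^sub>\<infinity>k. (cmod (c k))\<^sup>2)"
  have filt: "filterlim X (finite_subsets_at_top UNIV) sequentially"
    unfolding filterlim_finite_subsets_at_top
  proof (intro allI impI)
    fix Y :: "int set" assume "finite Y \<and> Y \<subseteq> UNIV"
    then have Y: "finite Y" by simp
    obtain n :: nat where n: "\<forall>k\<in>Y. nat \<bar>k\<bar> \<le> n" using finite_nat_set_iff_bounded_le[of "(\<lambda>k. nat \<bar>k\<bar>) ` Y"] Y by auto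
    show "\<forall>\<^sub>F m in sequentially. finite (X m) \<and> Y \<subseteq> X m \<and> X m \<subseteq> UNIV"
      using eventually_ge_at_top[of n]
    proof eventually_elim
      case (elim m)
      have "k \<in> X m" if "k \<in> Y" for k using bspec[OF n that] elim unfolding X_def by auto
      then show ?case by (auto simp: X_def)
    qed
  qed
  have hs: "((\<lambda>k. (cmod (c k))\<^sup>2) has_sum S) UNIV" unfolding S_def c_def by (rule has_sum_infsum[OF c])
  have lim: "(\<lambda>n. \<Sum>k\<in>X n. (cmod (c k))\<^sup>2) \<longlonglongrightarrow> S"
    using filterlim_compose[OF hs[unfolded has_sum_def] filt] by simp
  have upper: "(\<Sum>k\<in>Y. (cmod (c k))\<^sup>2) \<le> S" if "finite Y" for Y
    unfolding S_def c_def by (rule finite_sum_le_infsum[OF c that]) auto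
  have "\<exists>N. \<forall>n\<ge>N. S - (\<Sum>k\<in>X n. (cmod (c k))\<^sup>2) \<le> (1/4)^j" for j
  proof -
    have "\<forall>\<^sub>F n in sequentially. dist (\<Sum>k\<in>X n. (cmod (c k))\<^sup>2) S < (1/4)^j"
      by (rule tendstoD[OF lim]) simp
    then obtain N where "\<forall>n\<ge>N. dist (\<Sum>k\<in>X n. (cmod (c k))\<^sup>2) S < (1/4)^j"
      unfolding eventually_sequentially by blast
    then have "\<forall>n\<ge>N. S - (\<Sum>k\<in>X n. (cmod (c k))\<^sup>2) \<le> (1/4)^j" by (force simp: dist_real_def)
    then show ?thesis by blast
  qed
  then obtain N where N: "\<And>j n. n \<ge> N j \<Longrightarrow> S - (\<Sum>k\<in>X n. (cmod (c k))\<^sup>2) \<le> (1/4)^j" by metis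
  \<comment> \<open>Summing all earlier \<open>N i\<close> makes r nondecreasing, and the summand j
    makes it tend to infinity even if N is bounded.\<close>
  define r where "r j = j + (\<Sum>i\<le>j. N i)" for j
  have r: "r j \<ge> N j" "r j \<ge> j" "r j \<le> r (Suc j)" for j
    using member_le_sum[of j "{..j}" N] by (auto simp: r_def)
  \<comment> \<open>Starting with the empty set lets the increments \<open>P j\<close> telescope to
    the full partial sum.\<close>
  define Y where "Y j = (case j of 0 \<Rightarrow> {} | Suc i \<Rightarrow> X (r i))" for j
  have Yfin: "finite (Y j)" for j by (auto simp: Y_def X_def split: nat.split)
  have Ysub: "Y j \<subseteq> Y (Suc j)" for j
    using r(3)[of "j - 1"] by (cases j) (auto simp: Y_def X_def)
  define P where "P j x = Re (trig_sum c (Y (Suc j) - Y j) x)" for j x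
  have Pc: "continuous_on A (P j)" for A j unfolding P_def by (intro continuous_intros)
  have Ptel: "(\<Sum>j<n. P j x) = Re (trig_sum c (Y n) x)" for n x
  proof (induction n)
    case 0 then show ?case by (simp add: trig_sum_def Y_def)
  next
    case (Suc n)
    have "trig_sum c (Y (Suc n)) x = trig_sum c (Y n) x + trig_sum c (Y (Suc n) - Y n) x"
      unfolding trig_sum_def by (rule sum.subset_diff[OF Ysub Yfin, simplified add.commute])
    then show ?case using Suc by (simp add: P_def)
  qed
  have Pint: "(\<lambda>x. \<bar>P j x\<bar>) integrable_on {p..q}" for j p q
    by (intro integrable_continuous_real continuous_intros Pc)
  have Pbound: "integral {0..1} (\<lambda>x. \<bar>P (Suc j) x\<bar>) \<le> (1/2)^j" for j
  proof -
    have sub: "X (r j) \<subseteq> X (r (Suc j))" using r(3)[of j] by (auto simp: X_def)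
    have fin: "finite (X (r (Suc j)))" by (simp add: X_def)
    have "integral {0..1} (\<lambda>x. (P (Suc j) x)\<^sup>2) \<le> (\<Sum>k\<in>Y (Suc (Suc j)) - Y (Suc j). (cmod (c k))\<^sup>2)"
      unfolding P_def by (rule integral_Re_trig_sum_sq_le) (use Yfin in auto)
    also have "\<dots> = (\<Sum>k\<in>X (r (Suc j)). (cmod (c k))\<^sup>2) - (\<Sum>k\<in>X (r j). (cmod (c k))\<^sup>2)"
      using sum_diff[OF fin sub, of "\<lambda>k. (cmod (c k))\<^sup>2"] by (simp add: Y_def)
    also have "\<dots> \<le> (1/4)^j" using upper[OF fin] N[OF r(1), of j] by simp
    finally have sq: "integral {0..1} (\<lambda>x. (P (Suc j) x)\<^sup>2) \<le> (1/4)^j" .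
    \<comment> \<open>From the mean square to the mean by 2 |p| <= t p^2 + 1 / t. The weight t = 2^j
      balances the two terms, because the mean square is at most (1/4)^j.\<close>
    have "integral {0..1} (\<lambda>x. \<bar>P (Suc j) x\<bar>) \<le> integral {0..1} (\<lambda>x. (2^j * (P (Suc j) x)\<^sup>2 + (1/2)^j) / 2)"
    proof (rule integral_le[OF Pint])
      show "(\<lambda>x. (2^j * (P (Suc j) x)\<^sup>2 + (1/2)^j) / 2) integrable_on {0..1}"
        by (intro integrable_continuous_real continuous_intros Pc) auto
      fix x :: real
      define t :: real where "t = 2^j"
      have t: "t > 0" "(1/2)^j = 1 / t" by (auto simp: t_def power_divide)
      have "0 \<le> (t * \<bar>P (Suc j) x\<bar> - 1)\<^sup>2 / t" using t by simp
      also have "\<dots> = t * (P (Suc j) x)\<^sup>2 + 1 / t - 2 * \<bar>P (Suc j) x\<bar>"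
        using t by (simp add: power2_eq_square field_simps)
      finally show "\<bar>P (Suc j) x\<bar> \<le> (2^j * (P (Suc j) x)\<^sup>2 + (1/2)^j) / 2"
        unfolding t(2) t_def[symmetric] by simp
    qed
    also have "\<dots> = (2^j * integral {0..1} (\<lambda>x. (P (Suc j) x)\<^sup>2) + (1/2)^j) / 2"
    proof -
      have "integral {0..1} (\<lambda>x. 2^j * (P (Suc j) x)\<^sup>2 + (1/2)^j) = 2^j * integral {0..1} (\<lambda>x. (P (Suc j) x)\<^sup>2) + (1/2)^j"
        by (subst integral_add) (auto intro!: integrable_continuous_real continuous_intros Pc)
      then show ?thesis by simp
    qed
    also have "\<dots> \<le> (2^j * (1/4)^j + (1/2)^j) / 2"
      by (intro divide_right_mono add_right_mono mult_left_mono sq) auto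
    also have "(2::real)^j * (1/4)^j = (1/2)^j" by (simp add: power_mult_distrib[symmetric])
    finally show ?thesis by simp
  qed
  have sumP: "summable (\<lambda>j. integral {0..1} (\<lambda>x. \<bar>P j x\<bar>))"
  proof -
    have "summable (\<lambda>j. integral {0..1} (\<lambda>x. \<bar>P (Suc j) x\<bar>))"
      by (rule summable_comparison_test'[of "\<lambda>j. (1/2)^j" 0])
        (use Pbound integral_nonneg[OF Pint] in \<open>auto intro!: summable_geometric simp: abs_of_nonneg\<close>)
    then show ?thesis by (subst (asm) summable_Suc_iff)
  qed
  \<comment> \<open>Where the series diverges this is some default value, but only on a null set;
    periodicity holds there too because every \<open>P j\<close> is periodic.\<close>
  define g where "g x = (\<Sum>j. P j x)" for x
  have main: "g absolutely_integrable_on {0..y} \<and> (\<lambda>j. integral {0..y} (P j)) sums integral {0..y} g"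
    if y: "0 \<le> y" "y \<le> 1" for y
  proof -
    let ?f = "\<lambda>j x. indicator {0..y} x * P j x"
    have Pai: "P j absolutely_integrable_on {0..y}" for j
      by (intro absolutely_integrable_continuous_real Pc)
    then have int: "integrable lebesgue (?f j)" for j by (simp add: set_integrable_def)
    have nrm: "(\<integral>x. norm (?f j x) \<partial>lebesgue) = integral {0..y} (\<lambda>x. \<bar>P j x\<bar>)" for j
    proof -
      have "(\<integral>x. norm (?f j x) \<partial>lebesgue) = (LINT x:{0..y}|lebesgue. \<bar>P j x\<bar>)"
        unfolding set_lebesgue_integral_def by (rule Bochner_Integration.integral_cong) (auto simp: abs_mult)
      also have "\<dots> = integral {0..y} (\<lambda>x. \<bar>P j x\<bar>)"
        by (rule set_lebesgue_integral_eq_integral(2))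
          (intro absolutely_integrable_continuous_real continuous_intros Pc)
      finally show ?thesis .
    qed
    have le: "integral {0..y} (\<lambda>x. \<bar>P j x\<bar>) \<le> integral {0..1} (\<lambda>x. \<bar>P j x\<bar>)" for j
      by (rule integral_subset_le) (use y Pint in auto)
    have s: "summable (\<lambda>j. \<integral>x. norm (?f j x) \<partial>lebesgue)"
      unfolding nrm by (rule summable_comparison_test'[OF sumP, of 0]) (use le Pint in \<open>auto simp: integral_nonneg abs_of_nonneg\<close>)
    have "(\<integral>\<^sup>+x. (\<Sum>j. ennreal (norm (?f j x))) \<partial>lebesgue) = (\<Sum>j. \<integral>\<^sup>+x. ennreal (norm (?f j x)) \<partial>lebesgue)"
      by (rule nn_integral_suminf) (use int in measurable)
    also have "\<dots> = (\<Sum>j. ennreal (\<integral>x. norm (?f j x) \<partial>lebesgue))"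
      by (simp only: nn_integral_eq_integral[OF integrable_norm[OF int]] norm_ge_zero AE_I2)
    also have "\<dots> = ennreal (\<Sum>j. \<integral>x. norm (?f j x) \<partial>lebesgue)"
      by (rule suminf_ennreal2) (use s in auto)
    finally have "(\<integral>\<^sup>+x. (\<Sum>j. ennreal (norm (?f j x))) \<partial>lebesgue) \<noteq> \<infinity>" by simp
    then have "AE x in lebesgue. (\<Sum>j. ennreal (norm (?f j x))) \<noteq> \<infinity>"
      by (intro nn_integral_noteq_infinite) (use int in measurable)
    then have ae: "AE x in lebesgue. summable (\<lambda>j. norm (?f j x))"
      by eventually_elim (auto intro!: summable_suminf_not_top)
    have sumf: "(\<lambda>x. \<Sum>j. ?f j x) = (\<lambda>x. indicator {0..y} x *\<^sub>R g x)"
      by (auto simp: g_def indicator_def fun_eq_iff)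
    have "integrable lebesgue (\<lambda>x. \<Sum>j. ?f j x)" by (rule integrable_suminf[OF int ae s])
    then have gai: "g absolutely_integrable_on {0..y}" unfolding sumf set_integrable_def .
    have "(\<lambda>j. integral\<^sup>L lebesgue (?f j)) sums (\<integral>x. (\<Sum>j. ?f j x) \<partial>lebesgue)"
      by (rule sums_integral[OF int ae s])
    moreover have "integral\<^sup>L lebesgue (?f j) = integral {0..y} (P j)" for j
      using set_lebesgue_integral_eq_integral(2)[OF Pai, of j] by (simp add: set_lebesgue_integral_def)
    moreover have "(\<integral>x. (\<Sum>j. ?f j x) \<partial>lebesgue) = integral {0..y} g"
      unfolding sumf using set_lebesgue_integral_eq_integral(2)[OF gai] by (simp add: set_lebesgue_integral_def)
    ultimately show ?thesis using gai by simp
  qed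
  have "ac_deriv (fourier_series a) g"
  proof (rule ac_deriv_if_unit_interval[OF fourier_series_periodic1])
    show "periodic1 g" by (simp add: periodic1_def g_def P_def trig_sum_periodic)
    show "g absolutely_integrable_on {0..1}" using main[of 1] by simp
    fix y :: real assume y: "0 \<le> y" "y \<le> 1"
    have "(\<Sum>j<n. integral {0..y} (P j)) = Re (trig_sum a (Y n) y) - Re (trig_sum a (Y n) 0)" for n
    proof -
      have "(\<Sum>j<n. integral {0..y} (P j)) = integral {0..y} (\<lambda>x. \<Sum>j<n. P j x)"
        by (rule Henstock_Kurzweil_Integration.integral_sum[symmetric])
          (auto intro!: integrable_continuous_real Pc)
      also have "\<dots> = Re (trig_sum a (Y n) y) - Re (trig_sum a (Y n) 0)"
        unfolding Ptel c_def by (rule ac_derivD(5)[OF Re_trig_sum_ac_deriv[OF Yfin] y(1)])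
      finally show ?thesis .
    qed
    then have "(\<lambda>n. Re (trig_sum a (Y n) y) - Re (trig_sum a (Y n) 0)) \<longlonglongrightarrow> integral {0..y} g"
      using main[OF y] by (simp add: sums_def)
    then have "(\<lambda>n. Re (trig_sum a (Y (Suc n)) y) - Re (trig_sum a (Y (Suc n)) 0)) \<longlonglongrightarrow> integral {0..y} g"
      by (rule LIMSEQ_Suc)
    moreover have "filterlim (\<lambda>n. Y (Suc n)) (finite_subsets_at_top UNIV) sequentially"
    proof -
      have "filterlim r sequentially sequentially"
        by (rule filterlim_at_top_mono[OF filterlim_ident]) (use r(2) in auto)
      from filterlim_compose[OF filt this] show ?thesis by (simp add: Y_def)
    qed
    then have "(\<lambda>n. Re (trig_sum a (Y (Suc n)) y) - Re (trig_sum a (Y (Suc n)) 0)) \<longlonglongrightarrow> fourier_series a y - fourier_series a 0"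
      by (intro tendsto_diff filterlim_compose[OF tendsto_uniform_limitI[OF uniform_limit_fourier_series[OF a]]]) auto
    ultimately show "fourier_series a y - fourier_series a 0 = integral {0..y} g"
      using LIMSEQ_unique by blast
  qed
  then show ?thesis by blast
qed

subsection \<open>Sobolev regularity\<close>

lemma summable_on_int_iff_nat:
  fixes f :: "int \<Rightarrow> real"
  assumes "(\<lambda>n::nat. f (int n)) summable_on UNIV" "(\<lambda>n::nat. f (- int n)) summable_on UNIV"
  shows "f summable_on UNIV"
proof -
  have "f summable_on (range int)"
    using assms(1) by (subst summable_on_reindex) (auto simp: inj_on_def o_def)
  moreover have "f summable_on (range (\<lambda>n. - int n))"
    using assms(2) by (subst summable_on_reindex) (auto simp: inj_on_def o_def)
  moreover have "UNIV = range int \<union> (range (\<lambda>n. - int n) - range int)"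
  proof -
    have "k \<in> range int \<union> range (\<lambda>n. - int n)" for k
      by (cases k rule: int_cases2) auto
    then show ?thesis by auto
  qed
  ultimately show ?thesis
    using summable_on_Un_disjoint[of f "range int" "range (\<lambda>n. - int n) - range int"]
      summable_on_subset_banach[of f "range (\<lambda>n. - int n)" "range (\<lambda>n. - int n) - range int"]
    by auto
qed

lemma summable_on_inverse_weight: "(\<lambda>k::int. 1 / (1 + (2 * pi * of_int k)\<^sup>2)) summable_on UNIV"
proof -
  have "summable (\<lambda>n. 2 * inverse (real (Suc n) ^ 2))"
    using inverse_power_summable[of 2, where 'a=real] summable_Suc_iff[of "\<lambda>n. inverse (real n ^ 2)"]
    by (intro summable_mult) simp
  then have "summable (\<lambda>n::nat. 1 / (1 + (2 * pi * real n)\<^sup>2))"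
  proof (rule summable_comparison_test'[where N=0])
    fix n :: nat
    have "1 \<le> 2 * pi" using pi_gt3 by simp
    then have "real n \<le> 2 * pi * real n" using mult_right_mono[of 1 "2 * pi" "real n"] by simp
    then have sq: "(real n)\<^sup>2 \<le> (2 * pi * real n)\<^sup>2" by (intro power_mono) auto
    have "(real (Suc n))\<^sup>2 \<le> 2 * (1 + (real n)\<^sup>2)"
      using sum_squares_ge_zero[of "real n - 1" 0] by (simp add: power2_eq_square algebra_simps)
    also have "\<dots> \<le> 2 * (1 + (2 * pi * real n)\<^sup>2)"
      by (intro mult_left_mono add_left_mono sq) auto
    finally have "(real (Suc n))\<^sup>2 \<le> 2 * (1 + (2 * pi * real n)\<^sup>2)" .
    moreover have "(real (Suc n))\<^sup>2 > 0" "1 + (2 * pi * real n)\<^sup>2 > 0" by (auto intro: add_pos_nonneg)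
    ultimately show "norm (1 / (1 + (2 * pi * real n)\<^sup>2)) \<le> 2 * inverse (real (Suc n) ^ 2)"
      by (simp add: divide_simps del: of_nat_Suc)
  qed
  then have "(\<lambda>n::nat. 1 / (1 + (2 * pi * real n)\<^sup>2)) summable_on UNIV"
    by (subst summable_on_UNIV_nonneg_real_iff) auto
  then show ?thesis by (intro summable_on_int_iff_nat) simp_all
qed

text \<open>The constant of the embedding of \<open>H^1\<close> into the bounded functions, from
  Cauchy--Schwarz on the Fourier side.\<close>

definition sobolev_const :: real where
  "sobolev_const = sqrt (\<Sum>\<^sub>\<infinity>k::int. 1 / (1 + (2 * pi * of_int k)\<^sup>2))"

abbreviation sobolev_summable :: "real \<Rightarrow> (int \<Rightarrow> complex) \<Rightarrow> bool" where
  "sobolev_summable s c \<equiv> (\<lambda>k. sobolev_weight s k * (cmod (c k))\<^sup>2) summable_on UNIV"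

lemma sobolev_weight_nonneg [simp]: "sobolev_weight s k \<ge> 0"
  by (simp add: sobolev_weight_def)

lemma weight_base: "1 \<le> 1 + (2 * pi * of_int k)\<^sup>2" "0 < 1 + (2 * pi * of_int k)\<^sup>2"
proof -
  show "1 \<le> 1 + (2 * pi * of_int k)\<^sup>2" by simp
  then show "0 < 1 + (2 * pi * of_int k)\<^sup>2" by linarith
qed

lemma sobolev_weight_mono: "s \<le> s' \<Longrightarrow> sobolev_weight s k \<le> sobolev_weight s' k"
  unfolding sobolev_weight_def using weight_base(1)[of k] by (rule powr_mono[rotated])

text \<open>Cauchy--Schwarz after splitting the weight of exponent (s - 1) / 2 into exponents -1/2
  and s / 2. The sequence d may carry any symbol dominated by that weight, so one statement covers a
  function and its derivatives.\<close>

lemma sobolev_summable_embedding: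
  assumes c: "sobolev_summable s c" and d: "\<And>k. cmod (d k) \<le> sobolev_weight ((s - 1) / 2) k * cmod (c k)"
  shows "(\<lambda>k. cmod (d k)) summable_on UNIV"
    "(\<Sum>\<^sub>\<infinity>k. cmod (d k)) \<le> sobolev_const * sqrt (\<Sum>\<^sub>\<infinity>k. sobolev_weight s k * (cmod (c k))\<^sup>2)"
proof -
  let ?w = "\<lambda>k::int. 1 + (2 * pi * of_int k)\<^sup>2"
  let ?B = "sobolev_const * sqrt (\<Sum>\<^sub>\<infinity>k. sobolev_weight s k * (cmod (c k))\<^sup>2)"
  have bound: "(\<Sum>k\<in>X. cmod (d k)) \<le> ?B" if X: "finite X" for X
  proof -
    let ?a = "\<lambda>k. ?w k powr (- 1 / 2)" and ?b = "\<lambda>k. ?w k powr (s / 2) * cmod (c k)"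
    have ab: "sobolev_weight ((s - 1) / 2) k * cmod (c k) = ?a k * ?b k" for k
      by (simp add: sobolev_weight_def powr_add[symmetric] mult.assoc[symmetric] diff_divide_distrib)
    have a2: "(?a k)\<^sup>2 = 1 / ?w k" for k
    proof -
      have "(?a k)\<^sup>2 = ?w k powr (- 1)"
        using weight_base(2)[of k] by (simp add: powr_power)
      then show ?thesis using weight_base(2)[of k] by (simp add: powr_minus_divide)
    qed
    have b2: "(?b k)\<^sup>2 = sobolev_weight s k * (cmod (c k))\<^sup>2" for k
      using weight_base(2)[of k] by (simp add: power_mult_distrib powr_power sobolev_weight_def)
    have "(\<Sum>k\<in>X. cmod (d k)) \<le> (\<Sum>k\<in>X. \<bar>?a k\<bar> * \<bar>?b k\<bar>)"
      by (rule sum_mono) (use d ab in \<open>simp add: abs_mult\<close>)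
    also have "\<dots> \<le> L2_set ?a X * L2_set ?b X" by (rule L2_set_mult_ineq)
    also have "\<dots> = sqrt (\<Sum>k\<in>X. 1 / ?w k) * sqrt (\<Sum>k\<in>X. sobolev_weight s k * (cmod (c k))\<^sup>2)"
      unfolding L2_set_def a2 b2 ..
    also have "\<dots> \<le> ?B" unfolding sobolev_const_def
      by (intro mult_mono real_sqrt_le_mono finite_sum_le_infsum summable_on_inverse_weight c X)
        (auto intro!: infsum_nonneg sum_nonneg)
    finally show ?thesis .
  qed
  show s: "(\<lambda>k. cmod (d k)) summable_on UNIV"
    by (rule nonneg_bounded_partial_sums_imp_summable_on[where C="?B"])
      (auto intro!: eventually_finite_subsets_at_top_weakI bound)
  show "(\<Sum>\<^sub>\<infinity>k. cmod (d k)) \<le> ?B" by (rule infsum_le_finite_sums[OF s]) (use bound in auto)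
qed

text \<open>The first three bounds are applied with (s - 1) / 2 in place of s, whence the thresholds
  1, 2, 3 for summable coefficients of f, f' and f''. The last one controls the square of the symbol
  of f'''.\<close>

lemma sobolev_weight_ge:
  "s \<ge> 0 \<Longrightarrow> 1 \<le> sobolev_weight s k"
  "s \<ge> 1 / 2 \<Longrightarrow> \<bar>2 * pi * of_int k\<bar> \<le> sobolev_weight s k"
  "s \<ge> 1 \<Longrightarrow> (2 * pi * of_int k)\<^sup>2 \<le> sobolev_weight s k"
  "s \<ge> 3 \<Longrightarrow> (2 * pi * of_int k)\<^sup>2 ^ 3 \<le> sobolev_weight s k"
proof -
  note w = weight_base[of k]
  have "sobolev_weight 0 k = 1" "sobolev_weight 1 k = 1 + (2 * pi * of_int k)\<^sup>2"
    using w by (simp_all add: sobolev_weight_def)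
  then show "s \<ge> 0 \<Longrightarrow> 1 \<le> sobolev_weight s k" "s \<ge> 1 \<Longrightarrow> (2 * pi * of_int k)\<^sup>2 \<le> sobolev_weight s k"
    using sobolev_weight_mono[of 0 s k] sobolev_weight_mono[of 1 s k] by auto
  have "\<bar>2 * pi * of_int k\<bar> = sqrt ((2 * pi * of_int k)\<^sup>2)" by simp
  also have "\<dots> \<le> sqrt (1 + (2 * pi * of_int k)\<^sup>2)" by (intro real_sqrt_le_mono) simp
  also have "\<dots> = sobolev_weight (1/2) k" using w by (simp add: sobolev_weight_def powr_half_sqrt)
  finally show "s \<ge> 1 / 2 \<Longrightarrow> \<bar>2 * pi * of_int k\<bar> \<le> sobolev_weight s k"
    using sobolev_weight_mono[of "1/2" s k] by linarith
  have "(2 * pi * of_int k)\<^sup>2 ^ 3 \<le> (1 + (2 * pi * of_int k)\<^sup>2) ^ 3" by (intro power_mono) auto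
  also have "\<dots> = sobolev_weight 3 k" using w by (simp add: sobolev_weight_def powr_numeral)
  finally show "s \<ge> 3 \<Longrightarrow> (2 * pi * of_int k)\<^sup>2 ^ 3 \<le> sobolev_weight s k"
    using sobolev_weight_mono[of 3 s k] by linarith
qed

lemma cmod_ik_mult: "cmod (ik_mult c k) = \<bar>2 * pi * of_int k\<bar> * cmod (c k)"
  by (simp add: norm_mult abs_mult)

lemma sobolev_summable_embeddings:
  assumes c: "sobolev_summable s c"
  shows "s \<ge> 1 \<Longrightarrow> (\<lambda>k. cmod (c k)) summable_on UNIV"
    "s \<ge> 1 \<Longrightarrow> (\<Sum>\<^sub>\<infinity>k. cmod (c k)) \<le> sobolev_const * sqrt (\<Sum>\<^sub>\<infinity>k. sobolev_weight s k * (cmod (c k))\<^sup>2)"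
    "s \<ge> 2 \<Longrightarrow> (\<lambda>k. cmod (ik_mult c k)) summable_on UNIV"
    "s \<ge> 2 \<Longrightarrow> (\<Sum>\<^sub>\<infinity>k. cmod (ik_mult c k)) \<le> sobolev_const * sqrt (\<Sum>\<^sub>\<infinity>k. sobolev_weight s k * (cmod (c k))\<^sup>2)"
    "s \<ge> 3 \<Longrightarrow> (\<lambda>k. cmod (ik_mult (ik_mult c) k)) summable_on UNIV"
proof -
  have 0: "cmod (c k) \<le> sobolev_weight ((s - 1) / 2) k * cmod (c k)" if "s \<ge> 1" for k
    using mult_right_mono[OF sobolev_weight_ge(1)[of "(s-1)/2" k], of "cmod (c k)"] that by simp
  have 1: "cmod (ik_mult c k) \<le> sobolev_weight ((s - 1) / 2) k * cmod (c k)" if "s \<ge> 2" for k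
    unfolding cmod_ik_mult by (rule mult_right_mono[OF sobolev_weight_ge(2)]) (use that in auto)
  have 2: "cmod (ik_mult (ik_mult c) k) \<le> sobolev_weight ((s - 1) / 2) k * cmod (c k)" if "s \<ge> 3" for k
  proof -
    have "cmod (ik_mult (ik_mult c) k) = (2 * pi * of_int k)\<^sup>2 * cmod (c k)"
      by (simp add: norm_mult power2_eq_square)
    also have "\<dots> \<le> sobolev_weight ((s - 1) / 2) k * cmod (c k)"
      by (rule mult_right_mono[OF sobolev_weight_ge(3)]) (use that in auto)
    finally show ?thesis .
  qed
  show "s \<ge> 1 \<Longrightarrow> (\<lambda>k. cmod (c k)) summable_on UNIV"
    "s \<ge> 1 \<Longrightarrow> (\<Sum>\<^sub>\<infinity>k. cmod (c k)) \<le> sobolev_const * sqrt (\<Sum>\<^sub>\<infinity>k. sobolev_weight s k * (cmod (c k))\<^sup>2)"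
    using sobolev_summable_embedding[OF c 0] by auto
  show "s \<ge> 2 \<Longrightarrow> (\<lambda>k. cmod (ik_mult c k)) summable_on UNIV"
    "s \<ge> 2 \<Longrightarrow> (\<Sum>\<^sub>\<infinity>k. cmod (ik_mult c k)) \<le> sobolev_const * sqrt (\<Sum>\<^sub>\<infinity>k. sobolev_weight s k * (cmod (c k))\<^sup>2)"
    using sobolev_summable_embedding[OF c 1] by auto
  show "s \<ge> 3 \<Longrightarrow> (\<lambda>k. cmod (ik_mult (ik_mult c) k)) summable_on UNIV"
    using sobolev_summable_embedding(1)[OF c 2] by auto
qed

lemma L2_circle_absolutely_integrable:
  assumes "L2_circle f" shows "f absolutely_integrable_on {0..1}" "periodic1 f"
proof -
  show "periodic1 f" using assms by (simp add: L2_circle_def)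
  have m: "f \<in> borel_measurable lebesgue" and s: "(\<lambda>x. (f x)\<^sup>2) absolutely_integrable_on {0..1}"
    using assms by (auto simp: L2_circle_def)
  have "(\<lambda>x. 1 + (f x)\<^sup>2) absolutely_integrable_on {0..1}"
    by (intro set_integral_add(1) s) (auto intro: absolutely_integrable_continuous_real)
  then have "(\<lambda>x. 1 + (f x)\<^sup>2) integrable_on {0..1}" by (rule set_lebesgue_integral_eq_integral(1))
  then show "f absolutely_integrable_on {0..1}"
  proof (rule measurable_bounded_by_integrable_imp_absolutely_integrable[rotated 2])
    show "f \<in> borel_measurable (lebesgue_on {0..1})" using m by (rule measurable_restrict_space1)
    fix x
    have "\<bar>f x\<bar> \<le> 1 + (f x)\<^sup>2"
    proof (cases "\<bar>f x\<bar> \<le> 1")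
      case True then show ?thesis using zero_le_power2[of "f x"] by linarith
    next
      case False
      then have "\<bar>f x\<bar> * 1 \<le> \<bar>f x\<bar> * \<bar>f x\<bar>" by (intro mult_left_mono) auto
      then show ?thesis by (simp add: power2_eq_square)
    qed
    then show "norm (f x) \<le> 1 + (f x)\<^sup>2" by simp
  qed auto
qed

lemma sobolev_imp:
  assumes "sobolev s f"
  shows "f absolutely_integrable_on {0..1}" "periodic1 f" "sobolev_summable s (fourier_coeff f)"
  using assms L2_circle_absolutely_integrable by (auto simp: sobolev_def)

text \<open>For s >= 3 the coefficients of f, f' and f'' are summable while those of f''' are only
  known to be square summable, so the last derivative comes from the Riesz--Fischer argument and no
  continuity is claimed for it.\<close>

lemma sobolev_regular:
  assumes f: "sobolev s f" "continuous_on UNIV f" and s: "s \<ge> 3"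
  shows "\<exists>f1 f2 f3. ac_deriv f f1 \<and> ac_deriv f1 f2 \<and> ac_deriv f2 f3"
proof -
  define c where "c = fourier_coeff f"
  note c = sobolev_imp(3)[OF f(1), folded c_def]
  have 0: "(\<lambda>k. cmod (c k)) summable_on UNIV" and 1: "(\<lambda>k. cmod (ik_mult c k)) summable_on UNIV"
    and 2: "(\<lambda>k. cmod (ik_mult (ik_mult c) k)) summable_on UNIV"
    using sobolev_summable_embeddings(1,3,5)[OF c] s by auto
  have "f = fourier_series c"
    unfolding c_def by (rule eq_fourier_series[OF f(2) sobolev_imp(2)[OF f(1)] 0[unfolded c_def]])
  then have "ac_deriv f (fourier_series (ik_mult c))" using fourier_series_ac_deriv[OF 0 1] by simp
  moreover have "ac_deriv (fourier_series (ik_mult c)) (fourier_series (ik_mult (ik_mult c)))"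
    by (rule fourier_series_ac_deriv[OF 1 2])
  moreover have "\<exists>g. ac_deriv (fourier_series (ik_mult (ik_mult c))) g"
  proof (rule fourier_series_ac_deriv_exists[OF 2])
    show "(\<lambda>k. (cmod (ik_mult (ik_mult (ik_mult c)) k))\<^sup>2) summable_on UNIV"
    proof (rule summable_on_comparison_test[OF c])
      fix k
      have "(cmod (ik_mult (ik_mult (ik_mult c)) k))\<^sup>2 = (2 * pi * of_int k)\<^sup>2 ^ 3 * (cmod (c k))\<^sup>2"
        by (simp add: norm_mult power_mult_distrib power3_eq_cube mult_ac)
      also have "\<dots> \<le> sobolev_weight s k * (cmod (c k))\<^sup>2"
        by (rule mult_right_mono[OF sobolev_weight_ge(4)[OF s]]) simp
      finally show "(cmod (ik_mult (ik_mult (ik_mult c)) k))\<^sup>2 \<le> sobolev_weight s k * (cmod (c k))\<^sup>2" .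
    qed simp
  qed
  ultimately show ?thesis by blast
qed

lemma sobolev_summable_diff:
  assumes "sobolev_summable s c" "sobolev_summable s d"
  shows "sobolev_summable s (\<lambda>k. c k - d k)"
proof (rule summable_on_comparison_test)
  show "(\<lambda>k. 2 * (sobolev_weight s k * (cmod (c k))\<^sup>2) + 2 * (sobolev_weight s k * (cmod (d k))\<^sup>2)) summable_on UNIV"
    by (intro summable_on_add summable_on_cmult_right assms)
  fix k
  have "(cmod (c k - d k))\<^sup>2 \<le> (cmod (c k) + cmod (d k))\<^sup>2" by (intro power_mono norm_triangle_ineq4) auto
  also have "\<dots> \<le> 2 * (cmod (c k))\<^sup>2 + 2 * (cmod (d k))\<^sup>2"
    using zero_le_power2[of "cmod (c k) - cmod (d k)"] by (simp add: power2_eq_square algebra_simps)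
  finally show "sobolev_weight s k * (cmod (c k - d k))\<^sup>2 \<le>
      2 * (sobolev_weight s k * (cmod (c k))\<^sup>2) + 2 * (sobolev_weight s k * (cmod (d k))\<^sup>2)"
    using mult_left_mono[of _ _ "sobolev_weight s k"] by (fastforce simp: algebra_simps)
qed simp

lemma sobolev_summable_cmult:
  assumes "sobolev_summable s c" shows "sobolev_summable s (\<lambda>k. a * c k)"
  using summable_on_cmult_right[OF assms, of "(cmod a)\<^sup>2"] by (simp add: norm_mult power_mult_distrib mult_ac)

text \<open>Applied to the error of the difference quotient in time, measured in
  \<open>H^(s-1)\<close> with s - 1 at least 2: convergence in norm becomes uniform convergence for
  u and for u_x.\<close>

lemma ac_deriv_sobolev_bound:
  assumes h: "ac_deriv h h1" "continuous_on UNIV h1" and s: "s \<ge> 2"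
    and sm: "sobolev_summable s (fourier_coeff h)"
  shows "\<bar>h x\<bar> \<le> sobolev_const * sobolev_norm s h" "\<bar>h1 x\<bar> \<le> sobolev_const * sobolev_norm s h"
proof -
  note e = sobolev_summable_embeddings[OF sm]
  have "h = fourier_series (fourier_coeff h)"
    by (rule eq_fourier_series[OF ac_deriv_continuous[OF h(1)] ac_derivD(1)[OF h(1)]]) (use e s in auto)
  then have "\<bar>h x\<bar> \<le> (\<Sum>\<^sub>\<infinity>k. cmod (fourier_coeff h k))"
    using abs_fourier_series_le[OF e(1), of x] s by simp
  also have "\<dots> \<le> sobolev_const * sobolev_norm s h" using e(2) s by (simp add: sobolev_norm_def)
  finally show "\<bar>h x\<bar> \<le> sobolev_const * sobolev_norm s h" .
  have c1: "fourier_coeff h1 = ik_mult (fourier_coeff h)" using fourier_coeff_ac_deriv[OF h(1)] by blast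
  have sm1: "(\<lambda>k. cmod (fourier_coeff h1 k)) summable_on UNIV" unfolding c1 by (rule e(3)[OF s])
  have "h1 = fourier_series (fourier_coeff h1)"
    by (rule eq_fourier_series[OF h(2) ac_derivD(2)[OF h(1)] sm1])
  then have "\<bar>h1 x\<bar> \<le> (\<Sum>\<^sub>\<infinity>k. cmod (fourier_coeff h1 k))"
    using abs_fourier_series_le[OF sm1, of x] by simp
  also have "\<dots> \<le> sobolev_const * sobolev_norm s h"
    unfolding c1 using e(4)[OF s] by (simp add: sobolev_norm_def)
  finally show "\<bar>h1 x\<bar> \<le> sobolev_const * sobolev_norm s h" .
qed

lemma momentum_eq:
  assumes "ac_deriv f f1" "ac_deriv f1 f2"
  shows "AE x in lebesgue. momentum f x = f x - f2 x" "periodic1 (momentum f)"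
proof -
  note w = weak_deriv_ac_deriv[OF assms(1)]
  have "weak_deriv (weak_deriv f) = weak_deriv f1"
    by (rule weak_deriv_cong[OF w(1,2) ac_derivD(2)[OF assms(1)]])
  then have m: "momentum f = (\<lambda>x. f x - weak_deriv f1 x)" by (simp add: momentum_def fun_eq_iff)
  note w1 = weak_deriv_ac_deriv[OF assms(2)]
  show "AE x in lebesgue. momentum f x = f x - f2 x"
    unfolding m using w1(1) by eventually_elim simp
  show "periodic1 (momentum f)"
    unfolding m using ac_derivD(1)[OF assms(1)] w1(2) by (simp add: periodic1_def)
qed

lemma fourier_coeff_cong_AE:
  assumes ae: "AE x in lebesgue. f x = g x" and g: "g absolutely_integrable_on {0..1}"
  shows "f absolutely_integrable_on {0..1}" "fourier_coeff f k = fourier_coeff g k"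
proof -
  obtain N where N: "negligible N" "\<And>x. x \<notin> N \<Longrightarrow> f x = g x" using AE_lebesgueE[OF ae] by blast
  show f: "f absolutely_integrable_on {0..1}"
    by (rule absolutely_integrable_spike[OF g N(1)]) (use N(2) in auto)
  have "integral {0..1} (\<lambda>x. f x * cos_mode k x) = integral {0..1} (\<lambda>x. g x * cos_mode k x)"
    "integral {0..1} (\<lambda>x. f x * sin_mode k x) = integral {0..1} (\<lambda>x. g x * sin_mode k x)"
    by (rule integral_spike[OF N(1)], use N(2) in auto)+
  then show "fourier_coeff f k = fourier_coeff g k" by (simp add: fourier_coeff_eq f g)
qed

text \<open>Lets the time derivative of the momentum be compared with that of u mode by
  mode.\<close>

lemma fourier_coeff_momentum:
  assumes "ac_deriv f f1" "ac_deriv f1 f2"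
  shows "momentum f absolutely_integrable_on {0..1}"
    "fourier_coeff (momentum f) k = (1 + (2 * pi * of_int k)\<^sup>2) * fourier_coeff f k"
proof -
  have f: "f absolutely_integrable_on {0..1}"
    by (intro absolutely_integrable_continuous_real ac_deriv_continuous[OF assms(1)])
  have i: "(\<lambda>x. f x - f2 x) absolutely_integrable_on {0..1}"
    by (intro set_integral_diff(1) f ac_derivD(3)[OF assms(2)])
  note c = fourier_coeff_cong_AE[OF momentum_eq(1)[OF assms] i]
  show "momentum f absolutely_integrable_on {0..1}" by (rule c(1))
  show "fourier_coeff (momentum f) k = (1 + (2 * pi * of_int k)\<^sup>2) * fourier_coeff f k"
    unfolding c(2) fourier_coeff_diff[OF f ac_derivD(3)[OF assms(2)]]
      fourier_coeff_ac_deriv[OF assms(2)] fourier_coeff_ac_deriv[OF assms(1)]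
    by (simp add: algebra_simps power2_eq_square)
qed

subsection \<open>Conservation laws\<close>

text \<open>
  Here \<open>V\<close> plays the role of \<open>u\<^sub>t\<close>, and the last hypothesis is the equation for \<open>V - V\<^sub>x\<^sub>x = y\<^sub>t\<close>.
  The second integrand is the time derivative of \<open>u\<^sup>4 + 2 u\<^sup>2 u\<^sub>x\<^sup>2 - u\<^sub>x\<^sup>4 / 3\<close>.  Modulo exact derivatives
  it is \<open>4 V (u\<^sup>2 - u\<^sub>x\<^sup>2) y\<close>; since \<open>V y = R\<^sub>x\<close> for the \<open>R\<close> below, integrating by parts twice shows
  that this quantity equals \<open>-2\<close> times itself, again modulo exact derivatives.
\<close>

lemma novikov_conservation_identities:
  assumes u: "ac_deriv u u1" "ac_deriv u1 u2" "ac_deriv u2 u3" and V: "ac_deriv V V1"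
    and V1: "ac_deriv V1 (\<lambda>x. V x + ((u x)\<^sup>2 * (u1 x - u3 x) + 3 * u x * u1 x * (u x - u2 x)))"
  shows "integral {0..1} (\<lambda>x. 2 * (u x * V x) + 2 * (u1 x * V1 x)) = 0"
    "integral {0..1} (\<lambda>x. 4 * (u x ^ 3 * V x) + 4 * (u x * (u1 x)\<^sup>2 * V x) + 4 * ((u x)\<^sup>2 * u1 x * V1 x)
        - 4 / 3 * (u1 x ^ 3 * V1 x)) = 0"
proof -
  have eq: "ac_deriv f g'" if "ac_deriv f g" "g = g'" for f g g' using that by simp
  define y where "y x = u x - u2 x" for x
  have y: "ac_deriv y (\<lambda>x. u1 x - u3 x)" unfolding y_def by (rule ac_deriv_diff[OF u(1,3)])
  note rules = ac_deriv_add ac_deriv_diff ac_deriv_cmult ac_deriv_mult u V V1[folded y_def] y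
  \<comment> \<open>Multiplying the equation by u makes its nonlinear part exact: u (u^2 y_x + 3 u
    u_x y) = (u^3 y)_x.\<close>
  have "ac_deriv (\<lambda>x. 2 * (u x * V1 x - u x * (u x * (u x * y x)))) (\<lambda>x. 2 * (u x * V x) + 2 * (u1 x * V1 x))"
    by (rule eq, (rule rules)+) (simp add: fun_eq_iff algebra_simps power2_eq_square power3_eq_cube)
  then show "integral {0..1} (\<lambda>x. 2 * (u x * V x) + 2 * (u1 x * V1 x)) = 0"
    by (rule ac_deriv_integral_eq_0)
  \<comment> \<open>\<open>?Q\<close> moves the derivative off \<open>V1\<close> in the integrand;
    what remains is 4 V (u^2 - u_x^2) y.\<close>
  let ?Q = "\<lambda>x. (4 * (u x * (u x * u1 x)) - 4 / 3 * (u1 x * (u1 x * u1 x))) * V x"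
  let ?R = "\<lambda>x. u x * V1 x - u1 x * V x - u x * (u x * (u x * y x))"
  \<comment> \<open>This is ((V_x - u^2 y)^2 - V^2) / 2, with derivative u_x y R - (u^2 - u_x^2) V
    y. Hence (u^2 - u_x^2) R - 2 S has derivative 3 (u^2 - u_x^2) V y, which explains the factor 4/3
    below.\<close>
  let ?S = "\<lambda>x. (1/2) * (V1 x * V1 x) - (1/2) * (V x * V x) - u x * (u x * (y x * V1 x))
    + (1/2) * ((u x * (u x * y x)) * (u x * (u x * y x)))"
  have "ac_deriv (\<lambda>x. ?Q x + 4 / 3 * ((u x * u x - u1 x * u1 x) * ?R x - 2 * ?S x))
    (\<lambda>x. 4 * (u x ^ 3 * V x) + 4 * (u x * (u1 x)\<^sup>2 * V x) + 4 * ((u x)\<^sup>2 * u1 x * V1 x)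
        - 4 / 3 * (u1 x ^ 3 * V1 x))"
    by (rule eq, (rule rules)+)
      (simp add: fun_eq_iff y_def algebra_simps power2_eq_square power3_eq_cube)
  then show "integral {0..1} (\<lambda>x. 4 * (u x ^ 3 * V x) + 4 * (u x * (u1 x)\<^sup>2 * V x) + 4 * ((u x)\<^sup>2 * u1 x * V1 x)
        - 4 / 3 * (u1 x ^ 3 * V1 x)) = 0"
    by (rule ac_deriv_integral_eq_0)
qed

section \<open>The two energies and differentiation under the integral\<close>

definition circle_C1 :: "(real \<Rightarrow> real) \<Rightarrow> bool" where
  "circle_C1 f \<longleftrightarrow> ac_deriv f (deriv f) \<and> continuous_on UNIV (deriv f)"

lemma circle_C1I:
  assumes "ac_deriv f g" "continuous_on UNIV g"
  shows "circle_C1 f" "deriv f = g"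
proof -
  show "deriv f = g" using ac_deriv_has_real_derivative[OF assms] by (intro ext DERIV_imp_deriv)
  then show "circle_C1 f" using assms by (simp add: circle_C1_def)
qed

lemma circle_C1_continuous:
  assumes "circle_C1 f" shows "continuous_on S f" "continuous_on S (deriv f)"
  using assms ac_deriv_continuous continuous_on_subset unfolding circle_C1_def by blast+

abbreviation quartic_density :: "real \<Rightarrow> real \<Rightarrow> real" where
  "quartic_density a b \<equiv> a ^ 4 + 2 * a\<^sup>2 * b\<^sup>2 - b ^ 4 / 3"

definition energy :: "(real \<Rightarrow> real) \<Rightarrow> real" where
  "energy f = integral {0..1} (\<lambda>x. (f x)\<^sup>2 + (deriv f x)\<^sup>2)"

definition quartic_energy :: "(real \<Rightarrow> real) \<Rightarrow> real" where
  "quartic_energy f = integral {0..1} (\<lambda>x. quartic_density (f x) (deriv f x))"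

text \<open>Convergence uniform in x is what permits differentiation under the integral; the set S
  keeps the notion one-sided at the initial time.\<close>

definition uniform_deriv :: "(real \<Rightarrow> real \<Rightarrow> real) \<Rightarrow> (real \<Rightarrow> real) \<Rightarrow> real \<Rightarrow> real set \<Rightarrow> bool" where
  "uniform_deriv f f' t S \<longleftrightarrow> uniform_limit {0..1} (\<lambda>r x. (f r x - f t x) / (r - t)) f' (at t within S)"

lemma bounded_image_Icc:
  fixes f :: "real \<Rightarrow> real"
  assumes "continuous_on {a..b} f" shows "bounded (f ` {a..b})"
  by (intro compact_imp_bounded compact_continuous_image assms) auto

lemma eventually_at_within_mem: "\<forall>\<^sub>F r in at t within S. r \<in> S \<and> r \<noteq> t"
  by (simp add: eventually_at_filter)

lemma uniform_deriv_imp_uniform_limit: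
  assumes "uniform_deriv f f' t S" and f': "continuous_on {0..1} f'"
  shows "uniform_limit {0..1} f (f t) (at t within S)"
proof -
  have "uniform_limit {0..1} (\<lambda>r x::real. r - t) (\<lambda>x. 0) (at t within S)"
  proof (rule uniform_limitI)
    fix e :: real assume "e > 0"
    then show "\<forall>\<^sub>F r in at t within S. \<forall>x\<in>{0..1::real}. dist (r - t) 0 < e"
      unfolding eventually_at by (intro exI[of _ e]) (auto simp: dist_real_def)
  qed
  moreover have "bounded ((\<lambda>x::real. 0 :: real) ` {0..1})" by (rule bounded_image_Icc) (rule continuous_on_const)
  ultimately have "uniform_limit {0..1} (\<lambda>r x. (r - t) * ((f r x - f t x) / (r - t))) (\<lambda>x. 0 * f' x) (at t within S)"
    by (rule uniform_lim_mult[OF _ assms(1)[unfolded uniform_deriv_def] _ bounded_image_Icc[OF f']])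
  from uniform_limit_add[OF this uniform_limit_const[where c="f t"]]
  have "uniform_limit {0..1} (\<lambda>r x. (r - t) * ((f r x - f t x) / (r - t)) + f t x) (f t) (at t within S)"
    by simp
  then show ?thesis
    by (rule uniform_limit_cong[THEN iffD1, rotated -1])
      (use eventually_at_within_mem[where t=t and S=S] in \<open>auto elim!: eventually_mono\<close>)
qed

lemma uniform_deriv_mult:
  assumes f: "uniform_deriv f f' t S" and g: "uniform_deriv g g' t S"
    and c: "continuous_on {0..1} f'" "continuous_on {0..1} g'" "continuous_on {0..1} (f t)" "continuous_on {0..1} (g t)"
  shows "uniform_deriv (\<lambda>r x. f r x * g r x) (\<lambda>x. f' x * g t x + f t x * g' x) t S"
proof -
  note b = c[THEN bounded_image_Icc]
  have "uniform_limit {0..1} (\<lambda>r x. (f r x - f t x) / (r - t) * g r x) (\<lambda>x. f' x * g t x) (at t within S)"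
    by (rule uniform_lim_mult[OF f[unfolded uniform_deriv_def] uniform_deriv_imp_uniform_limit[OF g c(2)] b(1,4)])
  moreover have "uniform_limit {0..1} (\<lambda>r x. f t x * ((g r x - g t x) / (r - t))) (\<lambda>x. f t x * g' x) (at t within S)"
    by (rule uniform_lim_mult[OF uniform_limit_const g[unfolded uniform_deriv_def] b(3,2)])
  ultimately have "uniform_limit {0..1} (\<lambda>r x. (f r x - f t x) / (r - t) * g r x + f t x * ((g r x - g t x) / (r - t)))
    (\<lambda>x. f' x * g t x + f t x * g' x) (at t within S)"
    by (rule uniform_limit_add)
  moreover have "(\<lambda>r x. (f r x - f t x) / (r - t) * g r x + f t x * ((g r x - g t x) / (r - t))) =
     (\<lambda>r x. (f r x * g r x - f t x * g t x) / (r - t))"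
    by (auto simp: fun_eq_iff add_divide_distrib[symmetric] diff_divide_distrib[symmetric] algebra_simps)
  ultimately show ?thesis by (simp only: uniform_deriv_def)
qed

lemma uniform_deriv_add:
  assumes f: "uniform_deriv f f' t S" and g: "uniform_deriv g g' t S"
  shows "uniform_deriv (\<lambda>r x. f r x + g r x) (\<lambda>x. f' x + g' x) t S"
  using uniform_limit_add[OF f[unfolded uniform_deriv_def] g[unfolded uniform_deriv_def]]
  by (simp add: uniform_deriv_def add_divide_distrib[symmetric] algebra_simps)

lemma uniform_deriv_cmult:
  assumes f: "uniform_deriv f f' t S"
  shows "uniform_deriv (\<lambda>r x. a * f r x) (\<lambda>x. a * f' x) t S"
  using bounded_linear.uniform_limit[OF bounded_linear_mult_right f[unfolded uniform_deriv_def], of a]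
  by (simp add: uniform_deriv_def right_diff_distrib[symmetric])

lemma uniform_deriv_integral:
  assumes f: "uniform_deriv f f' t S" and c: "\<And>r. r \<in> S \<Longrightarrow> continuous_on {0..1} (f r)" and t: "t \<in> S"
  shows "((\<lambda>r. integral {0..1} (f r)) has_real_derivative integral {0..1} f') (at t within S)"
proof (cases "at t within S = bot")
  case True then show ?thesis by (simp add: has_field_derivative_iff)
next
  case False
  \<comment> \<open>Off S nothing is known about \<open>f r\<close>, so the quotient is set to zero
    there; limits within S do not see the change.\<close>
  define q where "q r = (if r \<in> S then (\<lambda>x. (f r x - f t x) / (r - t)) else (\<lambda>x. 0))" for r
  have ev: "\<forall>\<^sub>F r in at t within S. q r = (\<lambda>x. (f r x - f t x) / (r - t))"
    by (rule eventually_mono[OF eventually_at_within_mem]) (auto simp: q_def)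
  have "uniform_limit {0..1} q f' (at t within S)"
    by (rule uniform_limit_cong[THEN iffD2, OF _ _ f[unfolded uniform_deriv_def]])
      (use ev in \<open>auto elim!: eventually_mono\<close>)
  moreover have "continuous_on {0..1} (q r)" for r
    using c t by (auto simp: q_def divide_inverse intro!: continuous_intros)
  ultimately have "((\<lambda>r. integral {0..1} (q r)) \<longlongrightarrow> integral {0..1} f') (at t within S)"
    using False by (rule tendsto_integral_uniform_limit)
  moreover have "\<forall>\<^sub>F r in at t within S. integral {0..1} (q r) = (integral {0..1} (f r) - integral {0..1} (f t)) / (r - t)"
    using ev eventually_at_within_mem[where t=t and S=S]
  proof eventually_elim
    case (elim r)
    have "integral {0..1} (q r) = integral {0..1} (\<lambda>x. f r x - f t x) / (r - t)" by (simp add: elim)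
    also have "\<dots> = (integral {0..1} (f r) - integral {0..1} (f t)) / (r - t)"
      using c t elim by (subst integral_diff) (auto intro!: integrable_continuous_real)
    finally show ?case .
  qed
  ultimately have "((\<lambda>r. (integral {0..1} (f r) - integral {0..1} (f t)) / (r - t)) \<longlongrightarrow> integral {0..1} f') (at t within S)"
    by (rule Lim_transform_eventually)
  then show ?thesis by (simp add: has_field_derivative_iff)
qed

lemma cmod_fourier_coeff_le_sobolev_norm:
  assumes "sobolev_summable s (fourier_coeff f)" "s \<ge> 0"
  shows "cmod (fourier_coeff f k) \<le> sobolev_norm s f"
proof -
  have "(cmod (fourier_coeff f k))\<^sup>2 \<le> sobolev_weight s k * (cmod (fourier_coeff f k))\<^sup>2"
    using mult_right_mono[OF sobolev_weight_ge(1)[OF assms(2), of k], of "(cmod (fourier_coeff f k))\<^sup>2"] by simp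
  also have "\<dots> \<le> (\<Sum>\<^sub>\<infinity>k. sobolev_weight s k * (cmod (fourier_coeff f k))\<^sup>2)"
    using finite_sum_le_infsum[OF assms(1), of "{k}"] by simp
  finally show ?thesis unfolding sobolev_norm_def by (rule real_le_rsqrt)
qed

lemma fourier_coeff_quotient:
  assumes "f absolutely_integrable_on {0..1}" "g absolutely_integrable_on {0..1}" "h absolutely_integrable_on {0..1}"
  shows "fourier_coeff (\<lambda>x. (f x - g x) / a - h x) k = (fourier_coeff f k - fourier_coeff g k) / of_real a - fourier_coeff h k"
proof -
  have d: "(\<lambda>x. f x - g x) absolutely_integrable_on {0..1}" by (intro set_integral_diff(1) assms)
  have e: "(\<lambda>x. inverse a * (f x - g x)) absolutely_integrable_on {0..1}" by (rule set_integrable_mult_right) (rule d)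
  have "fourier_coeff (\<lambda>x. inverse a * (f x - g x) - h x) k =
      of_real (inverse a) * (fourier_coeff f k - fourier_coeff g k) - fourier_coeff h k"
    by (simp only: fourier_coeff_diff[OF e assms(3)] fourier_coeff_cmult[OF d] fourier_coeff_diff[OF assms(1,2)])
  then show ?thesis by (simp add: divide_inverse mult.commute)
qed

lemma has_sobolev_deriv_summable:
  assumes "has_sobolev_deriv s u v t I" "t \<in> I" "r \<in> I"
  shows "sobolev_summable s (fourier_coeff (\<lambda>x. (u r x - u t x) / (r - t) - v x))"
proof -
  have s: "sobolev s (u r)" "sobolev s (u t)" "sobolev s v" using assms by (auto simp: has_sobolev_deriv_def)
  have *: "fourier_coeff (\<lambda>x. (u r x - u t x) / (r - t) - v x) =
     (\<lambda>k. inverse (of_real (r - t)) * (fourier_coeff (u r) k - fourier_coeff (u t) k) - fourier_coeff v k)"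
    by (rule ext, subst fourier_coeff_quotient) (auto intro: s sobolev_imp(1) simp: divide_inverse mult.commute)
  show ?thesis unfolding * by (intro sobolev_summable_diff sobolev_summable_cmult sobolev_imp(3) s)
qed

lemma has_sobolev_deriv_fourier_coeff:
  assumes d: "has_sobolev_deriv s u v t I" and s: "s \<ge> 0" and t: "t \<in> I"
  shows "((\<lambda>r. (fourier_coeff (u r) k - fourier_coeff (u t) k) / of_real (r - t)) \<longlongrightarrow> fourier_coeff v k) (at t within I)"
proof -
  have sob: "sobolev s (u r)" "sobolev s v" if "r \<in> I" for r using d that by (auto simp: has_sobolev_deriv_def)
  have "((\<lambda>r. (fourier_coeff (u r) k - fourier_coeff (u t) k) / of_real (r - t) - fourier_coeff v k) \<longlongrightarrow> 0) (at t within I)"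
  proof (rule Lim_null_comparison)
    show "((\<lambda>r. sobolev_norm s (\<lambda>x. (u r x - u t x) / (r - t) - v x)) \<longlongrightarrow> 0) (at t within I)"
      using d by (simp add: has_sobolev_deriv_def)
    show "\<forall>\<^sub>F r in at t within I. cmod ((fourier_coeff (u r) k - fourier_coeff (u t) k) / of_real (r - t) - fourier_coeff v k)
       \<le> sobolev_norm s (\<lambda>x. (u r x - u t x) / (r - t) - v x)"
      using eventually_at_within_mem[where t=t and S=I]
    proof eventually_elim
      case (elim r)
      then show ?case
        using cmod_fourier_coeff_le_sobolev_norm[OF has_sobolev_deriv_summable[OF d t] s, of r k]
          fourier_coeff_quotient[OF sobolev_imp(1)[OF sob(1)] sobolev_imp(1)[OF sob(1)] sobolev_imp(1)[OF sob(2)], of r t t] t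
        by simp
    qed
  qed
  then show ?thesis by (simp add: LIM_zero_iff)
qed

section \<open>Conservation along a strong solution\<close>

context
  fixes s T :: real and u\<^sub>0 :: "real \<Rightarrow> real" and u :: "real \<Rightarrow> real \<Rightarrow> real"
  assumes s: "s \<ge> 3" and sol: "strong_solution s T u\<^sub>0 u"
begin

lemma strong_solution_regular:
  assumes "t \<in> {0..<T}"
  shows "\<exists>u2 u3. circle_C1 (u t) \<and> ac_deriv (deriv (u t)) u2 \<and> ac_deriv u2 u3"
proof -
  have "sobolev s (u t)" "continuous_on UNIV (u t)"
    using sol assms by (auto simp: strong_solution_def sobolev_continuous_on_def)
  then obtain f1 f2 f3 where f: "ac_deriv (u t) f1" "ac_deriv f1 f2" "ac_deriv f2 f3"
    using sobolev_regular s by blast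
  then show ?thesis using circle_C1I[OF f(1) ac_deriv_continuous[OF f(2)]] by auto
qed

lemma strong_solution_C1: "t \<in> {0..<T} \<Longrightarrow> circle_C1 (u t)"
  using strong_solution_regular by blast

text \<open>The coefficients of V are recorded as limits as well: the equation involves the
  derivative of the momentum, and V is matched with it mode by mode.\<close>

lemma strong_solution_time_deriv:
  assumes t: "t \<in> {0..<T}"
  obtains V where "circle_C1 V" "uniform_deriv u V t {0..<T}"
    "uniform_deriv (\<lambda>r. deriv (u r)) (deriv V) t {0..<T}"
    "\<And>k. t > 0 \<Longrightarrow> ((\<lambda>r. (fourier_coeff (u r) k - fourier_coeff (u t) k) / of_real (r - t)) \<longlongrightarrow> fourier_coeff V k) (at t within {0..<T})"
proof -
  obtain v where v: "has_sobolev_deriv (s - 1) u v t {0..<T}"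
    using sol t unfolding strong_solution_def sobolev_C1_on_def by blast
  have sob: "sobolev (s - 1) (u r)" if "r \<in> {0..<T}" for r using v that by (auto simp: has_sobolev_deriv_def)
  have sobv: "sobolev (s - 1) v" using v by (simp add: has_sobolev_deriv_def)
  define c where "c = fourier_coeff v"
  have sm: "(\<lambda>k. cmod (c k)) summable_on UNIV" and sm1: "(\<lambda>k. cmod (ik_mult c k)) summable_on UNIV"
    using sobolev_summable_embeddings(1,3)[OF sobolev_imp(3)[OF sobv]] s by (auto simp: c_def)
  \<comment> \<open>The derivative v is known only up to null sets; its Fourier series is the
    representative of class C^1, because s - 1 is at least 2.\<close>
  define V where "V = fourier_series c"
  have aV: "ac_deriv V (fourier_series (ik_mult c))" unfolding V_def by (rule fourier_series_ac_deriv[OF sm sm1])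
  have V: "circle_C1 V" and dV: "deriv V = fourier_series (ik_mult c)"
    using circle_C1I[OF aV fourier_series_continuous[OF sm1]] by auto
  have cV: "fourier_coeff V k = fourier_coeff v k" for k
    unfolding V_def
    by (subst fourier_coeff_fourier_series[OF sm]) (auto simp: c_def fourier_coeff_uminus sobolev_imp(1)[OF sobv])
  define N where "N r = sobolev_norm (s - 1) (\<lambda>x. (u r x - u t x) / (r - t) - v x)" for r
  have N: "(N \<longlongrightarrow> 0) (at t within {0..<T})" using v by (simp add: has_sobolev_deriv_def N_def[abs_def])
  have bound: "\<bar>(u r x - u t x) / (r - t) - V x\<bar> \<le> sobolev_const * N r"
    "\<bar>(deriv (u r) x - deriv (u t) x) / (r - t) - deriv V x\<bar> \<le> sobolev_const * N r"
    if r: "r \<in> {0..<T}" for r x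
  proof -
    let ?h = "\<lambda>x. (u r x - u t x) / (r - t) - V x"
    let ?h1 = "\<lambda>x. (deriv (u r) x - deriv (u t) x) / (r - t) - deriv V x"
    note C = strong_solution_C1[OF r] strong_solution_C1[OF t] V
    have "ac_deriv (\<lambda>x. inverse (r - t) * (u r x - u t x) - V x) (\<lambda>x. inverse (r - t) * (deriv (u r) x - deriv (u t) x) - deriv V x)"
      by (intro ac_deriv_diff ac_deriv_cmult) (use C in \<open>auto simp: circle_C1_def\<close>)
    then have a: "ac_deriv ?h ?h1" by (simp add: divide_inverse mult.commute)
    have ch1: "continuous_on UNIV ?h1" unfolding divide_inverse
      by (intro continuous_intros circle_C1_continuous C)
    have Vai: "V absolutely_integrable_on {0..1}"
      by (intro absolutely_integrable_continuous_real circle_C1_continuous V)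
    have ch: "fourier_coeff ?h k = fourier_coeff (\<lambda>x. (u r x - u t x) / (r - t) - v x) k" for k
      unfolding fourier_coeff_quotient[OF sobolev_imp(1)[OF sob[OF r]] sobolev_imp(1)[OF sob[OF t]] Vai]
        fourier_coeff_quotient[OF sobolev_imp(1)[OF sob[OF r]] sobolev_imp(1)[OF sob[OF t]] sobolev_imp(1)[OF sobv]] cV ..
    have n: "sobolev_norm (s - 1) ?h = N r" unfolding N_def sobolev_norm_def ch ..
    have "fourier_coeff ?h = fourier_coeff (\<lambda>x. (u r x - u t x) / (r - t) - v x)" using ch by blast
    then have sm: "sobolev_summable (s - 1) (fourier_coeff ?h)"
      using has_sobolev_deriv_summable[OF v t r] by (simp only:)
    show "\<bar>(u r x - u t x) / (r - t) - V x\<bar> \<le> sobolev_const * N r"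
      "\<bar>(deriv (u r) x - deriv (u t) x) / (r - t) - deriv V x\<bar> \<le> sobolev_const * N r"
      using ac_deriv_sobolev_bound[OF a ch1 _ sm, of x] s unfolding n by auto
  qed
  have small: "\<forall>\<^sub>F r in at t within {0..<T}. sobolev_const * N r < e" if "e > 0" for e
    using order_tendstoD(2)[OF tendsto_mult_right_zero[OF N, of sobolev_const] that] .
  have "uniform_deriv u V t {0..<T}" unfolding uniform_deriv_def
  proof (rule uniform_limitI)
    fix e :: real assume "e > 0"
    from small[OF this] eventually_at_within_mem
    show "\<forall>\<^sub>F r in at t within {0..<T}. \<forall>x\<in>{0..1}. dist ((u r x - u t x) / (r - t)) (V x) < e"
      by eventually_elim (auto simp: dist_real_def intro: le_less_trans[OF bound(1)])
  qed
  moreover have "uniform_deriv (\<lambda>r. deriv (u r)) (deriv V) t {0..<T}" unfolding uniform_deriv_def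
  proof (rule uniform_limitI)
    fix e :: real assume "e > 0"
    from small[OF this] eventually_at_within_mem
    show "\<forall>\<^sub>F r in at t within {0..<T}. \<forall>x\<in>{0..1}. dist ((deriv (u r) x - deriv (u t) x) / (r - t)) (deriv V x) < e"
      by eventually_elim (auto simp: dist_real_def intro: le_less_trans[OF bound(2)])
  qed
  moreover have "((\<lambda>r. (fourier_coeff (u r) k - fourier_coeff (u t) k) / of_real (r - t)) \<longlongrightarrow> fourier_coeff V k) (at t within {0..<T})" for k
    unfolding cV by (rule has_sobolev_deriv_fourier_coeff[OF v _ t]) (use s in auto)
  ultimately show ?thesis using that V by blast
qed

text \<open>The equation is posed for t > 0, so at t = 0 differentiability alone is claimed; it
  supplies the continuity through which the values at time 0 are reached.\<close>

lemma strong_solution_energy_deriv: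
  assumes t: "t \<in> {0..<T}"
  obtains D1 D2 where
    "((\<lambda>r. energy (u r)) has_real_derivative D1) (at t within {0..<T})"
    "((\<lambda>r. quartic_energy (u r)) has_real_derivative D2) (at t within {0..<T})"
    "t > 0 \<Longrightarrow> D1 = 0" "t > 0 \<Longrightarrow> D2 = 0"
proof -
  obtain V where V: "circle_C1 V" "uniform_deriv u V t {0..<T}"
    "uniform_deriv (\<lambda>r. deriv (u r)) (deriv V) t {0..<T}"
    and coeffV: "\<And>k. t > 0 \<Longrightarrow> ((\<lambda>r. (fourier_coeff (u r) k - fourier_coeff (u t) k) / of_real (r - t)) \<longlongrightarrow> fourier_coeff V k) (at t within {0..<T})"
    by (rule strong_solution_time_deriv[OF t]) blast
  define w where "w = u t"
  obtain u2 u3 where w: "circle_C1 w" "ac_deriv (deriv w) u2" "ac_deriv u2 u3"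
    using strong_solution_regular[OF t] by (auto simp: w_def)
  have aw: "ac_deriv w (deriv w)" using w(1) by (simp add: circle_C1_def)
  have aV: "ac_deriv V (deriv V)" using V(1) by (simp add: circle_C1_def)
  note cont = circle_C1_continuous[OF w(1)] circle_C1_continuous[OF V(1)]
  have contr: "continuous_on A (u r)" "continuous_on A (deriv (u r))" if "r \<in> {0..<T}" for A r
    using circle_C1_continuous[OF strong_solution_C1[OF that]] by auto
  have eq: "uniform_deriv f g' t {0..<T}" if "uniform_deriv f g t {0..<T}" "g = g'" for f g g' using that by simp
  let ?D1 = "\<lambda>x. 2 * (w x * V x) + 2 * (deriv w x * deriv V x)"
  let ?D2 = "\<lambda>x. 4 * (w x ^ 3 * V x) + 4 * (w x * (deriv w x)\<^sup>2 * V x) + 4 * ((w x)\<^sup>2 * deriv w x * deriv V x)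
        - 4 / 3 * (deriv w x ^ 3 * deriv V x)"
  have q: "uniform_deriv (\<lambda>r x. u r x * u r x) (\<lambda>x. 2 * (w x * V x)) t {0..<T}"
    by (rule eq[OF uniform_deriv_mult[OF V(2) V(2)]]) (auto intro: cont simp: w_def[symmetric])
  have q1: "uniform_deriv (\<lambda>r x. deriv (u r) x * deriv (u r) x) (\<lambda>x. 2 * (deriv w x * deriv V x)) t {0..<T}"
    by (rule eq[OF uniform_deriv_mult[OF V(3) V(3)]]) (auto intro: cont simp: w_def[symmetric])
  have D1: "((\<lambda>r. energy (u r)) has_real_derivative integral {0..1} ?D1) (at t within {0..<T})"
    unfolding energy_def power2_eq_square
    by (rule uniform_deriv_integral[OF uniform_deriv_add[OF q q1] _ t])
      (intro continuous_intros contr)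
  have qc: "continuous_on {0..1} (\<lambda>x. 2 * (w x * V x))" "continuous_on {0..1} (\<lambda>x. 2 * (deriv w x * deriv V x))"
    "continuous_on {0..1} (\<lambda>x. u t x * u t x)" "continuous_on {0..1} (\<lambda>x. deriv (u t) x * deriv (u t) x)"
    unfolding w_def[symmetric] by (intro continuous_intros cont)+
  note q4 = uniform_deriv_mult[OF q q qc(1,1,3,3)] and q22 = uniform_deriv_mult[OF q q1 qc]
    and q14 = uniform_deriv_mult[OF q1 q1 qc(2,2,4,4)]
  have "uniform_deriv (\<lambda>r x. quartic_density (u r x) (deriv (u r) x)) ?D2 t {0..<T}"
    using uniform_deriv_add[OF uniform_deriv_add[OF q4 uniform_deriv_cmult[OF q22, of 2]] uniform_deriv_cmult[OF q14, of "-1/3"]]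
    by (simp add: w_def algebra_simps power2_eq_square power3_eq_cube power4_eq_xxxx)
  then have D2: "((\<lambda>r. quartic_energy (u r)) has_real_derivative integral {0..1} ?D2) (at t within {0..<T})"
    unfolding quartic_energy_def
    by (rule uniform_deriv_integral[OF _ _ t]) (auto intro!: continuous_intros contr)
  have zero: "integral {0..1} ?D1 = 0 \<and> integral {0..1} ?D2 = 0" if t0: "t > 0"
  proof -
    have "novikov_at s T u t" using sol t t0 by (auto simp: strong_solution_def)
    then obtain z where z: "has_sobolev_deriv (s - 3) (\<lambda>r. momentum (u r)) z t {0..<T}"
      and pde: "AE x in lebesgue. z x + (u t x)\<^sup>2 * weak_deriv (momentum (u t)) x
             + 3 * u t x * weak_deriv (u t) x * momentum (u t) x = 0"
      unfolding novikov_at_def by blast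
    have sobz: "sobolev (s - 3) z" using z by (simp add: has_sobolev_deriv_def)
    have "at t within {0..<T} = at t"
      by (rule at_within_open_subset[of t "{0<..<T}"]) (use t t0 in auto)
    then have nb: "at t within {0..<T} \<noteq> bot" by simp
    \<comment> \<open>Both sides are limits of the same difference quotients, since the symbol of 1
      - d_xx does not depend on time. This identifies z with V - V_xx.\<close>
    have coeffz: "fourier_coeff z k = (1 + (2 * pi * of_int k)\<^sup>2) * fourier_coeff V k" for k
    proof (rule tendsto_unique[OF nb])
      show "((\<lambda>r. (fourier_coeff (momentum (u r)) k - fourier_coeff (momentum (u t)) k) / of_real (r - t)) \<longlongrightarrow> fourier_coeff z k) (at t within {0..<T})"
        by (rule has_sobolev_deriv_fourier_coeff[OF z _ t]) (use s in auto)
      have mom: "fourier_coeff (momentum (u r)) k = (1 + (2 * pi * of_int k)\<^sup>2) * fourier_coeff (u r) k"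
        if r: "r \<in> {0..<T}" for r
        using strong_solution_regular[OF r] fourier_coeff_momentum(2) unfolding circle_C1_def by blast
      show "((\<lambda>r. (fourier_coeff (momentum (u r)) k - fourier_coeff (momentum (u t)) k) / of_real (r - t)) \<longlongrightarrow>
          (1 + (2 * pi * of_int k)\<^sup>2) * fourier_coeff V k) (at t within {0..<T})"
      proof (rule Lim_transform_eventually)
        show "((\<lambda>r. (1 + (2 * pi * of_int k)\<^sup>2) * ((fourier_coeff (u r) k - fourier_coeff (u t) k) / of_real (r - t))) \<longlongrightarrow>
          (1 + (2 * pi * of_int k)\<^sup>2) * fourier_coeff V k) (at t within {0..<T})"
          by (intro tendsto_mult_left coeffV t0)
        show "\<forall>\<^sub>F r in at t within {0..<T}. (1 + (2 * pi * of_int k)\<^sup>2) * ((fourier_coeff (u r) k - fourier_coeff (u t) k) / of_real (r - t)) =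
          (fourier_coeff (momentum (u r)) k - fourier_coeff (momentum (u t)) k) / of_real (r - t)"
          using eventually_at_within_mem[where t=t and S="{0..<T}"]
        proof eventually_elim
          case (elim r)
          then show ?case using mom[of r] mom[OF t] by (simp add: right_diff_distrib)
        qed
      qed
    qed
    have Vai: "V absolutely_integrable_on {0..1}"
      by (intro absolutely_integrable_continuous_real cont)
    have V2: "ac_deriv (deriv V) (\<lambda>x. V x - z x)"
    proof (rule ac_deriv_if_fourier_coeff_continuous)
      show "periodic1 (deriv V)" "continuous_on UNIV (deriv V)" by (rule ac_derivD(2)[OF aV]) (rule cont)
      show "periodic1 (\<lambda>x. V x - z x)" using ac_derivD(1)[OF aV] sobolev_imp(2)[OF sobz] by (simp add: periodic1_def)
      show "(\<lambda>x. V x - z x) absolutely_integrable_on {0..1}"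
        by (intro set_integral_diff(1) Vai sobolev_imp(1)[OF sobz])
      show "fourier_coeff (\<lambda>x. V x - z x) k = 2 * pi * of_int k * \<i> * fourier_coeff (deriv V) k" for k
        unfolding fourier_coeff_diff[OF Vai sobolev_imp(1)[OF sobz]] coeffz fourier_coeff_ac_deriv[OF aV]
        by (simp add: algebra_simps power2_eq_square)
    qed
    define \<rho> where "\<rho> x = (w x)\<^sup>2 * (deriv w x - u3 x) + 3 * w x * deriv w x * (w x - u2 x)" for x
    have y: "ac_deriv (\<lambda>x. w x - u2 x) (\<lambda>x. deriv w x - u3 x)" by (rule ac_deriv_diff[OF aw w(3)])
    note m = momentum_eq[OF aw w(2)]
    have "weak_deriv (momentum w) = weak_deriv (\<lambda>x. w x - u2 x)"
      by (rule weak_deriv_cong[OF m ac_derivD(1)[OF y]])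
    then have "AE x in lebesgue. weak_deriv (momentum w) x = deriv w x - u3 x"
      using weak_deriv_ac_deriv(1)[OF y] by simp
    then have "AE x in lebesgue. V x - z x = V x + \<rho> x"
      using pde[folded w_def] m(1) weak_deriv_ac_deriv(1)[OF aw]
      by eventually_elim (simp add: \<rho>_def)
    then have V2': "ac_deriv (deriv V) (\<lambda>x. V x + \<rho> x)"
    proof (rule ac_deriv_spike[OF V2])
      show "periodic1 (\<lambda>x. V x + \<rho> x)"
        using ac_derivD(1,2)[OF aV] ac_derivD(1,2)[OF aw] ac_derivD(1,2)[OF w(3)]
        by (simp add: periodic1_def \<rho>_def)
    qed
    show ?thesis
      using novikov_conservation_identities[OF aw w(2,3) aV V2'[unfolded \<rho>_def]] by blast
  qed
  show ?thesis by (rule that[OF D1 D2]) (use zero in auto)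
qed

lemma strong_solution_conserved:
  assumes t: "t \<in> {0..<T}"
  shows "energy (u t) = energy (u 0)" "quartic_energy (u t) = quartic_energy (u 0)"
proof -
  have const: "f t = f 0"
    if d: "\<And>r. r \<in> {0..<T} \<Longrightarrow> \<exists>D. (f has_real_derivative D) (at r within {0..<T}) \<and> (r > 0 \<longrightarrow> D = 0)" for f :: "real \<Rightarrow> real"
  proof (cases "t = 0")
    case False
    have "continuous_on {0..<T} f"
      using d DERIV_continuous continuous_on_eq_continuous_within by blast
    then have "continuous_on {0..t} f" by (rule continuous_on_subset) (use t in auto)
    moreover have "(f has_real_derivative 0) (at r)" if r: "0 < r" "r < t" for r
    proof -
      have "at r within {0..<T} = at r"
        by (rule at_within_open_subset[of r "{0<..<T}"]) (use t r in auto)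
      then show ?thesis using d[of r] r t by force
    qed
    ultimately show ?thesis using DERIV_isconst2[of 0 t f t] False t by auto
  qed simp
  show "energy (u t) = energy (u 0)" by (rule const) (metis strong_solution_energy_deriv)
  show "quartic_energy (u t) = quartic_energy (u 0)" by (rule const) (metis strong_solution_energy_deriv)
qed

text \<open>The source of the continuity in time of the minimum of u.\<close>

lemma strong_solution_uniform_limit:
  assumes t: "t \<in> {0..<T}" shows "uniform_limit {0..1} u (u t) (at t within {0..<T})"
proof -
  obtain V where "circle_C1 V" "uniform_deriv u V t {0..<T}"
    using strong_solution_time_deriv[OF t] by blast
  then show ?thesis using uniform_deriv_imp_uniform_limit circle_C1_continuous by blast
qed

end

subsection \<open>The calibration inequality\<close>

text \<open>
  \<open>m\<^sup>2 * profile_e a\<close> and \<open>m\<^sup>4 * profile_n a\<close> are the energy and the quartic energy of a profile consisting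
  of an arc \<open>m cosh x\<close>, \<open>\<bar>x\<bar> \<le> a\<close>, and a constant piece \<open>m\<close> of (signed) length \<open>1 - 2a\<close>.
  The peakon is the case \<open>a = 1/2\<close>.
\<close>

definition profile_e :: "real \<Rightarrow> real" where
  "profile_e a = 1 + sinh (2 * a) - 2 * a"

definition profile_n :: "real \<Rightarrow> real" where
  "profile_n a = profile_e a + 4 / 3 * sinh a ^ 3 * cosh a"

text \<open>The slope of \<open>profile_n\<close> as a function of \<open>profile_e\<close>; times
  m^2 it is the upper bound for h when M = m cosh a.\<close>

definition profile_k :: "real \<Rightarrow> real" where
  "profile_k a = 4 / 3 * (cosh a)\<^sup>2 + 2 / 3"

lemma profile_e_deriv: "(profile_e has_real_derivative 4 * (sinh a)\<^sup>2) (at a)"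
proof -
  have "(profile_e has_real_derivative cosh (2 * a) * 2 - 2) (at a)"
    unfolding profile_e_def[abs_def] by (auto intro!: derivative_eq_intros)
  moreover have "cosh (2 * a) * 2 - 2 = 4 * (sinh a)\<^sup>2"
    unfolding cosh_double cosh_square_eq by simp
  ultimately show ?thesis by simp
qed

lemma profile_n_deriv: "(profile_n has_real_derivative profile_k a * (4 * (sinh a)\<^sup>2)) (at a)"
proof -
  have "(profile_n has_real_derivative 4 * (sinh a)\<^sup>2 + (4 * (sinh a)\<^sup>2 * cosh a * cosh a + 4 / 3 * sinh a ^ 3 * sinh a)) (at a)"
    unfolding profile_n_def[abs_def]
    by (rule DERIV_add[OF profile_e_deriv]) (auto intro!: derivative_eq_intros simp: power2_eq_square)
  moreover have "4 * (sinh a)\<^sup>2 + (4 * (sinh a)\<^sup>2 * cosh a * cosh a + 4 / 3 * sinh a ^ 3 * sinh a)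
      = profile_k a * (4 * (sinh a)\<^sup>2)"
  proof -
    have "4 * (sinh a)\<^sup>2 + (4 * (sinh a)\<^sup>2 * cosh a * cosh a + 4 / 3 * sinh a ^ 3 * sinh a)
      = 4 * (sinh a)\<^sup>2 + 4 * (sinh a)\<^sup>2 * (cosh a)\<^sup>2 + 4 / 3 * (sinh a)\<^sup>2 * (sinh a)\<^sup>2"
      by (simp add: power2_eq_square power3_eq_cube)
    also have "\<dots> = profile_k a * (4 * (sinh a)\<^sup>2)"
      unfolding profile_k_def cosh_square_eq by (simp add: field_simps)
    finally show ?thesis .
  qed
  ultimately show ?thesis by simp
qed

lemma has_real_derivative_integral_0:
  assumes q: "continuous_on UNIV q" and v: "v > 0"
  shows "((\<lambda>v. integral {0..v} q) has_real_derivative q v) (at v)"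
proof -
  have "((\<lambda>v. integral {0..v} q) has_real_derivative q v) (at v within {0..v+1})"
    by (rule integral_has_real_derivative) (use v in \<open>auto intro: continuous_on_subset[OF q]\<close>)
  then show ?thesis using at_within_Icc_at[of 0 v "v+1"] v by simp
qed

locale calibration =
  fixes m :: real
  assumes m: "m > 0"
begin

text \<open>The cutoff makes q continuous on the whole line and zero on [0, m], so that primitives
  can be taken from 0 with m an interior point.\<close>

definition q :: "real \<Rightarrow> real" where "q v = sqrt (max 0 (v\<^sup>2 - m\<^sup>2))"

text \<open>Chosen so that \<sigma> f(u) u_x is the part of h (u_x + \<sigma> q(u))^2 that is odd in
  u_x.\<close>

definition f :: "real \<Rightarrow> real" where "f v = q v * (8 / 3 * v\<^sup>2 + 4 / 3 * m\<^sup>2)"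

lemma q_continuous: "continuous_on S q" unfolding q_def[abs_def] by (intro continuous_intros)

lemma f_continuous: "continuous_on S f" unfolding f_def[abs_def] by (intro continuous_intros q_continuous)

lemma q_sq: "m \<le> v \<Longrightarrow> (q v)\<^sup>2 = v\<^sup>2 - m\<^sup>2"
  using m power_mono[of m v 2] by (simp add: q_def)

lemma q_cosh: "a \<ge> 0 \<Longrightarrow> q (m * cosh a) = m * sinh a"
proof -
  assume a: "a \<ge> 0"
  have "(m * cosh a)\<^sup>2 - m\<^sup>2 = (m * sinh a)\<^sup>2" by (simp add: power_mult_distrib cosh_square_eq algebra_simps)
  then show ?thesis using a m by (simp add: q_def max_def)
qed

text \<open>The substitution v = m cosh x, proved by comparing derivatives; g vanishes below m, so
  both sides start from zero.\<close>

lemma antiderivative_cosh: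
  assumes g: "continuous_on UNIV g" and g0: "\<And>v. 0 \<le> v \<Longrightarrow> v \<le> m \<Longrightarrow> g v = 0"
    and h: "\<And>x. x \<ge> 0 \<Longrightarrow> (h has_real_derivative g (m * cosh x) * (m * sinh x)) (at x)"
    and h0: "h 0 = 0" and a: "a \<ge> 0"
  shows "integral {0..m * cosh a} g = h a"
proof -
  have pos: "m * cosh x > 0" for x using m by simp
  have "((\<lambda>x. integral {0..m * cosh x} g - h x) has_real_derivative 0) (at x)" if "x \<ge> 0" for x
  proof -
    have "((\<lambda>x. m * cosh x) has_real_derivative m * sinh x) (at x)" by (auto intro!: derivative_eq_intros)
    from DERIV_diff[OF DERIV_chain2[OF has_real_derivative_integral_0[OF g pos] this] h[OF that]]
    show ?thesis by simp
  qed
  note d = this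
  have "integral {0..m * cosh a} g - h a = integral {0..m * cosh 0} g - h 0"
  proof (cases "a = 0")
    case False
    show ?thesis
      by (rule DERIV_isconst2[of 0 a])
        (use False a d in \<open>auto intro!: DERIV_atLeastAtMost_imp_continuous_on\<close>)
  qed simp
  moreover have "integral {0..m} g = integral {0..m} (\<lambda>v. 0)" by (rule integral_cong) (use g0 in auto)
  ultimately show ?thesis using h0 by simp
qed

lemma q_f_0: "0 \<le> v \<Longrightarrow> v \<le> m \<Longrightarrow> q v = 0" "0 \<le> v \<Longrightarrow> v \<le> m \<Longrightarrow> f v = 0"
  using power_mono[of v m 2] by (auto simp: q_def f_def)

lemma integral_q: "a \<ge> 0 \<Longrightarrow> integral {0..m * cosh a} q = m\<^sup>2 * (profile_e a - 1) / 4"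
proof (rule antiderivative_cosh[OF q_continuous q_f_0(1)])
  fix x :: real assume x: "x \<ge> 0"
  show "((\<lambda>a. m\<^sup>2 * (profile_e a - 1) / 4) has_real_derivative q (m * cosh x) * (m * sinh x)) (at x)"
    unfolding q_cosh[OF x] by (auto intro!: derivative_eq_intros profile_e_deriv simp: power2_eq_square)
qed (auto simp: profile_e_def)

lemma integral_f: "a \<ge> 0 \<Longrightarrow> integral {0..m * cosh a} f = m ^ 4 * (profile_n a - 1) / 2"
proof (rule antiderivative_cosh[OF f_continuous q_f_0(2)])
  fix x :: real assume x: "x \<ge> 0"
  show "((\<lambda>a. m ^ 4 * (profile_n a - 1) / 2) has_real_derivative f (m * cosh x) * (m * sinh x)) (at x)"
    unfolding f_def q_cosh[OF x]
    by (auto intro!: derivative_eq_intros profile_n_deriv simp: power2_eq_square power4_eq_xxxx profile_k_def algebra_simps)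
qed (auto simp: profile_e_def profile_n_def)

text \<open>With \<open>r = \<sigma> * q v\<close> the first expression is (p + r)^2. For h use 2/3
  p r - p^2 / 3 = r^2 / 3 - (p - r)^2 / 3 and r^2 = v^2 - m^2: it equals 4/3 v^2 + 2/3 m^2 minus a
  square.\<close>

lemma calibration_pointwise:
  assumes \<sigma>: "\<sigma>\<^sup>2 = 1" and v: "m \<le> v" "v \<le> M"
  shows "0 \<le> v\<^sup>2 + p\<^sup>2 - m\<^sup>2 + 2 * \<sigma> * (q v * p)"
    "quartic_density v p - m ^ 4 + \<sigma> * (f v * p) \<le> (4 / 3 * M\<^sup>2 + 2 / 3 * m\<^sup>2) * (v\<^sup>2 + p\<^sup>2 - m\<^sup>2 + 2 * \<sigma> * (q v * p))"
proof -
  let ?e = "v\<^sup>2 + p\<^sup>2 - m\<^sup>2 + 2 * \<sigma> * (q v * p)"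
  define r where "r = \<sigma> * q v"
  have r: "r\<^sup>2 = v\<^sup>2 - m\<^sup>2" using q_sq[OF v(1)] \<sigma> by (simp add: r_def power_mult_distrib)
  have v2: "v\<^sup>2 = r\<^sup>2 + m\<^sup>2" using r by simp
  have e: "(v\<^sup>2 + p\<^sup>2 - m\<^sup>2 + 2 * \<sigma> * (q v * p)) = (p + r)\<^sup>2"
    using r by (simp add: r_def[symmetric] power2_sum algebra_simps) (simp add: r_def algebra_simps)
  then show "0 \<le> (v\<^sup>2 + p\<^sup>2 - m\<^sup>2 + 2 * \<sigma> * (q v * p))" by simp
  define h where "h = v\<^sup>2 + m\<^sup>2 + 2 / 3 * (p * r) - p\<^sup>2 / 3"
  have "h = 4 / 3 * v\<^sup>2 + 2 / 3 * m\<^sup>2 - (p - r)\<^sup>2 / 3"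
    unfolding h_def power2_diff r by (simp add: field_simps)
  also have "\<dots> \<le> 4 / 3 * M\<^sup>2 + 2 / 3 * m\<^sup>2" 
  proof (rule order_trans[of _ "4 / 3 * v\<^sup>2 + 2 / 3 * m\<^sup>2"])
    show "4 / 3 * v\<^sup>2 + 2 / 3 * m\<^sup>2 \<le> 4 / 3 * M\<^sup>2 + 2 / 3 * m\<^sup>2"
      using power_mono[OF v(2), of 2] v m by simp
  qed simp
  finally have h: "h \<le> 4 / 3 * M\<^sup>2 + 2 / 3 * m\<^sup>2" .
  have "\<sigma> * (f v * p) = r * (8 / 3 * v\<^sup>2 + 4 / 3 * m\<^sup>2) * p" by (simp add: f_def r_def)
  moreover have "v ^ 4 = v\<^sup>2 * v\<^sup>2" by (simp add: power4_eq_xxxx power2_eq_square)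
  ultimately have "quartic_density v p - m ^ 4 + \<sigma> * (f v * p) = h * (p + r)\<^sup>2"
    unfolding h_def v2 by (simp add: v2 power2_eq_square power4_eq_xxxx field_simps)
  also have "\<dots> \<le> (4 / 3 * M\<^sup>2 + 2 / 3 * m\<^sup>2) * (p + r)\<^sup>2" by (rule mult_right_mono[OF h]) simp
  finally show "quartic_density v p - m ^ 4 + \<sigma> * (f v * p) \<le> (4 / 3 * M\<^sup>2 + 2 / 3 * m\<^sup>2) * (v\<^sup>2 + p\<^sup>2 - m\<^sup>2 + 2 * \<sigma> * (q v * p))"
    unfolding e .
qed

text \<open>The terms linear in U_x have the form g(U) U_x and integrate to differences of a
  primitive of g, so only the end values of U enter there, however U oscillates in between.\<close>

lemma calibration_interval:
  assumes U: "circle_C1 U" and ab: "\<alpha> \<le> \<beta>" and \<sigma>: "\<sigma>\<^sup>2 = 1" and v: "\<And>x. m \<le> U x" "\<And>x. U x \<le> M"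
  defines "E \<equiv> integral {\<alpha>..\<beta>} (\<lambda>x. (U x)\<^sup>2 + (deriv U x)\<^sup>2) - m\<^sup>2 * (\<beta> - \<alpha>)
      + 2 * \<sigma> * (integral {0..U \<beta>} q - integral {0..U \<alpha>} q)"
  shows "0 \<le> E"
    "integral {\<alpha>..\<beta>} (\<lambda>x. quartic_density (U x) (deriv U x)) - m ^ 4 * (\<beta> - \<alpha>)
      + \<sigma> * (integral {0..U \<beta>} f - integral {0..U \<alpha>} f) \<le> (4 / 3 * M\<^sup>2 + 2 / 3 * m\<^sup>2) * E"
proof -
  note c = circle_C1_continuous[OF U]
  have dU: "(U has_real_derivative deriv U x) (at x)" for x
    using U ac_deriv_has_real_derivative unfolding circle_C1_def by blast
  have chain: "((\<lambda>x. g (U x) * deriv U x) has_integral integral {0..U \<beta>} g - integral {0..U \<alpha>} g) {\<alpha>..\<beta>}"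
    if g: "continuous_on UNIV g" for g
  proof (rule fundamental_theorem_of_calculus[OF ab])
    fix x
    have "U x > 0" using v(1)[of x] m by linarith
    from DERIV_chain2[OF has_real_derivative_integral_0[OF g this] dU]
    show "((\<lambda>x. integral {0..U x} g) has_vector_derivative g (U x) * deriv U x) (at x within {\<alpha>..\<beta>})"
      by (simp add: has_real_derivative_iff_has_vector_derivative has_vector_derivative_at_within)
  qed
  have const: "((\<lambda>x. k) has_integral k * (\<beta> - \<alpha>)) {\<alpha>..\<beta>}" for k :: real
    using has_integral_const_real[of k \<alpha> \<beta>] ab by (simp add: mult.commute)
  have i1: "((\<lambda>x. (U x)\<^sup>2 + (deriv U x)\<^sup>2) has_integral integral {\<alpha>..\<beta>} (\<lambda>x. (U x)\<^sup>2 + (deriv U x)\<^sup>2)) {\<alpha>..\<beta>}"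
    and i2: "((\<lambda>x. quartic_density (U x) (deriv U x)) has_integral
      integral {\<alpha>..\<beta>} (\<lambda>x. quartic_density (U x) (deriv U x))) {\<alpha>..\<beta>}"
    by (intro integrable_integral integrable_continuous_real continuous_intros c; simp)+
  have e: "((\<lambda>x. (U x)\<^sup>2 + (deriv U x)\<^sup>2 - m\<^sup>2 + 2 * \<sigma> * (q (U x) * deriv U x)) has_integral E) {\<alpha>..\<beta>}"
    unfolding E_def
    by (intro has_integral_add has_integral_diff i1 const has_integral_mult_right chain q_continuous)
  have F: "((\<lambda>x. quartic_density (U x) (deriv U x) - m ^ 4 + \<sigma> * (f (U x) * deriv U x)) has_integral
      integral {\<alpha>..\<beta>} (\<lambda>x. quartic_density (U x) (deriv U x)) - m ^ 4 * (\<beta> - \<alpha>)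
      + \<sigma> * (integral {0..U \<beta>} f - integral {0..U \<alpha>} f)) {\<alpha>..\<beta>}"
    by (intro has_integral_add has_integral_diff[of "\<lambda>x. quartic_density (U x) (deriv U x)"]
        i2 const has_integral_mult_right chain f_continuous)
  show "0 \<le> E" by (rule has_integral_nonneg[OF e]) (use calibration_pointwise(1)[OF \<sigma> v] in auto)
  show "integral {\<alpha>..\<beta>} (\<lambda>x. quartic_density (U x) (deriv U x)) - m ^ 4 * (\<beta> - \<alpha>)
      + \<sigma> * (integral {0..U \<beta>} f - integral {0..U \<alpha>} f) \<le> (4 / 3 * M\<^sup>2 + 2 / 3 * m\<^sup>2) * E"
    by (rule has_integral_le[OF F has_integral_mult_right[OF e]]) (use calibration_pointwise(2)[OF \<sigma> v] in auto)
qed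

text \<open>
  On either side of the maximum \<open>U 0\<close> the peakon solves \<open>U\<^sub>x = \<mp> sqrt (U\<^sup>2 - m\<^sup>2)\<close>, so the sign changes
  at a minimum.
\<close>

lemma calibration:
  assumes U: "circle_C1 U" and max: "\<And>x. U x \<le> U 0" and \<eta>: "\<eta> \<in> {0..1}" "U \<eta> = m" and min: "\<And>x. m \<le> U x"
    and a: "a \<ge> 0" "U 0 = m * cosh a"
  shows "m\<^sup>2 * profile_e a \<le> energy U"
    "quartic_energy U - m ^ 4 * profile_n a \<le> m\<^sup>2 * profile_k a * (energy U - m\<^sup>2 * profile_e a)"
proof -
  note c = circle_C1_continuous[OF U]
  have "U (0 + 1) = U 0" using U ac_derivD(1) unfolding circle_C1_def periodic1_def by blast
  then have U1: "U 1 = m * cosh a" using a by simp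
  have q\<eta>: "integral {0..U \<eta>} q = 0" "integral {0..U \<eta>} f = 0"
    using integral_q[of 0] integral_f[of 0] \<eta>(2) by (simp_all add: profile_e_def profile_n_def)
  have comb: "integral {0..\<eta>} g + integral {\<eta>..1} g = integral {0..1} g" if "continuous_on UNIV g" for g :: "real \<Rightarrow> real"
    using \<eta>(1) that by (intro Henstock_Kurzweil_Integration.integral_combine) (auto intro: continuous_UNIV_integrable)
  \<comment> \<open>The sign is +1 before \<eta>, where the peakon has U_x = - q(U), and -1 after
    it.\<close>
  note I1 = calibration_interval[OF U _ _ min max, of 0 \<eta> 1]
  note I2 = calibration_interval[OF U _ _ min max, of \<eta> 1 "-1"]
  define E1 where "E1 = integral {0..\<eta>} (\<lambda>x. (U x)\<^sup>2 + (deriv U x)\<^sup>2) - m\<^sup>2 * \<eta> - 2 * integral {0..m * cosh a} q"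
  define E2 where "E2 = integral {\<eta>..1} (\<lambda>x. (U x)\<^sup>2 + (deriv U x)\<^sup>2) - m\<^sup>2 * (1 - \<eta>) - 2 * integral {0..m * cosh a} q"
  have sum: "E1 + E2 = energy U - m\<^sup>2 * profile_e a"
    unfolding E1_def E2_def energy_def integral_q[OF a(1)]
    using comb[of "\<lambda>x. (U x)\<^sup>2 + (deriv U x)\<^sup>2"] c by (simp add: continuous_intros algebra_simps)
  have 1: "0 \<le> E1" "integral {0..\<eta>} (\<lambda>x. quartic_density (U x) (deriv U x)) - m ^ 4 * \<eta>
      - integral {0..m * cosh a} f \<le> (4 / 3 * (m * cosh a)\<^sup>2 + 2 / 3 * m\<^sup>2) * E1"
    using I1 \<eta> by (auto simp: q\<eta> a(2) E1_def q\<eta>[unfolded \<eta>(2)])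
  have 2: "0 \<le> E2" "integral {\<eta>..1} (\<lambda>x. quartic_density (U x) (deriv U x)) - m ^ 4 * (1 - \<eta>)
      - integral {0..m * cosh a} f \<le> (4 / 3 * (m * cosh a)\<^sup>2 + 2 / 3 * m\<^sup>2) * E2"
    using I2 \<eta> by (auto simp: q\<eta> a(2) U1 E2_def q\<eta>[unfolded \<eta>(2)])
  show "m\<^sup>2 * profile_e a \<le> energy U" using 1(1) 2(1) sum by linarith
  have "quartic_energy U = integral {0..\<eta>} (\<lambda>x. quartic_density (U x) (deriv U x)) +
    integral {\<eta>..1} (\<lambda>x. quartic_density (U x) (deriv U x))"
    unfolding quartic_energy_def by (rule comb[symmetric]) (intro continuous_intros c, simp)
  then have "quartic_energy U - m ^ 4 - 2 * integral {0..m * cosh a} f \<le> (4 / 3 * (m * cosh a)\<^sup>2 + 2 / 3 * m\<^sup>2) * (E1 + E2)"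
    using 1(2) 2(2) unfolding distrib_left[of _ E1 E2] right_diff_distrib by linarith
  moreover have "(4 / 3 * (m * cosh a)\<^sup>2 + 2 / 3 * m\<^sup>2) = m\<^sup>2 * profile_k a"
    by (simp add: profile_k_def power_mult_distrib algebra_simps)
  moreover have "quartic_energy U - m ^ 4 - 2 * integral {0..m * cosh a} f = quartic_energy U - m ^ 4 * profile_n a"
    unfolding integral_f[OF a(1)] by (simp add: field_simps)
  ultimately show "quartic_energy U - m ^ 4 * profile_n a \<le> m\<^sup>2 * profile_k a * (energy U - m\<^sup>2 * profile_e a)"
    by (simp only: sum)
qed

end

subsection \<open>The profile functions\<close>

text \<open>The combination 2 N - K E governs the derivative of N / E^2; in this form its sign is
  visibly that of 2 a - 1.\<close>

lemma profile_n_eq: "2 * profile_n a = profile_k a * profile_e a - 4 / 3 * (sinh a)\<^sup>2 * (1 - 2 * a)"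
proof -
  have s3: "sinh a ^ 3 * cosh a = (sinh a)\<^sup>2 * sinh (2 * a) / 2"
    by (simp add: sinh_double power2_eq_square power3_eq_cube)
  have "2 * profile_n a = 2 * profile_e a + 4 / 3 * ((sinh a)\<^sup>2 * sinh (2 * a))"
    unfolding profile_n_def using s3 by (simp add: mult.commute mult.left_commute)
  moreover have k: "profile_k a = 2 + 4 / 3 * (sinh a)\<^sup>2" by (simp add: profile_k_def cosh_square_eq field_simps)
  ultimately show ?thesis unfolding k by (simp add: profile_e_def field_simps)
qed

lemma profile_e_mono: "0 \<le> a \<Longrightarrow> a \<le> b \<Longrightarrow> profile_e a \<le> profile_e b"
  by (rule DERIV_nonneg_imp_nondecreasing[of a b], assumption, rule exI, rule conjI, rule profile_e_deriv) simp

lemma profile_e_ge_1: "0 \<le> a \<Longrightarrow> 1 \<le> profile_e a"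
  using profile_e_mono[of 0 a] by (simp add: profile_e_def)

lemma profile_e_unbounded:
  assumes "0 \<le> a" "profile_e a \<le> Y"
  shows "\<exists>b\<ge>a. profile_e b = Y"
proof -
  \<comment> \<open>From exp (2 B) >= (1 + B)^2 follows a lower bound for \<open>profile_e B\<close>
    that grows like B^2 / 2; it exceeds B once B >= 4.\<close>
  define B where "B = max a (max Y 4)"
  have B: "B \<ge> a" "B \<ge> Y" "B \<ge> 4" by (auto simp: B_def)
  have "exp (2 * B) = (exp B)\<^sup>2" by (simp add: exp_double[symmetric])
  also have "\<dots> \<ge> (1 + B)\<^sup>2" using B by (intro power_mono exp_ge_add_one_self) auto
  finally have ex: "exp (2 * B) \<ge> (1 + B)\<^sup>2" .
  have "exp (- (2 * B)) \<le> 1" using B by simp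
  then have "exp (2 * B) - exp (- (2 * B)) \<ge> (1 + B)\<^sup>2 - 1" by (rule diff_mono[OF ex])
  then have "sinh (2 * B) \<ge> ((1 + B)\<^sup>2 - 1) / 2" by (simp add: sinh_field_def)
  then have "profile_e B \<ge> 1 + ((1 + B)\<^sup>2 - 1) / 2 - 2 * B" by (simp add: profile_e_def)
  moreover have "1 + ((1 + B)\<^sup>2 - 1) / 2 - 2 * B \<ge> B"
  proof -
    have "4 * B \<le> B * B" using B(3) by (intro mult_right_mono) auto
    then have "B * 4 \<le> B * B + 2" by linarith
    then show ?thesis by (simp add: power2_eq_square field_simps)
  qed
  ultimately have "Y \<le> profile_e B" using B(2) by linarith
  moreover have "continuous_on {a..B} profile_e"
    by (rule DERIV_atLeastAtMost_imp_continuous_on, rule exI, rule profile_e_deriv)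
  ultimately show ?thesis using IVT'[of profile_e a Y B] assms B(1) by auto
qed

text \<open>N / E^2 is the ratio of the two energies that is invariant under multiplying the profile
  by a constant. Its peak at a = 1/2 is the variational reason for stability.\<close>

lemma profile_ratio_mono:
  "0 \<le> a \<Longrightarrow> a < b \<Longrightarrow> b \<le> 1 / 2 \<Longrightarrow> profile_n a / (profile_e a)\<^sup>2 < profile_n b / (profile_e b)\<^sup>2"
  "1 / 2 \<le> a \<Longrightarrow> a < b \<Longrightarrow> profile_n b / (profile_e b)\<^sup>2 < profile_n a / (profile_e a)\<^sup>2"
proof -
  have d: "((\<lambda>x. profile_n x / (profile_e x)\<^sup>2) has_real_derivative
      16 / 3 * (sinh x) ^ 4 * (1 - 2 * x) / profile_e x ^ 3) (at x)" if "x \<ge> 0" for x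
  proof -
    have e: "profile_e x > 0" using profile_e_ge_1[OF that] by linarith
    have "((\<lambda>x. profile_n x / (profile_e x)\<^sup>2) has_real_derivative
      (profile_k x * (4 * (sinh x)\<^sup>2) * (profile_e x)\<^sup>2 - profile_n x * (2 * profile_e x * (4 * (sinh x)\<^sup>2))) / ((profile_e x)\<^sup>2 * (profile_e x)\<^sup>2)) (at x)"
      using e by (intro DERIV_divide profile_n_deriv) (auto intro!: derivative_eq_intros profile_e_deriv)
    also have "profile_k x * (4 * (sinh x)\<^sup>2) * (profile_e x)\<^sup>2 - profile_n x * (2 * profile_e x * (4 * (sinh x)\<^sup>2))
       = 4 * (sinh x)\<^sup>2 * profile_e x * (profile_k x * profile_e x - 2 * profile_n x)"
      by (simp add: power2_eq_square algebra_simps)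
    also have "\<dots> = 16 / 3 * (sinh x) ^ 4 * (1 - 2 * x) * profile_e x"
      unfolding profile_n_eq by (simp add: power2_eq_square power4_eq_xxxx)
    also have "16 / 3 * (sinh x) ^ 4 * (1 - 2 * x) * profile_e x / ((profile_e x)\<^sup>2 * (profile_e x)\<^sup>2)
       = 16 / 3 * (sinh x) ^ 4 * (1 - 2 * x) / profile_e x ^ 3"
      using e by (simp add: power2_eq_square power3_eq_cube)
    finally show ?thesis .
  qed
  have pos: "sinh x ^ 4 / profile_e x ^ 3 > 0" if "x > 0" for x :: real
    using profile_e_ge_1[of x] that by simp
  have cont: "continuous_on {a..b} (\<lambda>x. profile_n x / (profile_e x)\<^sup>2)" if "0 \<le> a" for a b
    using that by (intro DERIV_atLeastAtMost_imp_continuous_on exI) (rule d, simp)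
  show "profile_n a / (profile_e a)\<^sup>2 < profile_n b / (profile_e b)\<^sup>2" if "0 \<le> a" "a < b" "b \<le> 1 / 2"
  proof (rule DERIV_pos_imp_increasing_open[OF that(2) _ cont[OF that(1)]])
    fix x assume x: "a < x" "x < b"
    have "16 / 3 * (sinh x ^ 4 / profile_e x ^ 3) * (1 - 2 * x) > 0"
      using pos[of x] x that by (intro mult_pos_pos) auto
    then show "\<exists>y. ((\<lambda>x. profile_n x / (profile_e x)\<^sup>2) has_real_derivative y) (at x) \<and> y > 0"
      using d[of x] x that by (intro exI[of _ "16 / 3 * (sinh x) ^ 4 * (1 - 2 * x) / profile_e x ^ 3"]) auto
  qed
  show "profile_n b / (profile_e b)\<^sup>2 < profile_n a / (profile_e a)\<^sup>2" if "1 / 2 \<le> a" "a < b"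
  proof (rule DERIV_neg_imp_decreasing_open[OF that(2) _ cont])
    fix x assume x: "a < x" "x < b"
    have "16 / 3 * (sinh x ^ 4 / profile_e x ^ 3) * (1 - 2 * x) < 0"
      using pos[of x] x that by (intro mult_pos_neg) auto
    then show "\<exists>y. ((\<lambda>x. profile_n x / (profile_e x)\<^sup>2) has_real_derivative y) (at x) \<and> y < 0"
      using d[of x] x that by (intro exI[of _ "16 / 3 * (sinh x) ^ 4 * (1 - 2 * x) / profile_e x ^ 3"]) auto
  qed (use that in auto)
qed

text \<open>
  As a function of \<open>profile_e\<close>, \<open>profile_n\<close> is convex with slope \<open>profile_k\<close>; this is its gap to the tangent at \<open>a\<close>.
\<close>

definition profile_gap :: "real \<Rightarrow> real \<Rightarrow> real" where
  "profile_gap a b = profile_n b - profile_n a - profile_k a * (profile_e b - profile_e a)"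

lemma profile_k_mono: "0 \<le> a \<Longrightarrow> a \<le> b \<Longrightarrow> profile_k a \<le> profile_k b"
  by (simp add: profile_k_def cosh_real_nonneg_le_iff power_mono)

lemma profile_k_strict_mono: "0 \<le> a \<Longrightarrow> a < b \<Longrightarrow> profile_k a < profile_k b"
  by (simp add: profile_k_def cosh_real_nonneg_less_iff power_strict_mono)

lemma profile_gap_deriv: "(profile_gap a has_real_derivative (profile_k x - profile_k a) * (4 * (sinh x)\<^sup>2)) (at x)"
  unfolding profile_gap_def[abs_def]
  by (auto intro!: derivative_eq_intros profile_n_deriv profile_e_deriv simp: algebra_simps)

lemma profile_gap_mono:
  assumes "0 \<le> a" "a \<le> b" "b \<le> b'" shows "profile_gap a b \<le> profile_gap a b'"
proof (rule DERIV_nonneg_imp_nondecreasing[OF assms(3)])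
  fix x assume "b \<le> x"
  then have "profile_k a \<le> profile_k x" using assms by (intro profile_k_mono) auto
  then show "\<exists>y. (profile_gap a has_real_derivative y) (at x) \<and> 0 \<le> y"
    using profile_gap_deriv[of a x] by (intro exI[of _ "(profile_k x - profile_k a) * (4 * (sinh x)\<^sup>2)"]) auto
qed

lemma profile_gap_pos:
  assumes "0 \<le> a" "a < b" shows "0 < profile_gap a b"
proof -
  have "profile_gap a a < profile_gap a b"
  proof (rule DERIV_pos_imp_increasing_open[OF assms(2)])
    fix x assume x: "a < x" "x < b"
    have "profile_k a < profile_k x" using assms x by (intro profile_k_strict_mono) auto
    moreover have "sinh x \<noteq> 0" using x assms by simp
    ultimately show "\<exists>y. (profile_gap a has_real_derivative y) (at x) \<and> 0 < y"
      using profile_gap_deriv[of a x] by (intro exI[of _ "(profile_k x - profile_k a) * (4 * (sinh x)\<^sup>2)"]) auto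
  qed (rule DERIV_atLeastAtMost_imp_continuous_on, rule exI, rule profile_gap_deriv)
  then show ?thesis by (simp add: profile_gap_def)
qed

text \<open>The tangent of a convex function rises towards the value at b as its point of contact
  approaches b.\<close>

lemma profile_gap_antimono:
  assumes "0 \<le> a" "a \<le> a'" "a' \<le> b" shows "profile_gap a' b \<le> profile_gap a b"
proof -
  have "profile_gap a b - profile_gap a' b = profile_gap a a' + (profile_k a' - profile_k a) * (profile_e b - profile_e a')"
    by (simp add: profile_gap_def algebra_simps)
  moreover have "profile_gap a a' \<ge> 0" using profile_gap_mono[of a a a'] assms by (simp add: profile_gap_def)
  moreover have "(profile_k a' - profile_k a) * (profile_e b - profile_e a') \<ge> 0"
    using profile_k_mono[of a a'] profile_e_mono[of a' b] assms by simp
  ultimately show ?thesis by linarith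
qed

subsection \<open>Stability of the maximum\<close>

text \<open>Let b satisfy E = m^2 e(b). Divided by E^2, the last hypothesis becomes F / E^2 <=
  \<rho>(b) - gap(a, b) / e(b)^2 with a <= b. If F / E^2 is nearly \<rho>(1/2), the maximum of
  \<rho>, then b is near 1/2 and the gap is small, and a small gap keeps a from falling much below
  b. Finally m^2 = E / e(b) and the bound on a give the height.\<close>

lemma profile_stability:
  fixes m\<^sub>0 \<eta> :: real
  assumes m0: "m\<^sub>0 > 0" and \<eta>: "\<eta> > 0"
  defines "E\<^sub>0 \<equiv> m\<^sub>0\<^sup>2 * profile_e (1/2)" and "F\<^sub>0 \<equiv> m\<^sub>0 ^ 4 * profile_n (1/2)"
  shows "\<exists>\<kappa>>0. \<forall>E F m a. m > 0 \<longrightarrow> a \<ge> 0 \<longrightarrow> \<bar>E - E\<^sub>0\<bar> < \<kappa> \<longrightarrow> F > F\<^sub>0 - \<kappa> \<longrightarrow> m\<^sup>2 * profile_e a \<le> E \<longrightarrow>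
    F - m ^ 4 * profile_n a \<le> m\<^sup>2 * profile_k a * (E - m\<^sup>2 * profile_e a) \<longrightarrow> m * cosh a > m\<^sub>0 * cosh (1/2) - \<eta>"
proof -
  define \<rho> where "\<rho> b = profile_n b / (profile_e b)\<^sup>2" for b
  have e1: "profile_e b \<ge> 1" "profile_e b > 0" if "b \<ge> 0" for b
    using profile_e_ge_1[OF that] by auto
  have E0: "E\<^sub>0 > 0" unfolding E\<^sub>0_def using m0 e1(2)[of "1/2"] by simp
  have "profile_n (1/2) > 0" using e1(2)[of "1/2"] by (auto simp: profile_n_def intro!: add_pos_nonneg)
  then have F0: "F\<^sub>0 > 0" unfolding F\<^sub>0_def using m0 by simp
  have \<rho>0: "\<rho> (1/2) = F\<^sub>0 / E\<^sub>0\<^sup>2"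
    unfolding \<rho>_def E\<^sub>0_def F\<^sub>0_def using m0 by (simp add: power_mult_distrib power4_eq_xxxx power2_eq_square)
  have conte: "isCont profile_e x" for x using profile_e_deriv DERIV_isCont by blast
  \<comment> \<open>The worst value of m cosh a when E is at least
    \<open>E\<^sub>0 - \<theta>\<close>, b at most 1/2 + \<theta> and a at least 1/2 -
    \<theta>.\<close>
  let ?g = "\<lambda>\<theta>. sqrt ((E\<^sub>0 - \<theta>) / profile_e (1/2 + \<theta>)) * cosh (1/2 - \<theta>)"
  have "isCont (\<lambda>\<theta>. profile_e (1/2 + \<theta>)) 0"
    by (rule isCont_o2[where g=profile_e]) (auto intro!: continuous_intros conte)
  then have "isCont ?g 0"
    using e1(2)[of "1/2"] by (intro continuous_intros) auto
  moreover have "?g 0 = m\<^sub>0 * cosh (1/2)"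
    using e1(2)[of "1/2"] m0 by (simp add: E\<^sub>0_def)
  ultimately have "(?g \<longlongrightarrow> m\<^sub>0 * cosh (1/2)) (at_right 0)"
    using tendsto_within_subset[OF isContD[of 0 ?g] subset_UNIV] by simp
  then have "\<forall>\<^sub>F \<theta> in at_right 0. ?g \<theta> > m\<^sub>0 * cosh (1/2) - \<eta>"
    by (rule order_tendstoD) (use \<eta> in simp)
  moreover have "\<forall>\<^sub>F \<theta> in at_right 0. \<theta> \<in> {0<..<min (1/2) E\<^sub>0}"
    by (rule eventually_at_right_real) (use E0 in simp)
  ultimately have "\<forall>\<^sub>F \<theta> in at_right 0. ?g \<theta> > m\<^sub>0 * cosh (1/2) - \<eta> \<and> \<theta> > 0 \<and> \<theta> < 1/2 \<and> \<theta> < E\<^sub>0"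
    by eventually_elim simp
  from eventually_happens'[OF _ this] obtain \<theta> where
    \<theta>: "?g \<theta> > m\<^sub>0 * cosh (1/2) - \<eta>" "\<theta> > 0" "\<theta> < 1/2" "\<theta> < E\<^sub>0"
    by auto
  \<comment> \<open>b will be confined to (b1, b2). The room between a1 and b1 makes the gap
    \<sigma> positive, which rules out a < a1.\<close>
  define a1 b1 b2 where "a1 = 1/2 - \<theta>" and "b1 = 1/2 - \<theta> / 2" and "b2 = 1/2 + \<theta>"
  have ab: "0 \<le> a1" "a1 < b1" "b1 < 1/2" "1/2 < b2" using \<theta> by (auto simp: a1_def b1_def b2_def)
  define \<mu> where "\<mu> = \<rho> (1/2) - max (\<rho> b1) (\<rho> b2)"
  have \<mu>: "\<mu> > 0" using profile_ratio_mono(1)[of b1 "1/2"] profile_ratio_mono(2)[of "1/2" b2] ab by (simp add: \<mu>_def \<rho>_def)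
  define \<sigma> where "\<sigma> = profile_gap a1 b1"
  have \<sigma>: "\<sigma> > 0" unfolding \<sigma>_def by (rule profile_gap_pos) (use ab in auto)
  \<comment> \<open>The admissible deficit of F / E^2: at least \<mu> is lost when b leaves (b1,
    b2), and at least \<sigma> / e(b2)^2 when a < a1 while b stays inside.\<close>
  define \<nu> where "\<nu> = min \<mu> (\<sigma> / (profile_e b2)\<^sup>2)"
  have \<nu>: "\<nu> > 0" using \<mu> \<sigma> e1(2)[of b2] ab by (simp add: \<nu>_def)
  have "isCont (\<lambda>\<kappa>. (F\<^sub>0 - \<kappa>) / (E\<^sub>0 + \<kappa>)\<^sup>2) 0" using E0 by (intro continuous_intros) auto
  then have "((\<lambda>\<kappa>. (F\<^sub>0 - \<kappa>) / (E\<^sub>0 + \<kappa>)\<^sup>2) \<longlongrightarrow> \<rho> (1/2)) (at_right 0)"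
    unfolding \<rho>0 using tendsto_within_subset[OF isContD[of 0 "\<lambda>\<kappa>. (F\<^sub>0 - \<kappa>) / (E\<^sub>0 + \<kappa>)\<^sup>2"] subset_UNIV] by simp
  then have "\<forall>\<^sub>F \<kappa> in at_right 0. (F\<^sub>0 - \<kappa>) / (E\<^sub>0 + \<kappa>)\<^sup>2 > \<rho> (1/2) - \<nu>"
    by (rule order_tendstoD) (use \<nu> in simp)
  moreover have "\<forall>\<^sub>F \<kappa> in at_right 0. \<kappa> \<in> {0<..<min \<theta> F\<^sub>0}"
    by (rule eventually_at_right_real) (use \<theta> F0 in simp)
  ultimately have "\<forall>\<^sub>F \<kappa> in at_right 0. (F\<^sub>0 - \<kappa>) / (E\<^sub>0 + \<kappa>)\<^sup>2 > \<rho> (1/2) - \<nu> \<and> \<kappa> > 0 \<and> \<kappa> < \<theta> \<and> \<kappa> < F\<^sub>0"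
    by eventually_elim simp
  from eventually_happens'[OF _ this] obtain \<kappa> where
    \<kappa>: "(F\<^sub>0 - \<kappa>) / (E\<^sub>0 + \<kappa>)\<^sup>2 > \<rho> (1/2) - \<nu>" "\<kappa> > 0" "\<kappa> < \<theta>" "\<kappa> < F\<^sub>0"
    by auto
  show ?thesis
  proof (intro exI[of _ \<kappa>] conjI allI impI \<kappa>(2))
    fix E F m a :: real
    assume m: "m > 0" and a: "a \<ge> 0" and E: "\<bar>E - E\<^sub>0\<bar> < \<kappa>" and F: "F > F\<^sub>0 - \<kappa>" and J: "m\<^sup>2 * profile_e a \<le> E"
      and K: "F - m ^ 4 * profile_n a \<le> m\<^sup>2 * profile_k a * (E - m\<^sup>2 * profile_e a)"
    have Epos: "E > 0" using E \<kappa> \<theta> by simp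
    obtain b where b: "b \<ge> a" "profile_e b = E / m\<^sup>2"
      using profile_e_unbounded[OF a, of "E / m\<^sup>2"] J m by (auto simp: field_simps)
    have b0: "b \<ge> 0" using a b by simp
    have Eb: "E = m\<^sup>2 * profile_e b" using b m by simp
    have "F \<le> m ^ 4 * profile_n a + m\<^sup>2 * profile_k a * (m\<^sup>2 * (profile_e b - profile_e a))"
      using K unfolding Eb by (simp add: algebra_simps)
    also have "\<dots> = m ^ 4 * (profile_n b - profile_gap a b)"
      by (simp add: profile_gap_def algebra_simps power4_eq_xxxx power2_eq_square)
    finally have "F / E\<^sup>2 \<le> m ^ 4 * (profile_n b - profile_gap a b) / E\<^sup>2" by (rule divide_right_mono) simp
    also have "\<dots> = (profile_n b - profile_gap a b) / (profile_e b)\<^sup>2"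
      unfolding Eb using m by (simp add: power_mult_distrib power4_eq_xxxx power2_eq_square)
    finally have FE: "F / E\<^sup>2 \<le> \<rho> b - profile_gap a b / (profile_e b)\<^sup>2" by (simp add: \<rho>_def diff_divide_distrib)
    have "(F\<^sub>0 - \<kappa>) / (E\<^sub>0 + \<kappa>)\<^sup>2 \<le> (F\<^sub>0 - \<kappa>) / E\<^sup>2"
      using E Epos \<kappa> by (intro divide_left_mono power_mono mult_pos_pos) auto
    also have "\<dots> \<le> F / E\<^sup>2" using F by (intro divide_right_mono) auto
    finally have FE': "F / E\<^sup>2 > \<rho> (1/2) - \<nu>" using \<kappa>(1) by linarith
    have gap0: "profile_gap a b \<ge> 0" using profile_gap_mono[of a a b] a b by (simp add: profile_gap_def)
    then have "profile_gap a b / (profile_e b)\<^sup>2 \<ge> 0" by simp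
    then have \<rho>b: "\<rho> b > \<rho> (1/2) - \<mu>" using FE FE' unfolding \<nu>_def by linarith
    have "b1 < b"
    proof (rule ccontr)
      assume "\<not> b1 < b"
      then have "\<rho> b \<le> \<rho> b1" using profile_ratio_mono(1)[of b b1] b0 ab by (cases "b = b1") (auto simp: \<rho>_def)
      then show False using \<rho>b by (simp add: \<mu>_def)
    qed
    moreover have "b < b2"
    proof (rule ccontr)
      assume "\<not> b < b2"
      then have "\<rho> b \<le> \<rho> b2" using profile_ratio_mono(2)[of b2 b] ab by (cases "b = b2") (auto simp: \<rho>_def)
      then show False using \<rho>b by (simp add: \<mu>_def)
    qed
    ultimately have bb: "b1 < b" "b < b2" .
    \<comment> \<open>Maximality at 1/2 bounds \<rho> b from above, so the whole deficit of F / E^2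
      is available to bound the gap.\<close>
    have "\<rho> b \<le> \<rho> (1/2)"
    proof -
      consider "b < 1/2" | "b = 1/2" | "b > 1/2" by linarith
      then show ?thesis
      proof cases
        case 1 then show ?thesis using profile_ratio_mono(1)[of b "1/2"] b0 by (simp add: \<rho>_def)
      next
        case 2 then show ?thesis by (simp only: order_refl)
      next
        case 3 then show ?thesis using profile_ratio_mono(2)[of "1/2" b] by (simp add: \<rho>_def)
      qed
    qed
    then have "profile_gap a b / (profile_e b)\<^sup>2 < \<sigma> / (profile_e b2)\<^sup>2" using FE FE' unfolding \<nu>_def by linarith
    moreover have eb: "profile_e b \<le> profile_e b2" using profile_e_mono b0 bb by simp
    then have "profile_gap a b / (profile_e b2)\<^sup>2 \<le> profile_gap a b / (profile_e b)\<^sup>2"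
      using e1(2)[OF b0] gap0 by (intro divide_left_mono power_mono mult_pos_pos) auto
    ultimately have "profile_gap a b / (profile_e b2)\<^sup>2 < \<sigma> / (profile_e b2)\<^sup>2" by linarith
    then have gap: "profile_gap a b < \<sigma>" using e1(2)[of b2] ab by (simp add: divide_less_cancel)
    have "a1 \<le> a"
    proof (rule ccontr)
      assume "\<not> a1 \<le> a"
      then have "profile_gap a1 b1 \<le> profile_gap a b1" "profile_gap a b1 \<le> profile_gap a b"
        using a ab bb by (auto intro!: profile_gap_antimono profile_gap_mono)
      then show False using gap by (simp add: \<sigma>_def)
    qed
    then have cosh: "cosh a1 \<le> cosh a" using ab a by (simp add: cosh_real_nonneg_le_iff)
    have "(E\<^sub>0 - \<theta>) / profile_e b2 \<le> E / profile_e b"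
      using E \<kappa> \<theta> eb e1(2)[OF b0] by (intro frac_le) auto
    also have "\<dots> = m\<^sup>2" unfolding Eb using e1(2)[OF b0] by simp
    finally have "sqrt ((E\<^sub>0 - \<theta>) / profile_e b2) \<le> m" using m by (intro real_le_lsqrt) auto
    then have "sqrt ((E\<^sub>0 - \<theta>) / profile_e b2) * cosh a1 \<le> m * cosh a"
      using cosh m \<theta> e1(2)[of b2] ab by (intro mult_mono) auto
    then show "m * cosh a > m\<^sub>0 * cosh (1/2) - \<eta>" using \<theta>(1) by (simp add: a1_def b2_def)
  qed
qed

lemma circle_C1_shift:
  assumes "circle_C1 w"
  shows "circle_C1 (\<lambda>x. w (x + \<xi>))" "deriv (\<lambda>x. w (x + \<xi>)) = (\<lambda>x. deriv w (x + \<xi>))"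
    "energy (\<lambda>x. w (x + \<xi>)) = energy w" "quartic_energy (\<lambda>x. w (x + \<xi>)) = quartic_energy w"
proof -
  have a: "ac_deriv w (deriv w)" using assms by (simp add: circle_C1_def)
  have "continuous_on UNIV (\<lambda>x. deriv w (x + \<xi>))"
    by (rule continuous_on_compose2[OF circle_C1_continuous(2)[OF assms]]) (auto intro!: continuous_intros)
  note C = circle_C1I[OF ac_deriv_shift[OF a] this]
  show "circle_C1 (\<lambda>x. w (x + \<xi>))" and d: "deriv (\<lambda>x. w (x + \<xi>)) = (\<lambda>x. deriv w (x + \<xi>))" by (rule C)+
  have shift: "integral {0..1} (\<lambda>x. g (x + \<xi>)) = integral {0..1} g"
    if "periodic1 g" "continuous_on UNIV g" for g :: "real \<Rightarrow> real"
    using periodic1_integral[OF that(1), of \<xi>] integral_shift_real_ivl[of \<xi> \<xi> "\<xi> + 1" g] that(2)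
    by (simp add: absolutely_integrable_continuous_real continuous_on_subset)
  note p = ac_derivD(1,2)[OF a] and c = circle_C1_continuous[OF assms]
  show "energy (\<lambda>x. w (x + \<xi>)) = energy w" unfolding energy_def d
    by (rule shift[of "\<lambda>x. (w x)\<^sup>2 + (deriv w x)\<^sup>2"]) (use p in \<open>auto simp: periodic1_def intro!: continuous_intros c\<close>)
  show "quartic_energy (\<lambda>x. w (x + \<xi>)) = quartic_energy w" unfolding quartic_energy_def d
    by (rule shift[of "\<lambda>x. quartic_density (w x) (deriv w x)"])
      (use p in \<open>auto simp: periodic1_def intro!: continuous_intros c\<close>)
qed

lemma circle_C1_frac: "circle_C1 w \<Longrightarrow> w (frac x) = w x"
  using periodic1_frac ac_derivD(1) unfolding circle_C1_def by blast

lemma frac_mem: "frac x \<in> {0..1}" for x :: real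
  by (simp add: less_imp_le frac_lt_1)

text \<open>The maximum is moved to 0, and a is chosen so that maximum over minimum is cosh a;
  positivity makes this quotient meaningful.\<close>

lemma maximum_stability:
  fixes m\<^sub>0 \<eta> :: real
  assumes m0: "m\<^sub>0 > 0" and \<eta>: "\<eta> > 0"
  obtains \<kappa> where "\<kappa> > 0"
    "\<And>w \<xi>. circle_C1 w \<Longrightarrow> (\<And>x. w x \<le> w \<xi>) \<Longrightarrow> (\<And>x. w x > 0) \<Longrightarrow>
      \<bar>energy w - m\<^sub>0\<^sup>2 * profile_e (1/2)\<bar> < \<kappa> \<Longrightarrow> quartic_energy w > m\<^sub>0 ^ 4 * profile_n (1/2) - \<kappa> \<Longrightarrow>
      w \<xi> > m\<^sub>0 * cosh (1/2) - \<eta>"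
proof -
  obtain \<kappa> where \<kappa>: "\<kappa> > 0" and stab: "\<And>E F m a. m > 0 \<Longrightarrow> a \<ge> 0 \<Longrightarrow> \<bar>E - m\<^sub>0\<^sup>2 * profile_e (1/2)\<bar> < \<kappa> \<Longrightarrow>
    F > m\<^sub>0 ^ 4 * profile_n (1/2) - \<kappa> \<Longrightarrow> m\<^sup>2 * profile_e a \<le> E \<Longrightarrow>
    F - m ^ 4 * profile_n a \<le> m\<^sup>2 * profile_k a * (E - m\<^sup>2 * profile_e a) \<Longrightarrow> m * cosh a > m\<^sub>0 * cosh (1/2) - \<eta>"
    using profile_stability[OF m0 \<eta>] by blast
  show ?thesis
  proof (rule that[OF \<kappa>])
    fix w \<xi> assume w: "circle_C1 w" and max: "\<And>x. w x \<le> w \<xi>" and pos: "\<And>x. w x > 0"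
      and E: "\<bar>energy w - m\<^sub>0\<^sup>2 * profile_e (1/2)\<bar> < \<kappa>" and F: "quartic_energy w > m\<^sub>0 ^ 4 * profile_n (1/2) - \<kappa>"
    define U where "U = (\<lambda>x. w (x + \<xi>))"
    note U = circle_C1_shift[OF w, of \<xi>, folded U_def]
    obtain z where z: "z \<in> {0..1}" "\<And>x. x \<in> {0..1} \<Longrightarrow> U z \<le> U x"
      using continuous_attains_inf[of "{0..1}" U] circle_C1_continuous(1)[OF U(1)] by fastforce
    define m where "m = U z"
    have min: "m \<le> U x" for x
      using z(2)[OF frac_mem, of x] circle_C1_frac[OF U(1)] by (simp add: m_def)
    have mpos: "m > 0" using pos by (simp add: m_def U_def)
    then interpret calibration m by unfold_locales
    define a where "a = arcosh (U 0 / m)"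
    have r: "U 0 / m \<ge> 1" using min[of 0] mpos by simp
    have a: "a \<ge> 0" "U 0 = m * cosh a" using r mpos by (simp_all add: a_def)
    have "U x \<le> U 0" for x using max by (simp add: U_def)
    note cal = calibration[OF U(1) this z(1) m_def[symmetric] min a]
    have "m * cosh a > m\<^sub>0 * cosh (1/2) - \<eta>"
      by (rule stab[OF mpos a(1) E F]) (use cal U(3,4) in auto)
    then show "w \<xi> > m\<^sub>0 * cosh (1/2) - \<eta>" using a(2) by (simp add: U_def)
  qed
qed

subsection \<open>The peakon\<close>

text \<open>The value at x = 1/2. The height is sqrt c, so height over minimum is cosh (1/2): the
  peakon is the profile with a = 1/2.\<close>

definition peakon_min :: "real \<Rightarrow> real" where "peakon_min c = sqrt c / cosh (1/2)"

text \<open>The smooth function that agrees with the peakon on \<open>{0..1}\<close>; it replaces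
  the peakon under integrals, the kinks sitting at the ends.\<close>

definition peakon_arc :: "real \<Rightarrow> real \<Rightarrow> real" where
  "peakon_arc c x = peakon_min c * cosh (1/2 - x)"

definition peakon_arc' :: "real \<Rightarrow> real \<Rightarrow> real" where
  "peakon_arc' c x = - (peakon_min c * sinh (1/2 - x))"

lemma peakon_arc_deriv:
  "(peakon_arc c has_real_derivative peakon_arc' c x) (at x)"
  "(peakon_arc' c has_real_derivative peakon_arc c x) (at x)"
  unfolding peakon_arc_def[abs_def] peakon_arc'_def[abs_def] by (auto intro!: derivative_eq_intros)

lemma peakon_arc_continuous [continuous_intros]:
  "continuous_on S (peakon_arc c)" "continuous_on S (peakon_arc' c)"
  using peakon_arc_deriv by (auto intro!: continuous_at_imp_continuous_on DERIV_isCont)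

lemma peakon_eq: "peakon c x = peakon_arc c (frac x)"
  by (simp add: peakon_def peakon_arc_def peakon_min_def frac_def algebra_simps)

lemma peakon_periodic1: "periodic1 (peakon c)" by (simp add: periodic1_def peakon_eq frac_1_eq)

lemma peakon_eq_arc: "x \<in> {0..1} \<Longrightarrow> peakon c x = peakon_arc c x"
proof (cases "x = 1")
  case True
  have "cosh (1/2 :: real) = cosh (- (1/2))" by (rule cosh_minus[symmetric])
  then show ?thesis using True by (simp add: peakon_eq peakon_arc_def)
qed (simp add: peakon_eq frac_eq)

text \<open>The one-sided derivative from the right is taken at the integers, so the value at x = 1
  need not be \<open>peakon_arc' c 1\<close>.\<close>

definition peakon_deriv :: "real \<Rightarrow> real \<Rightarrow> real" where
  "peakon_deriv c x = peakon_arc' c (frac x)"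

lemma peakon_deriv_eq_arc: "x \<in> {0..1} - {1} \<Longrightarrow> peakon_deriv c x = peakon_arc' c x"
  by (simp add: peakon_deriv_def frac_eq)

lemma ac_deriv_peakon: "ac_deriv (peakon c) (peakon_deriv c)"
proof (rule ac_deriv_if_unit_interval[OF peakon_periodic1])
  show "periodic1 (peakon_deriv c)" by (simp add: periodic1_def peakon_deriv_def frac_1_eq)
  have "peakon_arc' c absolutely_integrable_on {0..1}"
    by (intro absolutely_integrable_continuous_real continuous_intros)
  then show "peakon_deriv c absolutely_integrable_on {0..1}"
    by (rule absolutely_integrable_spike[OF _ negligible_finite[of "{1}"]]) (use peakon_deriv_eq_arc in auto)
  fix x :: real assume x: "0 \<le> x" "x \<le> 1"
  have "(peakon_arc' c has_integral peakon_arc c x - peakon_arc c 0) {0..x}"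
    using peakon_arc_deriv(1)
    by (intro fundamental_theorem_of_calculus x(1))
      (simp add: has_real_derivative_iff_has_vector_derivative has_vector_derivative_at_within)
  then have "integral {0..x} (peakon_arc' c) = peakon c x - peakon c 0"
    using x peakon_eq_arc[of x c] peakon_eq_arc[of 0 c] by (simp add: integral_unique)
  moreover have "integral {0..x} (peakon_arc' c) = integral {0..x} (peakon_deriv c)"
    by (rule integral_spike[OF negligible_finite[of "{1}"]]) (use peakon_deriv_eq_arc x in auto)
  ultimately show "peakon c x - peakon c 0 = integral {0..x} (peakon_deriv c)" by simp
qed

text \<open>f' may differ from f on a null set because the initial datum comes without
  continuity.\<close>

lemma H1_norm_eq:
  assumes f: "ac_deriv f g" and f': "AE x in lebesgue. f' x = f x" "periodic1 f'"
    and i: "(\<lambda>x. (f x)\<^sup>2 + (g x)\<^sup>2) absolutely_integrable_on {0..1}"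
  shows "(H1_norm f')\<^sup>2 = integral {0..1} (\<lambda>x. (f x)\<^sup>2 + (g x)\<^sup>2)"
proof -
  have "AE x in lebesgue. weak_deriv f' x = g x"
    using weak_deriv_ac_deriv(1)[OF f] weak_deriv_cong[OF f' ac_derivD(1)[OF f]] by simp
  then have "AE x in lebesgue. (f' x)\<^sup>2 + (weak_deriv f' x)\<^sup>2 = (f x)\<^sup>2 + (g x)\<^sup>2"
    using f'(1) by eventually_elim simp
  then obtain N where N: "negligible N" "\<And>x. x \<notin> N \<Longrightarrow> (f' x)\<^sup>2 + (weak_deriv f' x)\<^sup>2 = (f x)\<^sup>2 + (g x)\<^sup>2"
    by (rule AE_lebesgueE) blast
  have "(\<lambda>x. (f' x)\<^sup>2 + (weak_deriv f' x)\<^sup>2) absolutely_integrable_on {0..1}"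
    by (rule absolutely_integrable_spike[OF i N(1)]) (use N(2) in auto)
  then have "(LINT x:{0..1}|lebesgue. (f' x)\<^sup>2 + (weak_deriv f' x)\<^sup>2) = integral {0..1} (\<lambda>x. (f' x)\<^sup>2 + (weak_deriv f' x)\<^sup>2)"
    by (rule set_lebesgue_integral_eq_integral(2))
  also have "\<dots> = integral {0..1} (\<lambda>x. (f x)\<^sup>2 + (g x)\<^sup>2)"
    by (rule integral_spike[OF N(1)]) (use N(2) in auto)
  finally have "H1_norm f' = sqrt (integral {0..1} (\<lambda>x. (f x)\<^sup>2 + (g x)\<^sup>2))" by (simp add: H1_norm_def)
  moreover have "integral {0..1} (\<lambda>x. (f x)\<^sup>2 + (g x)\<^sup>2) \<ge> 0"
    by (rule integral_nonneg) (use set_lebesgue_integral_eq_integral(1)[OF i] in auto)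
  ultimately show ?thesis by simp
qed

text \<open>Moving with \<xi> puts the kinks at the ends of the period; after correction at one
  point the integrand there is continuous.\<close>

lemma H1_norm_diff_peakon:
  fixes \<xi> :: real
  assumes w: "circle_C1 w" and w': "AE x in lebesgue. w' x = w x" "periodic1 w'"
  defines "W \<equiv> \<lambda>x. w (x + \<xi>)"
  shows "(H1_norm (\<lambda>x. w' x - peakon c (x - \<xi>)))\<^sup>2 = integral {0..1} (\<lambda>x. (W x - peakon_arc c x)\<^sup>2 + (deriv W x - peakon_arc' c x)\<^sup>2)"
proof -
  note W = circle_C1_shift[OF w, of \<xi>, folded W_def]
  have aw: "ac_deriv w (deriv w)" and aW: "ac_deriv W (deriv W)" using w W(1) by (auto simp: circle_C1_def)
  have ap: "ac_deriv (\<lambda>x. peakon c (x - \<xi>)) (\<lambda>x. peakon_deriv c (x - \<xi>))"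
    using ac_deriv_shift[OF ac_deriv_peakon, of c "- \<xi>"] by simp
  define H0 where "H0 x = (W x - peakon_arc c x)\<^sup>2 + (deriv W x - peakon_arc' c x)\<^sup>2" for x
  define H where "H x = (W x - peakon c x)\<^sup>2 + (deriv W x - peakon_deriv c x)\<^sup>2" for x
  have H0ai: "H0 absolutely_integrable_on {0..1}" unfolding H0_def[abs_def]
    by (intro absolutely_integrable_continuous_real continuous_intros circle_C1_continuous[OF W(1)])
  have HH0: "H x = H0 x" if "x \<in> {0..1} - {1}" for x
    using that peakon_eq_arc[of x c] peakon_deriv_eq_arc[of x c] by (simp add: H_def H0_def)
  have Hper: "periodic1 H"
    using ac_derivD(1,2)[OF aW] ac_derivD(1,2)[OF ac_deriv_peakon[of c]] by (simp add: periodic1_def H_def)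
  have Hai: "H absolutely_integrable_on {0..1}"
    by (rule absolutely_integrable_spike[OF H0ai negligible_finite[of "{1}"]]) (use HH0 in auto)
  have Heq: "H (x - \<xi>) = (w x - peakon c (x - \<xi>))\<^sup>2 + (deriv w x - peakon_deriv c (x - \<xi>))\<^sup>2" for x
    by (simp add: H_def W(2)) (simp add: W_def)
  have hai: "(\<lambda>x. H (x - \<xi>)) absolutely_integrable_on {0..1}"
    using absolutely_integrable_shift_real[OF periodic1_absolutely_integrable[OF Hper Hai, of "- \<xi>" "1 - \<xi>"], of "- \<xi>"] by simp
  have "(H1_norm (\<lambda>x. w' x - peakon c (x - \<xi>)))\<^sup>2 = integral {0..1} (\<lambda>x. H (x - \<xi>))"
    unfolding Heq
  proof (rule H1_norm_eq[OF ac_deriv_diff[OF aw ap]])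
    show "AE x in lebesgue. w' x - peakon c (x - \<xi>) = w x - peakon c (x - \<xi>)" using w'(1) by eventually_elim simp
    show "periodic1 (\<lambda>x. w' x - peakon c (x - \<xi>))" using w'(2) ac_derivD(1)[OF ap] by (simp add: periodic1_def)
  qed (use hai Heq in simp)
  also have "\<dots> = integral {- \<xi>..- \<xi> + 1} H"
    using integral_shift_real_ivl[of "- \<xi>" "- \<xi>" "- \<xi> + 1" H] by simp
  also have "\<dots> = integral {0..1} H" by (rule periodic1_integral[OF Hper Hai])
  also have "\<dots> = integral {0..1} H0"
    by (rule integral_spike[OF negligible_finite[of "{1}"], symmetric]) (use HH0 in auto)
  finally show ?thesis by (simp add: H0_def[abs_def])
qed

lemma profile_e_half: "profile_e (1/2) = sinh 1" "profile_n (1/2) = sinh 1 + 4 / 3 * sinh (1/2) ^ 3 * cosh (1/2)"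
  by (simp_all add: profile_e_def profile_n_def)

lemma sinh_1: "sinh 1 = 2 * sinh (1/2) * cosh (1/2 :: real)"
  using sinh_double[of "1/2 :: real"] by simp

lemma peakon_arc_ends: "peakon_arc c 0 = peakon_min c * cosh (1/2)" "peakon_arc c 1 = peakon_min c * cosh (1/2)"
  "peakon_arc' c 0 = - (peakon_min c * sinh (1/2))" "peakon_arc' c 1 = peakon_min c * sinh (1/2)"
  using cosh_minus[of "1/2 :: real"] sinh_minus[of "1/2 :: real"] by (simp_all add: peakon_arc_def peakon_arc'_def)

text \<open>Between the kinks \<phi>'' = \<phi>, so the cross term \<phi> W + \<phi>' W' is the
  derivative of \<phi>' W, and only the jump of \<phi>' at the peak, of size twice
  \<open>peakon_min c * sinh (1/2)\<close>, survives.\<close>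

lemma peakon_energy_identity:
  assumes W: "circle_C1 W"
  shows "integral {0..1} (\<lambda>x. (W x - peakon_arc c x)\<^sup>2 + (deriv W x - peakon_arc' c x)\<^sup>2)
    = energy W + (peakon_min c)\<^sup>2 * profile_e (1/2) - 4 * peakon_min c * sinh (1/2) * W 0"
proof -
  note cW = circle_C1_continuous[OF W]
  have dW: "(W has_real_derivative deriv W x) (at x)" for x
    using W ac_deriv_has_real_derivative unfolding circle_C1_def by blast
  have W1: "W 1 = W 0" using circle_C1_frac[OF W, of 1] by simp
  have ftc: "(g has_integral G 1 - G 0) {0..1}" if "\<And>x. (G has_real_derivative g x) (at x)" for G g :: "real \<Rightarrow> real"
    using that by (intro fundamental_theorem_of_calculus)
      (auto simp: has_real_derivative_iff_has_vector_derivative has_vector_derivative_at_within)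
  have cross: "((\<lambda>x. peakon_arc c x * W x + peakon_arc' c x * deriv W x) has_integral 2 * peakon_min c * sinh (1/2) * W 0) {0..1}"
    using ftc[OF DERIV_mult[OF peakon_arc_deriv(2)[of c] dW]] by (simp add: peakon_arc_ends W1 algebra_simps)
  have "((\<lambda>x. peakon_arc c x * peakon_arc c x + peakon_arc' c x * peakon_arc' c x) has_integral
      peakon_arc' c 1 * peakon_arc c 1 - peakon_arc' c 0 * peakon_arc c 0) {0..1}"
    using ftc[OF DERIV_mult[OF peakon_arc_deriv(2)[of c] peakon_arc_deriv(1)[of c]]] by (simp add: algebra_simps)
  then have sq: "((\<lambda>x. peakon_arc c x * peakon_arc c x + peakon_arc' c x * peakon_arc' c x) has_integral
      (peakon_min c)\<^sup>2 * profile_e (1/2)) {0..1}"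
    by (simp add: peakon_arc_ends profile_e_half sinh_1 power2_eq_square algebra_simps)
  have E: "((\<lambda>x. (W x)\<^sup>2 + (deriv W x)\<^sup>2) has_integral energy W) {0..1}"
    unfolding energy_def by (intro integrable_integral integrable_continuous_real continuous_intros cW)
  from has_integral_diff[OF has_integral_add[OF E sq] has_integral_mult_right[OF cross, of 2]]
  show ?thesis
    by (intro integral_unique) (simp add: power2_eq_square algebra_simps)
qed

lemma integral_quartic_peakon:
  "integral {0..1} (\<lambda>x. quartic_density (peakon_arc c x) (peakon_arc' c x))
    = peakon_min c ^ 4 * profile_n (1/2)"
proof -
  \<comment> \<open>With S = sinh and C = cosh the density is, up to
    \<open>peakon_min c ^ 4\<close>, 1 + 4 S^2 + 8/3 S^4, while (S C)' = 1 + 2 S^2 and (S^3 C)' = 3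
    S^2 + 4 S^4. The minus sign comes from the argument 1/2 - x.\<close>
  define A where "A x = - (peakon_min c ^ 4) * (sinh (1/2 - x) * cosh (1/2 - x) + 2 / 3 * (sinh (1/2 - x) ^ 3 * cosh (1/2 - x)))" for x
  have "((\<lambda>x. quartic_density (peakon_arc c x) (peakon_arc' c x)) has_integral A 1 - A 0) {0..1}"
  proof (rule fundamental_theorem_of_calculus)
    fix x :: real
    define S C where "S = sinh (1/2 - x)" and "C = cosh (1/2 - x)"
    have C2: "C * C = 1 + S * S" using cosh_square_eq[of "1/2 - x"] by (simp add: S_def C_def power2_eq_square)
    have d: "(A has_real_derivative - (peakon_min c ^ 4) * (- (C * C) - S * S + 2 / 3 * (- (3 * S\<^sup>2 * C * C) - S ^ 3 * S))) (at x)"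
      unfolding A_def[abs_def] S_def C_def by (auto intro!: derivative_eq_intros simp: field_simps)
    have eq: "- (C * C) - S * S + 2 / 3 * (- (3 * S\<^sup>2 * C * C) - S ^ 3 * S) =
      - ((C * C) * (C * C) + 2 * (C * C) * (S * S) - (S * S) * (S * S) / 3)"
    proof -
      have e: "3 * S\<^sup>2 * C * C = 3 * (S * S) * (C * C)" "S ^ 3 * S = (S * S) * (S * S)"
        by (simp_all add: power2_eq_square power3_eq_cube)
      show ?thesis unfolding e C2 by (simp add: field_simps)
    qed
    have "- (peakon_min c ^ 4) * - ((C * C) * (C * C) + 2 * (C * C) * (S * S) - (S * S) * (S * S) / 3) =
        quartic_density (peakon_arc c x) (peakon_arc' c x)"
      by (simp add: peakon_arc_def peakon_arc'_def S_def C_def power4_eq_xxxx power2_eq_square algebra_simps)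
    with d[unfolded eq] have "(A has_real_derivative quartic_density (peakon_arc c x) (peakon_arc' c x)) (at x)"
      by (simp only:)
    then show "(A has_vector_derivative quartic_density (peakon_arc c x) (peakon_arc' c x)) (at x within {0..1})"
      by (simp add: has_real_derivative_iff_has_vector_derivative has_vector_derivative_at_within)
  qed simp
  moreover have "A 1 - A 0 = peakon_min c ^ 4 * profile_n (1/2)"
    using cosh_minus[of "1/2 :: real"] sinh_minus[of "1/2 :: real"]
    by (simp add: A_def profile_e_half sinh_1 field_simps)
  ultimately show ?thesis by (simp add: integral_unique)
qed

subsection \<open>Orbital stability\<close>

text \<open>On an interval of length 1 the difference and its derivative have mean absolute value at
  most d. Somewhere the difference is no larger than its mean, and from there it changes by at most
  the mean of its derivative: together 2 d.\<close>

lemma peakon_arc_close: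
  assumes W: "circle_C1 W" and d: "d > 0"
    and I: "integral {0..1} (\<lambda>x. (W x - peakon_arc c x)\<^sup>2 + (deriv W x - peakon_arc' c x)\<^sup>2) \<le> d\<^sup>2"
  shows "x \<in> {0..1} \<Longrightarrow> \<bar>W x - peakon_arc c x\<bar> \<le> 2 * d"
    "integral {0..1} (\<lambda>x. \<bar>deriv W x - peakon_arc' c x\<bar>) \<le> d"
proof -
  note [continuous_intros] = circle_C1_continuous[OF W]
  define g where "g x = W x - peakon_arc c x" for x
  define g1 where "g1 x = deriv W x - peakon_arc' c x" for x
  have cg [continuous_intros]: "continuous_on S g" "continuous_on S g1" for S
    unfolding g_def[abs_def] g1_def[abs_def] by (intro continuous_intros)+
  have dg: "(g has_real_derivative g1 x) (at x)" for x
    unfolding g_def[abs_def] g1_def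
    using W ac_deriv_has_real_derivative unfolding circle_C1_def by (blast intro: DERIV_diff peakon_arc_deriv(1))
  have mean: "integral {0..1} (\<lambda>x. \<bar>h x\<bar>) \<le> d"
    if h: "continuous_on {0..1} h" and le: "\<And>x. (h x)\<^sup>2 \<le> (g x)\<^sup>2 + (g1 x)\<^sup>2" for h
  proof -
    have "integral {0..1} (\<lambda>x. \<bar>h x\<bar>) \<le> integral {0..1} (\<lambda>x. (inverse d * ((g x)\<^sup>2 + (g1 x)\<^sup>2) + d) / 2)"
    proof (rule integral_le)
      fix x :: real
      have "0 \<le> (\<bar>h x\<bar> - d)\<^sup>2 / d" using d by simp
      also have "\<dots> = inverse d * (h x)\<^sup>2 + d - 2 * \<bar>h x\<bar>" using d by (simp add: power2_eq_square field_simps)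
      also have "\<dots> \<le> inverse d * ((g x)\<^sup>2 + (g1 x)\<^sup>2) + d - 2 * \<bar>h x\<bar>"
        using le[of x] d by (intro diff_right_mono add_right_mono mult_left_mono) auto
      finally show "\<bar>h x\<bar> \<le> (inverse d * ((g x)\<^sup>2 + (g1 x)\<^sup>2) + d) / 2" by simp
    qed (use h in \<open>auto intro!: integrable_continuous_real continuous_intros\<close>)
    also have "\<dots> = (inverse d * integral {0..1} (\<lambda>x. (g x)\<^sup>2 + (g1 x)\<^sup>2) + d) / 2"
    proof -
      have "integral {0..1} (\<lambda>x. inverse d * ((g x)\<^sup>2 + (g1 x)\<^sup>2) + d) = inverse d * integral {0..1} (\<lambda>x. (g x)\<^sup>2 + (g1 x)\<^sup>2) + d"
        by (subst integral_add) (auto intro!: integrable_continuous_real continuous_intros)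
      then show ?thesis by simp
    qed
    also have "\<dots> \<le> (inverse d * d\<^sup>2 + d) / 2"
      using I d by (intro divide_right_mono add_right_mono mult_left_mono) (auto simp: g_def g1_def)
    also have "\<dots> = d" using d by (simp add: power2_eq_square)
    finally show ?thesis .
  qed
  have g1: "integral {0..1} (\<lambda>x. \<bar>g1 x\<bar>) \<le> d" by (rule mean) (auto intro!: continuous_intros)
  then show "integral {0..1} (\<lambda>x. \<bar>deriv W x - peakon_arc' c x\<bar>) \<le> d" by (simp add: g1_def)
  have g: "integral {0..1} (\<lambda>x. \<bar>g x\<bar>) \<le> d" by (rule mean) (auto intro!: continuous_intros)
  have int1: "(\<lambda>x. \<bar>g1 x\<bar>) integrable_on {p..q}" for p q by (intro integrable_continuous_real continuous_intros)
  have incr: "\<bar>g q - g p\<bar> \<le> d" if "0 \<le> p" "p \<le> q" "q \<le> 1" for p q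
  proof -
    have "(g1 has_integral g q - g p) {p..q}"
      using dg by (intro fundamental_theorem_of_calculus that)
        (simp add: has_real_derivative_iff_has_vector_derivative has_vector_derivative_at_within)
    then have "\<bar>g q - g p\<bar> = norm (integral {p..q} g1)" by (simp add: integral_unique)
    also have "\<dots> \<le> integral {p..q} (\<lambda>x. \<bar>g1 x\<bar>)"
      by (rule integral_norm_bound_integral) (auto intro!: integrable_continuous_real continuous_intros)
    also have "\<dots> \<le> integral {0..1} (\<lambda>x. \<bar>g1 x\<bar>)" by (rule integral_subset_le) (use that int1 in auto)
    finally show ?thesis using g1 by linarith
  qed
  obtain y where y: "y \<in> {0..1}" "\<And>x. x \<in> {0..1} \<Longrightarrow> \<bar>g y\<bar> \<le> \<bar>g x\<bar>"
    using continuous_attains_inf[of "{0..1}" "\<lambda>x. \<bar>g x\<bar>"] by (fastforce intro: continuous_intros)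
  have "integral {0..1} (\<lambda>x::real. \<bar>g y\<bar>) \<le> integral {0..1} (\<lambda>x. \<bar>g x\<bar>)"
    by (rule integral_le) (use y in \<open>auto intro!: integrable_continuous_real continuous_intros\<close>)
  then have gy: "\<bar>g y\<bar> \<le> d" using g by simp
  show "\<bar>W x - peakon_arc c x\<bar> \<le> 2 * d" if x: "x \<in> {0..1}"
  proof -
    have "\<bar>g x - g y\<bar> \<le> d" using incr[of x y] incr[of y x] x y(1) by (cases "x \<le> y") (auto simp: abs_minus_commute)
    then show ?thesis using gy by (simp add: g_def)
  qed
qed

text \<open>
  Factoring \<open>1 - \<partial>\<^sub>x\<^sup>2 = (1 + \<partial>\<^sub>x)(1 - \<partial>\<^sub>x)\<close>: both \<open>e\<^sup>x (w - w\<^sub>x)\<close> and \<open>-e\<^sup>-\<^sup>x (w + w\<^sub>x)\<close> are nondecreasing,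
  and periodicity of the second factors fixes their sign.
\<close>

lemma abs_deriv_le_if_momentum_nonneg:
  assumes w: "circle_C1 w" and w2: "ac_deriv (deriv w) w2" "continuous_on UNIV w2"
    and y: "\<And>x. w x - w2 x \<ge> 0"
  shows "\<bar>deriv w x\<bar> \<le> w x"
proof -
  have aw: "ac_deriv w (deriv w)" using w by (simp add: circle_C1_def)
  have d: "(w has_real_derivative deriv w x) (at x)" "(deriv w has_real_derivative w2 x) (at x)" for x
    using ac_deriv_has_real_derivative[OF aw circle_C1_continuous(2)[OF w]] ac_deriv_has_real_derivative[OF w2] by auto
  have per: "w (x + 1) = w x" "deriv w (x + 1) = deriv w x"
    using ac_derivD(1,2)[OF aw] by (auto simp: periodic1_def)
  have "exp x * (w x - deriv w x) \<le> exp (x + 1) * (w (x + 1) - deriv w (x + 1))"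
  proof (rule DERIV_nonneg_imp_nondecreasing[of x "x + 1"])
    fix z
    have "((\<lambda>z. exp z * (w z - deriv w z)) has_real_derivative exp z * (w z - w2 z)) (at z)"
      by (auto intro!: derivative_eq_intros d simp: algebra_simps)
    then show "\<exists>D. ((\<lambda>z. exp z * (w z - deriv w z)) has_real_derivative D) (at z) \<and> 0 \<le> D"
      using y[of z] by (intro exI[of _ "exp z * (w z - w2 z)"]) auto
  qed simp
  then have "0 \<le> (exp (x + 1) - exp x) * (w x - deriv w x)" unfolding per by (simp add: algebra_simps)
  then have 1: "0 \<le> w x - deriv w x" by (simp add: zero_le_mult_iff)
  have "exp (- (x + 1)) * (w (x + 1) + deriv w (x + 1)) \<le> exp (- x) * (w x + deriv w x)"
  proof (rule DERIV_nonpos_imp_nonincreasing[of x "x + 1"])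
    fix z
    have "((\<lambda>z. exp (- z) * (w z + deriv w z)) has_real_derivative - (exp (- z) * (w z - w2 z))) (at z)"
      by (auto intro!: derivative_eq_intros d simp: algebra_simps)
    then show "\<exists>D. ((\<lambda>z. exp (- z) * (w z + deriv w z)) has_real_derivative D) (at z) \<and> D \<le> 0"
      using y[of z] by (intro exI[of _ "- (exp (- z) * (w z - w2 z))"]) auto
  qed simp
  then have "0 \<le> (exp (- x) - exp (- (x + 1))) * (w x + deriv w x)" unfolding per by (simp add: algebra_simps)
  then have "0 \<le> w x + deriv w x" by (simp add: zero_le_mult_iff)
  with 1 show ?thesis by linarith
qed

lemma abs_mult_diff_le:
  fixes a b a0 b0 B C :: real
  assumes "\<bar>a\<bar> \<le> B" "\<bar>b0\<bar> \<le> C"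
  shows "\<bar>a * b - a0 * b0\<bar> \<le> B * \<bar>b - b0\<bar> + C * \<bar>a - a0\<bar>"
proof -
  have "a * b - a0 * b0 = a * (b - b0) + b0 * (a - a0)" by (simp add: algebra_simps)
  also have "\<bar>\<dots>\<bar> \<le> \<bar>a\<bar> * \<bar>b - b0\<bar> + \<bar>b0\<bar> * \<bar>a - a0\<bar>"
    by (rule order_trans[OF abs_triangle_ineq]) (simp add: abs_mult)
  also have "\<dots> \<le> B * \<bar>b - b0\<bar> + C * \<bar>a - a0\<bar>" using assms by (intro add_mono mult_right_mono) auto
  finally show ?thesis .
qed

text \<open>The factor of |a - a0| is 4 from the first term and 2 * 2 from the second, in all 8;
  that of |b - b0| is 4 + 4/3.\<close>

lemma quartic_diff_bound:
  fixes a b a0 b0 B :: real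
  assumes B: "\<bar>a\<bar> \<le> B" "\<bar>b\<bar> \<le> B" "\<bar>a0\<bar> \<le> B" "\<bar>b0\<bar> \<le> B"
  shows "quartic_density a0 b0 - 8 * B ^ 3 * (\<bar>a - a0\<bar> + \<bar>b - b0\<bar>) \<le> quartic_density a b"
proof -
  have B0: "B \<ge> 0" using B(1) by linarith
  have sq: "\<bar>p\<^sup>2\<bar> \<le> B\<^sup>2" if "\<bar>p\<bar> \<le> B" for p using power_mono[OF that, of 2] by simp
  have sqd: "\<bar>p\<^sup>2 - p0\<^sup>2\<bar> \<le> 2 * B * \<bar>p - p0\<bar>" if "\<bar>p\<bar> \<le> B" "\<bar>p0\<bar> \<le> B" for p p0
    using abs_mult_diff_le[OF that, of p p0] by (simp add: power2_eq_square)
  have prod: "\<bar>p\<^sup>2 * r\<^sup>2 - p0\<^sup>2 * r0\<^sup>2\<bar> \<le> 2 * B ^ 3 * (\<bar>p - p0\<bar> + \<bar>r - r0\<bar>)"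
    if "\<bar>p\<bar> \<le> B" "\<bar>r\<bar> \<le> B" "\<bar>p0\<bar> \<le> B" "\<bar>r0\<bar> \<le> B" for p r p0 r0
  proof -
    have "\<bar>p\<^sup>2 * r\<^sup>2 - p0\<^sup>2 * r0\<^sup>2\<bar> \<le> B\<^sup>2 * \<bar>r\<^sup>2 - r0\<^sup>2\<bar> + B\<^sup>2 * \<bar>p\<^sup>2 - p0\<^sup>2\<bar>"
      by (rule abs_mult_diff_le) (use sq that in auto)
    also have "\<dots> \<le> B\<^sup>2 * (2 * B * \<bar>r - r0\<bar>) + B\<^sup>2 * (2 * B * \<bar>p - p0\<bar>)"
      by (intro add_mono mult_left_mono sqd that) auto
    finally show ?thesis by (simp add: power2_eq_square power3_eq_cube algebra_simps)
  qed
  have four: "p ^ 4 = p\<^sup>2 * p\<^sup>2" for p :: real by (simp add: power4_eq_xxxx power2_eq_square)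
  have "\<bar>a ^ 4 - a0 ^ 4\<bar> \<le> 4 * (B ^ 3 * \<bar>a - a0\<bar>)" "\<bar>b ^ 4 - b0 ^ 4\<bar> \<le> 4 * (B ^ 3 * \<bar>b - b0\<bar>)"
    using prod[OF B(1,1,3,3)] prod[OF B(2,2,4,4)] unfolding four by simp_all
  moreover have "\<bar>a\<^sup>2 * b\<^sup>2 - a0\<^sup>2 * b0\<^sup>2\<bar> \<le> 2 * (B ^ 3 * \<bar>a - a0\<bar>) + 2 * (B ^ 3 * \<bar>b - b0\<bar>)"
    using prod[OF B] by (simp only: distrib_left mult.assoc)
  moreover have "B ^ 3 * \<bar>a - a0\<bar> \<ge> 0" "B ^ 3 * \<bar>b - b0\<bar> \<ge> 0" using B0 by simp_all
  ultimately show ?thesis unfolding abs_le_iff mult.assoc distrib_left by linarith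
qed

lemma peakon_min_pos: "c > 0 \<Longrightarrow> peakon_min c > 0" by (simp add: peakon_min_def)

lemma peakon_arc_bounds:
  assumes c: "c > 0" and x: "x \<in> {0..1}"
  shows "peakon_min c \<le> peakon_arc c x" "peakon_arc c x \<le> sqrt c" "\<bar>peakon_arc' c x\<bar> \<le> sqrt c"
proof -
  note m = peakon_min_pos[OF c]
  show "peakon_min c \<le> peakon_arc c x" using m cosh_real_ge_1[of "1/2 - x"] by (simp add: peakon_arc_def)
  have "cosh (1/2 - x) = cosh \<bar>1/2 - x\<bar>" by (simp add: abs_if cosh_minus)
  also have "\<dots> \<le> cosh (1/2)"
  proof (rule cosh_real_nonneg_le_iff[THEN iffD2])
    show "\<bar>1/2 - x\<bar> \<le> 1/2" using x unfolding abs_le_iff by auto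
  qed auto
  finally have "cosh (1/2 - x) \<le> cosh (1/2)" .
  then show le: "peakon_arc c x \<le> sqrt c" using c by (simp add: peakon_arc_def peakon_min_def field_simps)
  have "\<bar>sinh (1/2 - x)\<bar> \<le> cosh (1/2 - x)"
    using sinh_less_cosh_real[of "1/2 - x"] sinh_less_cosh_real[of "- (1/2 - x)"]
    by (simp add: abs_if sinh_minus cosh_minus del: minus_diff_eq)
  then have "\<bar>peakon_arc' c x\<bar> \<le> peakon_arc c x" using m by (simp add: peakon_arc_def peakon_arc'_def abs_mult)
  then show "\<bar>peakon_arc' c x\<bar> \<le> sqrt c" using le by simp
qed

text \<open>The bound of w_x by w turns the uniform bound on w into one on w_x, so the quartic
  density is Lipschitz on the range at hand. The factor 24 is 8 times 3: w is within 2 d uniformly,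
  w_x within d in the mean.\<close>

lemma quartic_energy_near_peakon:
  assumes c: "c > 0" and w: "circle_C1 w" and b: "\<And>x. \<bar>deriv w x\<bar> \<le> w x" and d: "0 < d" "d \<le> 1"
    and I: "integral {0..1} (\<lambda>x. (w x - peakon_arc c x)\<^sup>2 + (deriv w x - peakon_arc' c x)\<^sup>2) \<le> d\<^sup>2"
  shows "quartic_energy w \<ge> peakon_min c ^ 4 * profile_n (1/2) - 24 * (sqrt c + 2) ^ 3 * d"
proof -
  note [continuous_intros] = circle_C1_continuous[OF w]
  \<comment> \<open>sqrt c bounds the peakon and its derivative, and w exceeds the peakon by at most
    2 d <= 2.\<close>
  define B where "B = sqrt c + 2"
  have B0: "B > 0" using c by (simp add: B_def add_pos_pos)
  note close = peakon_arc_close[OF w d(1) I]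
  let ?Q = "\<lambda>x. quartic_density (peakon_arc c x) (peakon_arc' c x)"
  let ?r = "\<lambda>x. \<bar>deriv w x - peakon_arc' c x\<bar>"
  have "peakon_min c ^ 4 * profile_n (1/2) - 24 * B ^ 3 * d \<le> integral {0..1} ?Q - 8 * B ^ 3 * (2 * d + integral {0..1} ?r)"
  proof -
    have "8 * B ^ 3 * (2 * d + integral {0..1} ?r) \<le> 8 * B ^ 3 * (2 * d + d)"
      using B0 close(2) by (intro mult_left_mono add_left_mono) auto
    then show ?thesis using integral_quartic_peakon[of c] by simp
  qed
  also have "\<dots> = integral {0..1} (\<lambda>x. ?Q x - 8 * B ^ 3 * (2 * d + ?r x))"
  proof -
    have "integral {0..1} (\<lambda>x. 2 * d + ?r x) = 2 * d + integral {0..1} ?r"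
      by (subst integral_add) (auto intro!: integrable_continuous_real continuous_intros)
    moreover have "integral {0..1} (\<lambda>x. ?Q x - 8 * B ^ 3 * (2 * d + ?r x)) =
        integral {0..1} ?Q - integral {0..1} (\<lambda>x. 8 * B ^ 3 * (2 * d + ?r x))"
      by (rule integral_diff) (intro integrable_continuous_real continuous_intros; simp)+
    ultimately show ?thesis by simp
  qed
  also have "\<dots> \<le> quartic_energy w"
    unfolding quartic_energy_def
  proof (rule integral_le)
    fix x :: real assume x: "x \<in> {0..1}"
    note p = peakon_arc_bounds[OF c x]
    have wx: "0 \<le> w x" "w x \<le> B" using b[of x] close(1)[OF x] p(2) d by (auto simp: B_def)
    have "8 * B ^ 3 * (\<bar>w x - peakon_arc c x\<bar> + ?r x) \<le> 8 * B ^ 3 * (2 * d + ?r x)"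
      using B0 close(1)[OF x] by (intro mult_left_mono add_right_mono) auto
    moreover have "?Q x - 8 * B ^ 3 * (\<bar>w x - peakon_arc c x\<bar> + ?r x) \<le> quartic_density (w x) (deriv w x)"
      by (rule quartic_diff_bound) (use wx b[of x] p peakon_min_pos[OF c] in \<open>auto simp: B_def\<close>)
    ultimately show "?Q x - 8 * B ^ 3 * (2 * d + ?r x) \<le> quartic_density (w x) (deriv w x)"
      by linarith
  qed (intro integrable_continuous_real continuous_intros; simp)+
  finally show ?thesis by (simp add: B_def)
qed

lemma H1_norm_nonneg: "H1_norm f \<ge> 0"
  unfolding H1_norm_def set_lebesgue_integral_def by (intro real_sqrt_ge_zero integral_nonneg_AE) auto

text \<open>The uniform error 2 d is at most half the minimum of the peakon.\<close>

lemma circle_C1_ge_if_near_peakon: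
  assumes c: "c > 0" and W: "circle_C1 W" and d: "0 < d" "d \<le> peakon_min c / 4"
    and I: "integral {0..1} (\<lambda>x. (W x - peakon_arc c x)\<^sup>2 + (deriv W x - peakon_arc' c x)\<^sup>2) \<le> d\<^sup>2"
  shows "W x \<ge> peakon_min c / 2"
proof -
  have "\<bar>W (frac x) - peakon_arc c (frac x)\<bar> \<le> 2 * d" by (rule peakon_arc_close(1)[OF W d(1) I frac_mem])
  then have "W (frac x) \<ge> peakon_min c / 2" using peakon_arc_bounds(1)[OF c frac_mem, of x] d by linarith
  then show ?thesis using circle_C1_frac[OF W] by simp
qed

lemma initial_data_near_peakon:
  assumes c: "c > 0" and s: "s \<ge> 3" and sob: "sobolev s u\<^sub>0" and y: "AE x in lebesgue. momentum u\<^sub>0 x \<ge> 0"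
    and w: "continuous_on UNIV w" "sobolev s w" "AE x in lebesgue. w x = u\<^sub>0 x"
    and d: "0 < d" "d \<le> 1" "d \<le> peakon_min c / 4" and H: "H1_norm (\<lambda>x. u\<^sub>0 x - peakon c x) < d"
  shows "w x \<ge> peakon_min c / 2"
    "\<bar>energy w - (peakon_min c)\<^sup>2 * profile_e (1/2)\<bar> \<le> (1 + 8 * peakon_min c * sinh (1/2)) * d"
    "quartic_energy w \<ge> peakon_min c ^ 4 * profile_n (1/2) - 24 * (sqrt c + 2) ^ 3 * d"
proof -
  obtain f1 w2 f3 where f: "ac_deriv w f1" "ac_deriv f1 w2" "ac_deriv w2 f3"
    using sobolev_regular[OF w(2,1) s] by blast
  have W: "circle_C1 w" "deriv w = f1" using circle_C1I[OF f(1) ac_deriv_continuous[OF f(2)]] by auto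
  note m0 = peakon_min_pos[OF c]
  have u0w: "AE x in lebesgue. u\<^sub>0 x = w x" using w(3) by eventually_elim simp
  have "(H1_norm (\<lambda>x. u\<^sub>0 x - peakon c (x - 0)))\<^sup>2 =
      integral {0..1} (\<lambda>x. (w (x + 0) - peakon_arc c x)\<^sup>2 + (deriv (\<lambda>x. w (x + 0)) x - peakon_arc' c x)\<^sup>2)"
    by (rule H1_norm_diff_peakon[OF W(1) u0w sobolev_imp(2)[OF sob]])
  then have Heq: "(H1_norm (\<lambda>x. u\<^sub>0 x - peakon c x))\<^sup>2 =
      integral {0..1} (\<lambda>x. (w x - peakon_arc c x)\<^sup>2 + (deriv w x - peakon_arc' c x)\<^sup>2)" by simp
  have D: "(H1_norm (\<lambda>x. u\<^sub>0 x - peakon c x))\<^sup>2 \<le> d\<^sup>2" using H H1_norm_nonneg by (intro power_mono) auto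
  then have I: "integral {0..1} (\<lambda>x. (w x - peakon_arc c x)\<^sup>2 + (deriv w x - peakon_arc' c x)\<^sup>2) \<le> d\<^sup>2"
    unfolding Heq .
  show "w x \<ge> peakon_min c / 2" by (rule circle_C1_ge_if_near_peakon[OF c W(1) d(1,3) I])
  \<comment> \<open>The sign of the momentum is given almost everywhere and for
    \<open>u\<^sub>0\<close>; it is carried over to w, where continuity of w and w2 makes it hold
    everywhere.\<close>
  have "AE x in lebesgue. 0 \<le> w x - w2 x"
  proof -
    have wd: "weak_deriv u\<^sub>0 = weak_deriv w"
      by (rule weak_deriv_cong[OF u0w sobolev_imp(2)[OF sob] sobolev_imp(2)[OF w(2)]])
    from u0w have "AE x in lebesgue. momentum u\<^sub>0 x = momentum w x"
      by eventually_elim (simp add: momentum_def wd)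
    then show ?thesis using y momentum_eq(1)[OF f(1,2)] by eventually_elim simp
  qed
  then obtain N where N: "negligible N" "\<And>x. x \<notin> N \<Longrightarrow> 0 \<le> w x - w2 x" by (rule AE_lebesgueE) blast
  have c2: "continuous_on UNIV w2" by (rule ac_deriv_continuous[OF f(3)])
  have "open {x. w x < w2 x}" by (intro open_Collect_less w(1) c2)
  moreover have "negligible {x. w x < w2 x}" by (rule negligible_subset[OF N(1)]) (use N(2) in force)
  ultimately have "{x. w x < w2 x} = {}" using open_not_negligible by blast
  then have "\<And>x. w x - w2 x \<ge> 0" by (simp add: not_less)
  note b = abs_deriv_le_if_momentum_nonneg[OF W(1) f(2)[folded W(2)] c2 this]
  show "quartic_energy w \<ge> peakon_min c ^ 4 * profile_n (1/2) - 24 * (sqrt c + 2) ^ 3 * d"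
    by (rule quartic_energy_near_peakon[OF c W(1) b d(1,2) I])
  define E0 where "E0 = (peakon_min c)\<^sup>2 * profile_e (1/2)"
  let ?A = "4 * peakon_min c * sinh (1/2)"
  have A: "?A > 0" using m0 by simp
  have A2: "?A * peakon_arc c 0 = 2 * E0"
    by (simp add: E0_def peakon_arc_ends profile_e_half sinh_1 power2_eq_square)
  \<comment> \<open>The energy identity read backwards: the distance is small and so is the
    difference of heights, at most 2 d. That 2 and the 4 in \<open>?A\<close> give the constant
    8.\<close>
  have "energy w - E0 = integral {0..1} (\<lambda>x. (w x - peakon_arc c x)\<^sup>2 + (deriv w x - peakon_arc' c x)\<^sup>2)
      + ?A * (w 0 - peakon_arc c 0)"
    using peakon_energy_identity[OF W(1), of c] A2 by (simp add: E0_def algebra_simps)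
  also have "\<bar>\<dots>\<bar> \<le> d\<^sup>2 + ?A * (2 * d)"
  proof -
    have "\<bar>?A * (w 0 - peakon_arc c 0)\<bar> \<le> ?A * (2 * d)"
      unfolding abs_mult[of ?A] abs_of_pos[OF A] using A peakon_arc_close(1)[OF W(1) d(1) I, of 0] by (intro mult_left_mono) auto
    moreover have "integral {0..1} (\<lambda>x. (w x - peakon_arc c x)\<^sup>2 + (deriv w x - peakon_arc' c x)\<^sup>2) \<ge> 0"
      unfolding Heq[symmetric] by simp
    ultimately show ?thesis using I by (simp only: abs_le_iff) linarith
  qed
  also have "d\<^sup>2 \<le> d" using d mult_left_mono[of d 1 d] by (simp add: power2_eq_square)
  finally show "\<bar>energy w - (peakon_min c)\<^sup>2 * profile_e (1/2)\<bar> \<le> (1 + 8 * peakon_min c * sinh (1/2)) * d"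
    by (simp add: E0_def algebra_simps)
qed

text \<open>The infimum is nonexpansive for the sup norm; the margin e / 2 turns the weak inequality
  back into a strict one.\<close>

lemma tendsto_INF_uniform_limit:
  fixes u :: "'a \<Rightarrow> real \<Rightarrow> real"
  assumes lim: "uniform_limit {0..1} u f F" and cu: "\<forall>\<^sub>F r in F. continuous_on {0..1} (u r)" and cf: "continuous_on {0..1} f"
  shows "((\<lambda>r. INF x\<in>{0..1}. u r x) \<longlongrightarrow> (INF x\<in>{0..1}. f x)) F"
proof (rule tendstoI)
  fix e :: real assume e: "e > 0"
  have bdd: "bdd_below (g ` {0..1})" if "continuous_on {0..1} g" for g :: "real \<Rightarrow> real"
    using bounded_image_Icc[OF that] by (rule bounded_imp_bdd_below)
  have half: "(INF x\<in>{0..1}. g x) - e / 2 \<le> (INF x\<in>{0..1}. h x)"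
    if "continuous_on {0..1} g" "\<And>x. x \<in> {0..1} \<Longrightarrow> dist (g x) (h x) < e / 2" for g h :: "real \<Rightarrow> real"
  proof (rule cINF_greatest)
    fix x :: real assume x: "x \<in> {0..1}"
    have "(INF x\<in>{0..1}. g x) \<le> g x" by (rule cINF_lower[OF bdd[OF that(1)] x])
    then show "(INF x\<in>{0..1}. g x) - e / 2 \<le> h x"
      using that(2)[OF x] abs_ge_self[of "g x - h x"] unfolding dist_real_def by linarith
  qed simp
  from uniform_limitD[OF lim, of "e / 2"] e have "\<forall>\<^sub>F r in F. \<forall>x\<in>{0..1}. dist (u r x) (f x) < e / 2" by simp
  with cu show "\<forall>\<^sub>F r in F. dist (INF x\<in>{0..1}. u r x) (INF x\<in>{0..1}. f x) < e"
  proof eventually_elim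
    case (elim r)
    have "(INF x\<in>{0..1}. u r x) - e / 2 \<le> (INF x\<in>{0..1}. f x)" by (rule half) (use elim in auto)
    moreover have "(INF x\<in>{0..1}. f x) - e / 2 \<le> (INF x\<in>{0..1}. u r x)"
      by (rule half[OF cf]) (use elim in \<open>auto simp: dist_commute\<close>)
    ultimately show ?case using e unfolding dist_real_def by linarith
  qed
qed

theorem theorem1p1:
  fixes c s \<epsilon> :: real
  assumes "c > 0" and "s \<ge> 3" and "\<epsilon> > 0"
  shows "\<exists>\<delta>>0. \<forall>(u\<^sub>0 :: real \<Rightarrow> real) (u :: real \<Rightarrow> real \<Rightarrow> real) (\<xi> :: real \<Rightarrow> real).
    sobolev s u\<^sub>0 \<longrightarrow>
    (AE x in lebesgue. momentum u\<^sub>0 x \<ge> 0) \<longrightarrow>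
    H1_norm (\<lambda>x. u\<^sub>0 x - peakon c x) < \<delta> \<longrightarrow>
    global_strong_solution s u\<^sub>0 u \<longrightarrow>
    (\<forall>t\<ge>0. \<forall>x. u t x \<le> u t (\<xi> t)) \<longrightarrow>
    (SUP t\<in>{0..}. ereal (H1_norm (\<lambda>x. u t x - peakon c (x - \<xi> t)))) < ereal \<epsilon>"
proof -
  note c = assms(1) and s = assms(2)
  define m where "m = peakon_min c"
  have m: "m > 0" using peakon_min_pos[OF c] by (simp add: m_def)
  define A where "A = 4 * m * sinh (1/2)"
  have A: "A > 0" using m by (simp add: A_def)
  define E0 where "E0 = m\<^sup>2 * profile_e (1/2)"
  have AE0: "A * (m * cosh (1/2)) = 2 * E0"
    by (simp add: A_def E0_def profile_e_half sinh_1 power2_eq_square)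
  \<comment> \<open>\<epsilon> / 2 leaves room for the supremum, which may equal e; m / 4 makes
    closeness imply u >= m / 2.\<close>
  define e where "e = min (\<epsilon> / 2) (m / 4)"
  have e: "e > 0" "e < \<epsilon>" "e \<le> m / 4" using assms(3) m by (auto simp: e_def)
  \<comment> \<open>Budget for the squared distance E + E0 - A u(\<xi>): the energy contributes less
    than \<kappa> <= e^2 / 2 and the maximum at most A \<eta> = e^2 / 4, together below e^2.\<close>
  define \<eta> where "\<eta> = e\<^sup>2 / (4 * A)"
  have \<eta>: "\<eta> > 0" "A * \<eta> = e\<^sup>2 / 4" using e A by (simp_all add: \<eta>_def)
  obtain \<kappa>0 where \<kappa>0: "\<kappa>0 > 0" and stab: "\<And>w \<xi>. circle_C1 w \<Longrightarrow> (\<And>x. w x \<le> w \<xi>) \<Longrightarrow> (\<And>x. w x > 0) \<Longrightarrow>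
      \<bar>energy w - E0\<bar> < \<kappa>0 \<Longrightarrow> quartic_energy w > m ^ 4 * profile_n (1/2) - \<kappa>0 \<Longrightarrow> w \<xi> > m * cosh (1/2) - \<eta>"
    using maximum_stability[OF m \<eta>(1), folded E0_def] by blast
  define \<kappa> where "\<kappa> = min \<kappa>0 (e\<^sup>2 / 2)"
  have \<kappa>: "\<kappa> > 0" "\<kappa> \<le> \<kappa>0" "\<kappa> \<le> e\<^sup>2 / 2" using \<kappa>0 e by (auto simp: \<kappa>_def)
  \<comment> \<open>Dominates the initial error of both energies per unit of \<delta>.\<close>
  define K where "K = 1 + 2 * A + 24 * (sqrt c + 2) ^ 3"
  have B: "24 * (sqrt c + 2) ^ 3 > 0" using c by (simp add: add_pos_pos)
  have K: "K > 0" "1 + 2 * A \<le> K" "24 * (sqrt c + 2) ^ 3 \<le> K" using A B unfolding K_def by linarith+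
  define \<delta> where "\<delta> = min 1 (min (m / 4) (\<kappa> / (2 * K)))"
  have \<delta>: "\<delta> > 0" "\<delta> \<le> 1" "\<delta> \<le> m / 4" using m \<kappa> K by (auto simp: \<delta>_def)
  have "\<delta> \<le> \<kappa> / (2 * K)" by (simp add: \<delta>_def)
  then have "K * \<delta> \<le> \<kappa> / 2" using K(1) by (simp add: field_simps)
  then have "K * \<delta> < \<kappa>" using \<kappa>(1) by linarith
  then have K\<delta>: "(1 + 2 * A) * \<delta> < \<kappa>" "24 * (sqrt c + 2) ^ 3 * \<delta> < \<kappa>"
    using le_less_trans[OF mult_right_mono[OF K(2) less_imp_le[OF \<delta>(1)]]]
      le_less_trans[OF mult_right_mono[OF K(3) less_imp_le[OF \<delta>(1)]]] by blast+
  show ?thesis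
  proof (intro exI[of _ \<delta>] conjI allI impI \<delta>(1))
    fix u\<^sub>0 :: "real \<Rightarrow> real" and u :: "real \<Rightarrow> real \<Rightarrow> real" and \<xi> :: "real \<Rightarrow> real"
    assume sob: "sobolev s u\<^sub>0" and y: "AE x in lebesgue. momentum u\<^sub>0 x \<ge> 0"
      and H: "H1_norm (\<lambda>x. u\<^sub>0 x - peakon c x) < \<delta>" and glob: "global_strong_solution s u\<^sub>0 u"
      and max: "\<forall>t\<ge>0. \<forall>x. u t x \<le> u t (\<xi> t)"
    have sol: "strong_solution s T u\<^sub>0 u" if "T > 0" for T using glob that by (auto simp: global_strong_solution_def)
    have C1: "circle_C1 (u t)" if "t \<ge> 0" for t
      using strong_solution_C1[OF s sol[of "t + 1"]] that by simp
    have cons: "energy (u t) = energy (u 0)" "quartic_energy (u t) = quartic_energy (u 0)" if "t \<ge> 0" for t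
      using that by (auto intro: strong_solution_conserved[OF s sol[of "t + 1"]])
    have u0: "continuous_on UNIV (u 0)" "sobolev s (u 0)" "AE x in lebesgue. u 0 x = u\<^sub>0 x"
      using sol[of 1] by (auto simp: strong_solution_def sobolev_continuous_on_def)
    note init = initial_data_near_peakon[OF c s sob y u0 \<delta>(1,2) \<delta>(3)[unfolded m_def] H]
    have init_ge: "u 0 x \<ge> m / 2" for x using init(1) by (simp add: m_def)
    have "1 + 8 * m * sinh (1/2) = 1 + 2 * A" by (simp add: A_def)
    then have "\<bar>energy (u 0) - E0\<bar> < \<kappa>"
      using le_less_trans[OF init(2)[folded m_def, folded E0_def], of \<kappa>] K\<delta>(1) by metis
    moreover have "quartic_energy (u 0) > m ^ 4 * profile_n (1/2) - \<kappa>"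
      using less_le_trans[OF diff_strict_left_mono[OF K\<delta>(2)] init(3)[folded m_def]] .
    ultimately have energy: "\<bar>energy (u t) - E0\<bar> < \<kappa>" and quartic: "quartic_energy (u t) > m ^ 4 * profile_n (1/2) - \<kappa>"
      if "t \<ge> 0" for t
      using cons[OF that] by simp_all
    \<comment> \<open>Mere positivity at one time returns the quantitative bound m / 2 at that time;
      this improvement closes the continuity argument.\<close>
    have close: "H1_norm (\<lambda>x. u t x - peakon c (x - \<xi> t)) < e \<and> (\<forall>x. u t x \<ge> m / 2)"
      if t: "t \<ge> 0" and pos: "\<And>x. u t x > 0" for t
    proof -
      define W where "W = (\<lambda>x. u t (x + \<xi> t))"
      note W = circle_C1_shift[OF C1[OF t], of "\<xi> t", folded W_def]
      have "u t (\<xi> t) > m * cosh (1/2) - \<eta>"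
      proof (rule stab[OF C1[OF t] _ pos])
        show "u t x \<le> u t (\<xi> t)" for x using max t by blast
        show "\<bar>energy (u t) - E0\<bar> < \<kappa>0" "quartic_energy (u t) > m ^ 4 * profile_n (1/2) - \<kappa>0"
          using energy[OF t] quartic[OF t] \<kappa>(2) by linarith+
      qed
      then have "A * u t (\<xi> t) \<ge> A * (m * cosh (1/2) - \<eta>)" using A by (intro mult_left_mono) auto
      then have Amax: "A * u t (\<xi> t) \<ge> 2 * E0 - e\<^sup>2 / 4" by (simp add: right_diff_distrib AE0 \<eta>(2))
      have Heq: "(H1_norm (\<lambda>x. u t x - peakon c (x - \<xi> t)))\<^sup>2 =
          integral {0..1} (\<lambda>x. (W x - peakon_arc c x)\<^sup>2 + (deriv W x - peakon_arc' c x)\<^sup>2)"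
        unfolding W_def
      proof (rule H1_norm_diff_peakon[OF C1[OF t]])
        show "periodic1 (u t)" using C1[OF t] ac_derivD(1)[of "u t"] unfolding circle_C1_def by blast
      qed simp
      also have "\<dots> = energy (u t) + E0 - A * u t (\<xi> t)"
        unfolding peakon_energy_identity[OF W(1)] W(3) by (simp add: E0_def A_def m_def W_def)
      also have "\<dots> < e\<^sup>2" using energy[OF t] Amax \<kappa>(3) zero_less_power[OF e(1), of 2] by linarith
      finally have lt: "(H1_norm (\<lambda>x. u t x - peakon c (x - \<xi> t)))\<^sup>2 < e\<^sup>2" .
      then have "H1_norm (\<lambda>x. u t x - peakon c (x - \<xi> t)) < e" by (rule power2_less_imp_less) (use e in simp)
      moreover have "W x \<ge> m / 2" for x
        unfolding m_def
        by (rule circle_C1_ge_if_near_peakon[OF c W(1) e(1) e(3)[unfolded m_def]]) (use lt Heq in linarith)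
      then have "u t x \<ge> m / 2" for x using \<open>\<And>x. W x \<ge> m / 2\<close>[of "x - \<xi> t"] by (simp add: W_def)
      ultimately show ?thesis by blast
    qed
    define \<mu> where "\<mu> t = (INF x\<in>{0..1}. u t x)" for t
    have \<mu>_le: "\<mu> t \<le> u t x" if "t \<ge> 0" for t x
    proof -
      have "\<mu> t \<le> u t (frac x)" unfolding \<mu>_def
        by (rule cINF_lower[OF bounded_imp_bdd_below[OF bounded_image_Icc[OF circle_C1_continuous(1)[OF C1[OF that]]]] frac_mem])
      then show ?thesis using circle_C1_frac[OF C1[OF that]] by simp
    qed
    have \<mu>_ge: "\<mu> t \<ge> m / 2" if "\<And>x. u t x \<ge> m / 2" for t
      unfolding \<mu>_def by (rule cINF_greatest) (use that in auto)
    have pos: "u t x > 0" if t: "t \<ge> 0" for t x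
    proof -
      have cont: "continuous_on {0..t} \<mu>"
        unfolding continuous_on_def
      proof
        fix r assume r: "r \<in> {0..t}"
        have "uniform_limit {0..1} u (u r) (at r within {0..<t+1})"
          by (rule strong_solution_uniform_limit[OF s sol]) (use r in auto)
        moreover have "\<forall>\<^sub>F r' in at r within {0..<t+1}. continuous_on {0..1} (u r')"
          by (rule eventually_mono[OF eventually_at_within_mem]) (rule circle_C1_continuous(1)[OF C1], simp)
        ultimately have "(\<mu> \<longlongrightarrow> \<mu> r) (at r within {0..<t+1})" unfolding \<mu>_def
          by (rule tendsto_INF_uniform_limit) (rule circle_C1_continuous(1)[OF C1], use r in simp)
        then show "(\<mu> \<longlongrightarrow> \<mu> r) (at r within {0..t})" by (rule tendsto_within_subset) auto
      qed
      have "\<mu> t > 0"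
      proof (rule ccontr)
        assume "\<not> \<mu> t > 0"
        moreover have "\<mu> 0 \<ge> m / 2" by (rule \<mu>_ge[OF init_ge])
        \<comment> \<open>The minimum starts at m / 2 or above, so on losing positivity it would
          pass through m / 4. There u is still positive, and \<open>close\<close> forces the minimum
          to be at least m / 2.\<close>
        ultimately obtain r where r: "0 \<le> r" "r \<le> t" "\<mu> r = m / 4"
          using IVT2'[of \<mu> t "m / 4" 0] cont t m by auto
        have "u r x > 0" for x using \<mu>_le[OF r(1), of x] r(3) m by linarith
        then have "\<mu> r \<ge> m / 2" using close[OF r(1)] by (intro \<mu>_ge) blast
        then show False using r(3) m by simp
      qed
      then show ?thesis using \<mu>_le[OF t, of x] by linarith
    qed
    have "(SUP t\<in>{0..}. ereal (H1_norm (\<lambda>x. u t x - peakon c (x - \<xi> t)))) \<le> ereal e"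
    proof (rule SUP_least)
      fix t :: real assume "t \<in> {0..}"
      then show "ereal (H1_norm (\<lambda>x. u t x - peakon c (x - \<xi> t))) \<le> ereal e" using close[of t] pos[of t] by simp
    qed
    also have "\<dots> < ereal \<epsilon>" using e(2) by simp
    finally show "(SUP t\<in>{0..}. ereal (H1_norm (\<lambda>x. u t x - peakon c (x - \<xi> t)))) < ereal \<epsilon>" .
  qed
qed

end
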